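(* Let $N\ge 3$ and let $\alpha>0$ be fixed. There exists $\delta=\delta(\alpha)>0$ such that, for each $p\in(1,1+\delta)$, the problem $$-\Delta u=|x|^\alpha u^p \text{ in } B,\qquad u>0\text{ in }B,\qquad u=0\text{ on }\partial B$$ has a unique solution, which is radial and nondegenerate. Moreover its Morse index is equal to $1$.
   Context: $B$ is the open unit ball of $\mathbb R^N$ centered at the origin. A solution $u$ of the problem $-\Delta u=|x|^\alpha u^p$ in $B$, $u>0$ in $B$, $u=0$ on $\partial B$, is nondegenerate if the linearized problem $-\Delta v=p|x|^\alpha u^{p-1}v$ in $B$, $v=0$ on $\partial B$, has only the trivial solution. The Morse index of $u$ is the number of negative eigenvalues $\lambda$, counted with multiplicity, of $-\Delta v-p|x|^\alpha u^{p-1}v=\lambda v$ in $B$, $v=0$ on $\partial B$. *)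

theory Defs
  imports
    "HOL-Analysis.Analysis"
    "HOL-Library.Function_Algebras"
    "HOL-Library.Extended_Nat"
begin

definition partial :: "'a::euclidean_space \<Rightarrow> ('a \<Rightarrow> real) \<Rightarrow> 'a \<Rightarrow> real" where
  "partial b f x = frechet_derivative f (at x) b"

(* k-times continuous differentiability; only meant for open S. *)
fun Ck_on :: "nat \<Rightarrow> 'a::euclidean_space set \<Rightarrow> ('a \<Rightarrow> real) \<Rightarrow> bool" where
  "Ck_on 0 S f \<longleftrightarrow> continuous_on S f"
| "Ck_on (Suc k) S f \<longleftrightarrow>
     (\<forall>x\<in>S. f differentiable (at x)) \<and> (\<forall>b\<in>Basis. Ck_on k S (partial b f))"

definition laplacian :: "('a::euclidean_space \<Rightarrow> real) \<Rightarrow> 'a \<Rightarrow> real" where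
  "laplacian f x = (\<Sum>b\<in>Basis. partial b (partial b f) x)"

(* Functions of class C^2(B) and C^0(closure B), B the open unit ball, that vanish on the
   boundary.  A function on the closed ball is represented by its extension by zero, so
   that equality of HOL functions is equality on the closed ball. *)
definition dirichlet_class :: "('a::euclidean_space \<Rightarrow> real) set" where
  "dirichlet_class = {v. Ck_on 2 (ball 0 1) v \<and> continuous_on (cball 0 1) v \<and>
     (\<forall>x. x \<notin> ball 0 1 \<longrightarrow> v x = 0)}"

definition henon_solution :: "real \<Rightarrow> real \<Rightarrow> ('a::euclidean_space \<Rightarrow> real) \<Rightarrow> bool" where
  "henon_solution \<alpha> p u \<longleftrightarrow> u \<in> dirichlet_class \<and>
     (\<forall>x\<in>ball 0 1. u x > 0) \<and>
     (\<forall>x\<in>ball 0 1. - laplacian u x = norm x powr \<alpha> * u x powr p)"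

definition radial :: "('a::euclidean_space \<Rightarrow> real) \<Rightarrow> bool" where
  "radial u \<longleftrightarrow> (\<exists>\<phi>. \<forall>x\<in>ball 0 1. u x = \<phi> (norm x))"

definition nondegenerate :: "real \<Rightarrow> real \<Rightarrow> ('a::euclidean_space \<Rightarrow> real) \<Rightarrow> bool" where
  "nondegenerate \<alpha> p u \<longleftrightarrow>
     (\<forall>v\<in>dirichlet_class.
        (\<forall>x\<in>ball 0 1. - laplacian v x = p * norm x powr \<alpha> * u x powr (p - 1) * v x)
        \<longrightarrow> (\<forall>x. v x = 0))"

definition eigenspace ::
  "real \<Rightarrow> real \<Rightarrow> ('a::euclidean_space \<Rightarrow> real) \<Rightarrow> real \<Rightarrow> ('a \<Rightarrow> real) set" where
  "eigenspace \<alpha> p u lam =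
     {v \<in> dirichlet_class. \<forall>x\<in>ball 0 1.
        - laplacian v x - p * norm x powr \<alpha> * u x powr (p - 1) * v x = lam * v x}"

definition negative_eigenvalues ::
  "real \<Rightarrow> real \<Rightarrow> ('a::euclidean_space \<Rightarrow> real) \<Rightarrow> real set" where
  "negative_eigenvalues \<alpha> p u = {lam. lam < 0 \<and> (\<exists>v\<in>eigenspace \<alpha> p u lam. \<exists>x. v x \<noteq> 0)}"

(* Real-valued functions under pointwise addition (Function_Algebras) and scaling;
   the library has no real_vector instance for them. *)
interpretation fun_space: vector_space "\<lambda>(c::real) (f::'a \<Rightarrow> real) x. c * f x"
  by unfold_locales (auto simp: fun_eq_iff algebra_simps)

(* The multiplicity of an eigenvalue is the dimension of its eigenspace.  The infinite case
   is split off because card, sum and dim take junk values there. *)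
definition morse_index :: "real \<Rightarrow> real \<Rightarrow> ('a::euclidean_space \<Rightarrow> real) \<Rightarrow> enat" where
  "morse_index \<alpha> p u =
     (if finite (negative_eigenvalues \<alpha> p u) \<and>
         (\<forall>lam\<in>negative_eigenvalues \<alpha> p u.
            \<exists>S. finite S \<and> eigenspace \<alpha> p u lam \<subseteq> fun_space.span S)
      then enat (\<Sum>lam\<in>negative_eigenvalues \<alpha> p u. fun_space.dim (eigenspace \<alpha> p u lam))
      else \<infinity>)"

end

theory Submission
  imports Defs
begin

text \<open>All estimates rest on the maximum principle, an explicit barrier and the mean value inequality
  for superharmonic functions. They give, for \<open>p\<close> close to 1, bounds \<open>s c d \<le> u \<le> s K d\<close> for every
  solution \<open>u\<close> with maximum \<open>s\<close>, where \<open>d = 1 - |x|\<^sup>2\<close>, together with \<open>s\<^sup>p\<^sup>-\<^sup>1 \<le> K\<close>. Two solutions, or a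
  solution and an eigenfunction of the linearised problem with eigenvalue in \<open>[-(p - 1) K, 0]\<close>,
  satisfy almost the same linear equation up to an error of order \<open>p - 1\<close>. By a Birkhoff type
  contraction the oscillation of their quotient is at most \<open>O(p - 1)\<close> times the size of the
  quotient. For two solutions this forces equality; an eigenfunction must vanish or have a sign, and
  eigenfunctions of constant sign belong to a single eigenvalue. Existence follows by solving the
  radial initial value problem: the solution has a zero because of the a priori bound, and scaling
  moves the zero to 1. A positive radial eigenfunction with negative eigenvalue is found by shooting
  in the eigenvalue.\<close>

section \<open>The maximum principle\<close>

text \<open>The maximum s of a solution is not bounded as p tends to 1; only mu = s^(p-1) is, so all
  estimates are relative to s. Quotients of functions that both vanish on the sphere have to be
  controlled up to the boundary. This is why upper and lower bounds by the same d, with constants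
  independent of p, must be available before any comparison of solutions. The lower bound loses a
  factor mu^(-N), which enters the equation with exponent p - 1. The restriction p - 1 <= 1/(2N)
  makes this loss at most mu^(1/2), so half a power of mu survives and can be played against a fixed
  eigenvalue bound. Since the weight grows with |x|, moving planes do not give symmetry; radiality
  is read off from uniqueness together with the existence of one radial solution. Spectral theory is
  replaced by comparison: u itself is a positive strict supersolution of the linearised problem for
  every lambda < -(p-1)K, which excludes such eigenvalues. Simplicity and the sign of eigenfunctions
  come from optimal constants in inequalities m w <= v instead of orthogonality.\<close>

text \<open>\<open>G\<close> is the gradient and \<open>L\<close> the Laplacian, both carried as
  explicit data so that the calculus rules compute them syntactically. Continuity is asked of the
  diagonal Hessian entries, which are the ones that occur in the integration by parts behind the
  mean value inequality.\<close>

definition haslap ::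
  "'a::euclidean_space set \<Rightarrow> ('a \<Rightarrow> real) \<Rightarrow> ('a \<Rightarrow> 'a) \<Rightarrow> ('a \<Rightarrow> real) \<Rightarrow> bool" where
  "haslap S f G L \<longleftrightarrow> open S \<and> (\<forall>x\<in>S. (f has_derivative (\<lambda>h. G x \<bullet> h)) (at x)) \<and>
     (\<exists>H. (\<forall>x\<in>S. (G has_derivative H x) (at x)) \<and>
       (\<forall>b\<in>Basis. continuous_on S (\<lambda>x. H x b \<bullet> b)) \<and>
       (\<forall>x\<in>S. L x = (\<Sum>b\<in>Basis. H x b \<bullet> b)))"

lemma haslapI:
  assumes "open S" "\<And>x. x \<in> S \<Longrightarrow> (f has_derivative (\<lambda>h. G x \<bullet> h)) (at x)"
    "\<And>x. x \<in> S \<Longrightarrow> (G has_derivative H x) (at x)"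
    "\<And>b. b \<in> Basis \<Longrightarrow> continuous_on S (\<lambda>x. H x b \<bullet> b)"
    "\<And>x. x \<in> S \<Longrightarrow> L x = (\<Sum>b\<in>Basis. H x b \<bullet> b)"
  shows "haslap S f G L"
  using assms unfolding haslap_def by blast

lemma haslapE:
  assumes "haslap S f G L"
  obtains H where "open S" "\<And>x. x \<in> S \<Longrightarrow> (f has_derivative (\<lambda>h. G x \<bullet> h)) (at x)"
    "\<And>x. x \<in> S \<Longrightarrow> (G has_derivative H x) (at x)"
    "\<And>b. b \<in> Basis \<Longrightarrow> continuous_on S (\<lambda>x. H x b \<bullet> b)"
    "\<And>x. x \<in> S \<Longrightarrow> L x = (\<Sum>b\<in>Basis. H x b \<bullet> b)"
  using assms unfolding haslap_def by blast

lemma haslap_at: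
  assumes "haslap S f G L" "x \<in> S"
  obtains H where "(f has_derivative (\<lambda>h. G x \<bullet> h)) (at x)" "(G has_derivative H) (at x)"
    "L x = (\<Sum>b\<in>Basis. H b \<bullet> b)"
  using assms unfolding haslap_def by blast

lemma haslap_open: "haslap S f G L \<Longrightarrow> open S"
  by (simp add: haslap_def)

lemma haslap_subset: "haslap S f G L \<Longrightarrow> open T \<Longrightarrow> T \<subseteq> S \<Longrightarrow> haslap T f G L"
  unfolding haslap_def by (meson continuous_on_subset subsetD)

lemma haslap_continuous_on: "haslap S f G L \<Longrightarrow> continuous_on S f"
  by (meson haslap_at continuous_at_imp_continuous_on has_derivative_continuous)

lemma haslap_gradient_continuous_on: "haslap S f G L \<Longrightarrow> continuous_on S G"
  by (meson haslap_at continuous_at_imp_continuous_on has_derivative_continuous)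

lemma haslap_cong_lap:
  "haslap S f G L \<Longrightarrow> (\<And>x. x \<in> S \<Longrightarrow> L' x = L x) \<Longrightarrow> haslap S f G L'"
  unfolding haslap_def by simp

lemma haslap_add:
  assumes "haslap S f G L" "haslap S f' G' L'"
  shows "haslap S (\<lambda>x. f x + f' x) (\<lambda>x. G x + G' x) (\<lambda>x. L x + L' x)"
proof -
  obtain H where H: "open S" "\<And>x. x \<in> S \<Longrightarrow> (f has_derivative (\<lambda>h. G x \<bullet> h)) (at x)"
    "\<And>x. x \<in> S \<Longrightarrow> (G has_derivative H x) (at x)"
    "\<And>b. b \<in> Basis \<Longrightarrow> continuous_on S (\<lambda>x. H x b \<bullet> b)"
    "\<And>x. x \<in> S \<Longrightarrow> L x = (\<Sum>b\<in>Basis. H x b \<bullet> b)" by (rule haslapE[OF assms(1)]) (rule that)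
  obtain H' where H': "open S" "\<And>x. x \<in> S \<Longrightarrow> (f' has_derivative (\<lambda>h. G' x \<bullet> h)) (at x)"
    "\<And>x. x \<in> S \<Longrightarrow> (G' has_derivative H' x) (at x)"
    "\<And>b. b \<in> Basis \<Longrightarrow> continuous_on S (\<lambda>x. H' x b \<bullet> b)"
    "\<And>x. x \<in> S \<Longrightarrow> L' x = (\<Sum>b\<in>Basis. H' x b \<bullet> b)" by (rule haslapE[OF assms(2)]) (rule that)
  show ?thesis
  proof (rule haslapI[where H="\<lambda>x h. H x h + H' x h"])
    show "((\<lambda>x. f x + f' x) has_derivative (\<lambda>h. (G x + G' x) \<bullet> h)) (at x)" if "x \<in> S" for x
      using has_derivative_add[OF H(2)[OF that] H'(2)[OF that]] by (simp add: inner_add_left)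
    show "((\<lambda>x. G x + G' x) has_derivative (\<lambda>h. H x h + H' x h)) (at x)" if "x \<in> S" for x
      using has_derivative_add[OF H(3)[OF that] H'(3)[OF that]] .
    show "continuous_on S (\<lambda>x. (H x b + H' x b) \<bullet> b)" if "b \<in> Basis" for b
      using continuous_on_add[OF H(4)[OF that] H'(4)[OF that]] by (simp add: inner_add_left)
    show "L x + L' x = (\<Sum>b\<in>Basis. (H x b + H' x b) \<bullet> b)" if "x \<in> S" for x
      using H(5)[OF that] H'(5)[OF that] by (simp add: inner_add_left sum.distrib)
  qed (rule H(1))
qed

lemma haslap_mult:
  assumes "haslap S f G L" "haslap S g G' L'"
  shows "haslap S (\<lambda>x. f x * g x) (\<lambda>x. f x *\<^sub>R G' x + g x *\<^sub>R G x)
    (\<lambda>x. f x * L' x + g x * L x + 2 * (G x \<bullet> G' x))"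
proof -
  obtain H where H: "open S" "\<And>x. x \<in> S \<Longrightarrow> (f has_derivative (\<lambda>h. G x \<bullet> h)) (at x)"
    "\<And>x. x \<in> S \<Longrightarrow> (G has_derivative H x) (at x)"
    "\<And>b. b \<in> Basis \<Longrightarrow> continuous_on S (\<lambda>x. H x b \<bullet> b)"
    "\<And>x. x \<in> S \<Longrightarrow> L x = (\<Sum>b\<in>Basis. H x b \<bullet> b)" by (rule haslapE[OF assms(1)]) (rule that)
  obtain H' where H': "open S" "\<And>x. x \<in> S \<Longrightarrow> (g has_derivative (\<lambda>h. G' x \<bullet> h)) (at x)"
    "\<And>x. x \<in> S \<Longrightarrow> (G' has_derivative H' x) (at x)"
    "\<And>b. b \<in> Basis \<Longrightarrow> continuous_on S (\<lambda>x. H' x b \<bullet> b)"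
    "\<And>x. x \<in> S \<Longrightarrow> L' x = (\<Sum>b\<in>Basis. H' x b \<bullet> b)" by (rule haslapE[OF assms(2)]) (rule that)
  note c = haslap_continuous_on[OF assms(1)] haslap_continuous_on[OF assms(2)]
    haslap_gradient_continuous_on[OF assms(1)] haslap_gradient_continuous_on[OF assms(2)]
  show ?thesis
  proof (rule haslapI[where H="\<lambda>x h. (f x *\<^sub>R H' x h + (G x \<bullet> h) *\<^sub>R G' x) + (g x *\<^sub>R H x h + (G' x \<bullet> h) *\<^sub>R G x)"])
    fix x assume x: "x \<in> S"
    show "((\<lambda>x. f x * g x) has_derivative (\<lambda>h. (f x *\<^sub>R G' x + g x *\<^sub>R G x) \<bullet> h)) (at x)"
      using has_derivative_mult[OF H(2)[OF x] H'(2)[OF x]] by (simp add: inner_add_left mult.commute)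
    show "((\<lambda>x. f x *\<^sub>R G' x + g x *\<^sub>R G x) has_derivative
       (\<lambda>h. (f x *\<^sub>R H' x h + (G x \<bullet> h) *\<^sub>R G' x) + (g x *\<^sub>R H x h + (G' x \<bullet> h) *\<^sub>R G x))) (at x)"
      by (intro has_derivative_add has_derivative_scaleR H(2,3) H'(2,3) x)
    have "(\<Sum>b\<in>Basis. (G x \<bullet> b) * (G' x \<bullet> b)) = G x \<bullet> G' x"
      by (simp add: euclidean_inner[symmetric])
    moreover have "(\<Sum>b\<in>Basis. (G' x \<bullet> b) * (G x \<bullet> b)) = G x \<bullet> G' x"
      using euclidean_inner[of "G' x" "G x"] by (simp add: inner_commute)
    ultimately show "f x * L' x + g x * L x + 2 * (G x \<bullet> G' x) =
      (\<Sum>b\<in>Basis. ((f x *\<^sub>R H' x b + (G x \<bullet> b) *\<^sub>R G' x) + (g x *\<^sub>R H x b + (G' x \<bullet> b) *\<^sub>R G x)) \<bullet> b)"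
      using H(5)[OF x] H'(5)[OF x]
      by (simp add: inner_add_left sum.distrib flip: sum_distrib_left)
  next
    fix b :: 'a assume b: "b \<in> Basis"
    have "continuous_on S (\<lambda>x. (f x * (H' x b \<bullet> b) + (G x \<bullet> b) * (G' x \<bullet> b)) +
        (g x * (H x b \<bullet> b) + (G' x \<bullet> b) * (G x \<bullet> b)))"
      by (intro continuous_on_add continuous_on_mult continuous_on_inner continuous_on_const c H(4)[OF b] H'(4)[OF b])
    then show "continuous_on S (\<lambda>x. ((f x *\<^sub>R H' x b + (G x \<bullet> b) *\<^sub>R G' x) + (g x *\<^sub>R H x b + (G' x \<bullet> b) *\<^sub>R G x)) \<bullet> b)"
      by (simp add: inner_add_left)
  qed (rule H(1))
qed

lemma haslap_comp:
  assumes "haslap S f G L" 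
    and "\<And>x. x \<in> S \<Longrightarrow> (\<phi> has_real_derivative \<phi>' (f x)) (at (f x))"
    and "\<And>x. x \<in> S \<Longrightarrow> (\<phi>' has_real_derivative \<phi>'' (f x)) (at (f x))"
    and "continuous_on S (\<lambda>x. \<phi>'' (f x))"
  shows "haslap S (\<lambda>x. \<phi> (f x)) (\<lambda>x. \<phi>' (f x) *\<^sub>R G x)
    (\<lambda>x. \<phi>' (f x) * L x + \<phi>'' (f x) * (G x \<bullet> G x))"
proof -
  obtain H where H: "open S" "\<And>x. x \<in> S \<Longrightarrow> (f has_derivative (\<lambda>h. G x \<bullet> h)) (at x)"
    "\<And>x. x \<in> S \<Longrightarrow> (G has_derivative H x) (at x)"
    "\<And>b. b \<in> Basis \<Longrightarrow> continuous_on S (\<lambda>x. H x b \<bullet> b)"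
    "\<And>x. x \<in> S \<Longrightarrow> L x = (\<Sum>b\<in>Basis. H x b \<bullet> b)" by (rule haslapE[OF assms(1)]) (rule that)
  have D: "((\<lambda>x. \<phi>' (f x)) has_derivative (\<lambda>h. \<phi>'' (f x) * (G x \<bullet> h))) (at x)" if "x \<in> S" for x
    using has_derivative_compose[OF H(2)[OF that], of \<phi>' "(*) (\<phi>'' (f x))"] assms(3)[OF that]
    by (simp add: has_field_derivative_def)
  have c: "continuous_on S (\<lambda>x. \<phi>' (f x))"
    by (rule continuous_at_imp_continuous_on) (use D has_derivative_continuous in blast)
  show ?thesis
  proof (rule haslapI[where H="\<lambda>x h. \<phi>' (f x) *\<^sub>R H x h + (\<phi>'' (f x) * (G x \<bullet> h)) *\<^sub>R G x"])
    fix x assume x: "x \<in> S"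
    show "((\<lambda>x. \<phi> (f x)) has_derivative (\<lambda>h. (\<phi>' (f x) *\<^sub>R G x) \<bullet> h)) (at x)"
      using has_derivative_compose[OF H(2)[OF x], of \<phi> "(*) (\<phi>' (f x))"] assms(2)[OF x]
      by (simp add: has_field_derivative_def)
    show "((\<lambda>x. \<phi>' (f x) *\<^sub>R G x) has_derivative
       (\<lambda>h. \<phi>' (f x) *\<^sub>R H x h + (\<phi>'' (f x) * (G x \<bullet> h)) *\<^sub>R G x)) (at x)"
      by (rule has_derivative_scaleR[OF D[OF x] H(3)[OF x]])
    have "(\<Sum>b\<in>Basis. \<phi>'' (f x) * (G x \<bullet> b) * (G x \<bullet> b)) = \<phi>'' (f x) * (G x \<bullet> G x)"
      by (subst euclidean_inner) (simp add: sum_distrib_left mult.assoc)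
    then show "\<phi>' (f x) * L x + \<phi>'' (f x) * (G x \<bullet> G x) =
        (\<Sum>b\<in>Basis. (\<phi>' (f x) *\<^sub>R H x b + (\<phi>'' (f x) * (G x \<bullet> b)) *\<^sub>R G x) \<bullet> b)"
      using H(5)[OF x] by (simp add: inner_add_left sum.distrib sum_distrib_left)
  next
    fix b :: 'a assume b: "b \<in> Basis"
    have "continuous_on S (\<lambda>x. \<phi>' (f x) * (H x b \<bullet> b) + \<phi>'' (f x) * (G x \<bullet> b) * (G x \<bullet> b))"
      by (intro continuous_on_add continuous_on_mult continuous_on_inner continuous_on_const c H(4)[OF b]
          assms(4) haslap_gradient_continuous_on[OF assms(1)])
    then show "continuous_on S (\<lambda>x. (\<phi>' (f x) *\<^sub>R H x b + (\<phi>'' (f x) * (G x \<bullet> b)) *\<^sub>R G x) \<bullet> b)"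
      by (simp add: inner_add_left)
  qed (rule H(1))
qed

lemma haslap_const: "open S \<Longrightarrow> haslap S (\<lambda>x. c) (\<lambda>x. 0) (\<lambda>x. 0)"
  by (rule haslapI[where H="\<lambda>x h. 0"]) auto

lemma haslap_cmult:
  assumes "haslap S f G L" shows "haslap S (\<lambda>x. c * f x) (\<lambda>x. c *\<^sub>R G x) (\<lambda>x. c * L x)"
  using haslap_mult[OF haslap_const[OF haslap_open[OF assms], of c] assms] by simp

lemma haslap_diff:
  assumes "haslap S f G L" "haslap S f' G' L'"
  shows "haslap S (\<lambda>x. f x - f' x) (\<lambda>x. G x - G' x) (\<lambda>x. L x - L' x)"
  using haslap_add[OF assms(1) haslap_cmult[OF assms(2), of "-1"]] by simp

lemma haslap_dist_sq:
  "open S \<Longrightarrow> haslap S (\<lambda>x. (x - x0) \<bullet> (x - x0)) (\<lambda>x. 2 *\<^sub>R (x - x0)) (\<lambda>x. 2 * DIM('a))"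
  for x0 :: "'a::euclidean_space"
  by (rule haslapI[where H="\<lambda>x h. 2 *\<^sub>R h"])
    (auto intro!: derivative_eq_intros simp: inner_commute)

lemma haslap_one_minus_sq:
  "open S \<Longrightarrow> haslap S (\<lambda>x. 1 - (norm x)\<^sup>2) (\<lambda>x. - 2 *\<^sub>R x) (\<lambda>x. - 2 * DIM('a))"
  for S :: "'a::euclidean_space set"
  using haslap_diff[OF haslap_const[of S 1] haslap_dist_sq[of S 0]]
  by (simp add: power2_norm_eq_inner)

section \<open>Interior minima, comparison, and a quantitative Hopf lemma\<close>

lemma second_derivative_min:
  fixes g :: "real \<Rightarrow> real"
  assumes "e > 0" "\<And>t. \<bar>t\<bar> < e \<Longrightarrow> (g has_real_derivative g' t) (at t)"
    "(g' has_real_derivative l) (at 0)" "\<And>t. \<bar>t\<bar> < e \<Longrightarrow> g 0 \<le> g t"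
  shows "0 \<le> l"
proof (rule ccontr)
  assume "\<not> 0 \<le> l"
  then have l: "l < 0" by simp
  have "g' 0 = 0"
    using DERIV_local_min[OF assms(2)[of 0], of e] assms(1,4) by auto
  obtain d where d: "d > 0" "\<And>h. h > 0 \<Longrightarrow> h < d \<Longrightarrow> g' (0 + h) < g' 0"
    using DERIV_neg_dec_right[OF assms(3) l] by blast
  define t where "t = min d e / 2"
  have t: "0 < t" "t < d" "t < e" using d(1) assms(1) by (auto simp: t_def min_def)
  obtain z where z: "0 < z" "z < t" "g t - g 0 = (t - 0) * g' z"
    using MVT2[of 0 t g g'] t assms(2) by (metis abs_of_nonneg less_trans_Suc order.strict_trans1)
  have "g' z < 0" using d(2)[of z] z t \<open>g' 0 = 0\<close> by simp
  then have "g t < g 0" using z t by (smt (verit) mult_pos_neg)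
  with assms(4)[of t] t show False by simp
qed

text \<open>Along each coordinate line the restriction of \<open>f\<close> has a minimum, so every
  diagonal entry of the Hessian is nonnegative, and \<open>L x\<close> is their sum.\<close>

lemma haslap_local_min:
  assumes "haslap S f G L" "x \<in> S" "e > 0" "\<And>y. dist y x < e \<Longrightarrow> y \<in> S \<Longrightarrow> f x \<le> f y"
  shows "0 \<le> L x"
proof -
  obtain H where H: "(G has_derivative H) (at x)" "L x = (\<Sum>b\<in>Basis. H b \<bullet> b)"
    using haslap_at[OF assms(1,2)] .
  obtain e' where e': "e' > 0" "ball x e' \<subseteq> S"
    using haslap_open[OF assms(1)] assms(2) openE by blast
  have "0 \<le> H b \<bullet> b" if b: "b \<in> Basis" for b
  proof (rule second_derivative_min[of "min e e'" "\<lambda>t. f (x + t *\<^sub>R b)" "\<lambda>t. G (x + t *\<^sub>R b) \<bullet> b"])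
    show "0 < min e e'" using assms e' by simp
    have nb: "norm b = 1" using b by simp
    have mem: "x + t *\<^sub>R b \<in> S" if "\<bar>t\<bar> < min e e'" for t
      using that e' nb by (auto simp: dist_norm intro!: subsetD[OF e'(2)])
    show "((\<lambda>t. f (x + t *\<^sub>R b)) has_real_derivative G (x + t *\<^sub>R b) \<bullet> b) (at t)"
      if t: "\<bar>t\<bar> < min e e'" for t
    proof -
      have "(f has_derivative (\<lambda>h. G (x + t *\<^sub>R b) \<bullet> h)) (at (x + t *\<^sub>R b))"
        by (rule haslap_at[OF assms(1) mem[OF t]])
      moreover have "((\<lambda>t. x + t *\<^sub>R b) has_derivative (\<lambda>h. h *\<^sub>R b)) (at t)"
        by (auto intro!: derivative_eq_intros)
      ultimately have "((\<lambda>t. f (x + t *\<^sub>R b)) has_derivative (\<lambda>h. G (x + t *\<^sub>R b) \<bullet> (h *\<^sub>R b))) (at t)"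
        by (rule has_derivative_compose[rotated])
      then show ?thesis by (simp add: has_field_derivative_def mult_commute_abs)
    qed
    have "((\<lambda>t. x + t *\<^sub>R b) has_derivative (\<lambda>h. h *\<^sub>R b)) (at 0)"
      by (auto intro!: derivative_eq_intros)
    from has_derivative_compose[OF this, of G H] H(1)
    have "((\<lambda>t. G (x + t *\<^sub>R b)) has_derivative (\<lambda>h. H (h *\<^sub>R b))) (at 0)" by simp
    from has_derivative_inner_left[OF this, of b]
    have "((\<lambda>t. G (x + t *\<^sub>R b) \<bullet> b) has_derivative (\<lambda>h. H (h *\<^sub>R b) \<bullet> b)) (at 0)" .
    moreover have "linear H" using H(1) has_derivative_linear by blast
    ultimately show "((\<lambda>t. G (x + t *\<^sub>R b) \<bullet> b) has_real_derivative H b \<bullet> b) (at 0)"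
      by (simp add: has_field_derivative_def linear_scale mult_commute_abs)
    show "f (x + 0 *\<^sub>R b) \<le> f (x + t *\<^sub>R b)" if "\<bar>t\<bar> < min e e'" for t
      using assms(4)[OF _ mem[OF that]] that nb by (simp add: dist_norm)
  qed
  then show ?thesis using H(2) by (simp add: sum_nonneg)
qed

text \<open>Adding a small multiple of 1 - |x|^2, whose Laplacian is negative, makes the inequality
  strict, so a negative minimum contradicts \<open>haslap_local_min\<close>. The sign of
  \<open>L\<close> is required only where \<open>f\<close> is negative; this is what lets later
  applications absorb zero-order terms such as K f.\<close>

lemma weak_maximum_principle:
  fixes f :: "'a::euclidean_space \<Rightarrow> real"
  assumes f: "haslap S f G L" and T: "compact T" "S \<subseteq> T" "T \<subseteq> cball 0 1"
    and "continuous_on T f" "\<And>x. x \<in> T - S \<Longrightarrow> 0 \<le> f x"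
    and "\<And>x. x \<in> S \<Longrightarrow> f x < 0 \<Longrightarrow> L x \<le> 0" "z \<in> T"
  shows "0 \<le> f z"
proof (rule ccontr)
  assume neg: "\<not> 0 \<le> f z"
  \<comment> \<open>The perturbation is at most \<open>e\<close>, so half of the negative value at
    \<open>z\<close> survives.\<close>
  define e where "e = - f z / 2"
  have e: "e > 0" using neg by (simp add: e_def)
  define g where "g x = f x + e * (1 - (norm x)\<^sup>2)" for x
  have "continuous_on T g" unfolding g_def using assms(5) by (intro continuous_intros)
  then obtain x where x: "x \<in> T" "\<And>y. y \<in> T \<Longrightarrow> g x \<le> g y"
    using continuous_attains_inf[OF T(1), of g] assms(8) by blast
  have d: "0 \<le> 1 - (norm y)\<^sup>2" "1 - (norm y)\<^sup>2 \<le> 1" if "y \<in> T" for y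
    using that T(3) by (auto simp: power_le_one)
  have "g z \<le> f z + e * 1" unfolding g_def using d[OF assms(8)] e by (intro add_left_mono mult_left_mono) auto
  then have "g z < 0" using neg by (simp add: e_def)
  then have gx: "g x < 0" using x(2)[OF assms(8)] by simp
  have fx: "f x < 0" using gx d[OF x(1)] e unfolding g_def by (smt (verit) mult_nonneg_nonneg)
  then have xS: "x \<in> S" using assms(6) x(1) by force
  have "haslap S g (\<lambda>x. G x + e *\<^sub>R (- 2 *\<^sub>R x)) (\<lambda>x. L x + e * (- 2 * DIM('a)))"
    unfolding g_def by (intro haslap_add haslap_cmult haslap_one_minus_sq f haslap_open[OF f])
  from haslap_local_min[OF this xS, of 1] have "0 \<le> L x + e * (- 2 * DIM('a))"
    using x(2) T(2) by auto
  moreover have "L x \<le> 0" using assms(7) xS fx by blast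
  moreover have "e * real DIM('a) > 0" using e by simp
  ultimately show False by simp
qed

lemma weak_maximum_principle_ball:
  fixes f :: "'a::euclidean_space \<Rightarrow> real"
  assumes "haslap (ball 0 1) f G L" "continuous_on (cball 0 1) f" "\<And>x. norm x = 1 \<Longrightarrow> 0 \<le> f x"
    "\<And>x. norm x < 1 \<Longrightarrow> f x < 0 \<Longrightarrow> L x \<le> 0" "norm z \<le> 1"
  shows "0 \<le> f z"
  by (rule weak_maximum_principle[OF assms(1), of "cball 0 1"]) (use assms in auto)

text \<open>The barrier \<open>(1 - |x|\<^sup>2) |x - x0|\<^sup>-\<^sup>k\<close> decays only polynomially in the radius of the small ball,
  which is what makes the a priori bound below close up; for \<open>k = N\<close> it resembles the Poisson kernel.\<close>

lemma hopf_lower_bound: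
  fixes f :: "'a::euclidean_space \<Rightarrow> real" and k K r c :: real
  assumes f: "haslap (ball 0 1) f G L" and cont: "continuous_on (cball 0 1) f"
    and nonneg: "\<And>x. norm x \<le> 1 \<Longrightarrow> 0 \<le> f x"
    and L: "\<And>x. norm x < 1 \<Longrightarrow> L x \<le> K * f x" and "K \<ge> 0"
    and k: "k \<ge> DIM('a)" "k * (k - DIM('a)) \<ge> 4 * K"
    and r: "r > 0" "cball x0 r \<subseteq> ball 0 1"
    and c: "c \<ge> 0" "\<And>x. x \<in> cball x0 r \<Longrightarrow> c \<le> f x" and "norm z \<le> 1"
  shows "c * (r / 2) powr k * (1 - (norm z)\<^sup>2) \<le> f z"
proof -
  have x0: "norm x0 < 1" using r by (auto dest!: subsetD[of _ _ x0])
  have kpos: "k > 0" using k(1) DIM_positive[where 'a='a] by linarith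
  \<comment> \<open>A diameter of the small ball fits into the open unit ball. Hence (r/2)^k <= 1,
    and the claim is trivial for \<open>z\<close> inside the small ball.\<close>
  have r1: "r < 1" 
  proof -
    obtain b::'a where b: "b \<in> Basis" using nonempty_Basis by blast
    have "x0 + r *\<^sub>R b \<in> cball x0 r" "x0 - r *\<^sub>R b \<in> cball x0 r" using r b by (auto simp: dist_norm)
    then have "norm (x0 + r *\<^sub>R b) < 1" "norm (x0 - r *\<^sub>R b) < 1"
      using r(2) by (meson mem_ball_0 subsetD)+
    moreover have "norm ((x0 + r *\<^sub>R b) - (x0 - r *\<^sub>R b)) = 2 * r"
      using b r by (simp flip: scaleR_2)
    ultimately show ?thesis using norm_triangle_ineq4[of "x0 + r *\<^sub>R b" "x0 - r *\<^sub>R b"] by linarith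
  qed
  show ?thesis
  proof (cases "z \<in> ball x0 r")
    case True
    have "c \<le> f z" using c(2)[of z] True by auto
    moreover have "(r / 2) powr k \<le> 1" using r r1 kpos by (intro powr_le1) auto
    moreover have "0 \<le> 1 - (norm z)\<^sup>2" "1 - (norm z)\<^sup>2 \<le> 1" using assms(12) by (auto simp: power_le_one)
    ultimately have "c * (r / 2) powr k * (1 - (norm z)\<^sup>2) \<le> c * 1 * 1"
      using c by (intro mult_mono) auto
    then show ?thesis using \<open>c \<le> f z\<close> by simp
  next
    case False
    define S where "S = ball 0 1 - cball x0 r"
    define T where "T = cball 0 1 - ball x0 r"
    define q where "q x = ((x - x0) \<bullet> (x - x0)) powr (- k / 2)" for x :: 'a
    define b where "b x = (1 - (norm x)\<^sup>2) * q x" for x :: 'a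
    have oS: "open S" unfolding S_def by (intro open_Diff) auto
    define sq where "sq x = (x - x0) \<bullet> (x - x0)" for x
    have sqpos: "sq x > 0" if "x \<noteq> x0" for x using that unfolding sq_def by (simp add: inner_gt_zero_iff)
    have Sne: "x \<noteq> x0" if "x \<in> S" for x using that r unfolding S_def by auto
    \<comment> \<open>The barrier is built from the squared distance, which is a polynomial, so the
      exponent is halved.\<close>
    define j where "j = - k / 2"
    have hq: "haslap S (\<lambda>x. sq x powr j) (\<lambda>x. (j * sq x powr (j - 1)) *\<^sub>R (2 *\<^sub>R (x - x0)))
        (\<lambda>x. (j * sq x powr (j - 1)) * (2 * DIM('a))
           + (j * ((j - 1) * sq x powr (j - 1 - 1))) * ((2 *\<^sub>R (x - x0)) \<bullet> (2 *\<^sub>R (x - x0))))"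
      unfolding sq_def
    proof (rule haslap_comp[OF haslap_dist_sq[OF oS], where \<phi>="\<lambda>s. s powr j"
          and \<phi>'="\<lambda>s. j * s powr (j - 1)" and \<phi>''="\<lambda>s. j * ((j - 1) * s powr (j - 1 - 1))"])
      fix x assume "x \<in> S"
      then have p: "0 < (x - x0) \<bullet> (x - x0)" using Sne sqpos sq_def by metis
      show "((\<lambda>s. s powr j) has_real_derivative j * ((x - x0) \<bullet> (x - x0)) powr (j - 1)) (at ((x - x0) \<bullet> (x - x0)))"
        using p by (intro has_real_derivative_powr)
      show "((\<lambda>s. j * s powr (j - 1)) has_real_derivative
          j * ((j - 1) * ((x - x0) \<bullet> (x - x0)) powr (j - 1 - 1))) (at ((x - x0) \<bullet> (x - x0)))"
        using p by (intro DERIV_cmult has_real_derivative_powr)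
    next
      show "continuous_on S (\<lambda>x. j * ((j - 1) * ((x - x0) \<bullet> (x - x0)) powr (j - 1 - 1)))"
        using Sne by (intro continuous_intros) auto
    qed
    have qsq: "q = (\<lambda>x. sq x powr j)" by (auto simp: q_def sq_def j_def)
    define D where "D x = 1 - (norm x)\<^sup>2" for x :: 'a
    let ?Lb = "\<lambda>x. D x * ((j * sq x powr (j - 1)) * (2 * DIM('a))
           + (j * ((j - 1) * sq x powr (j - 1 - 1))) * ((2 *\<^sub>R (x - x0)) \<bullet> (2 *\<^sub>R (x - x0))))
         + sq x powr j * (- 2 * DIM('a))
         + 2 * ((- 2 *\<^sub>R x) \<bullet> ((j * sq x powr (j - 1)) *\<^sub>R (2 *\<^sub>R (x - x0))))"
    let ?Gb = "\<lambda>x. D x *\<^sub>R ((j * sq x powr (j - 1)) *\<^sub>R (2 *\<^sub>R (x - x0))) + sq x powr j *\<^sub>R (- 2 *\<^sub>R x)"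
    have hb: "haslap S b ?Gb ?Lb"
      unfolding b_def D_def qsq by (rule haslap_mult[OF haslap_one_minus_sq[OF oS] hq])
    \<comment> \<open>With s = |x - x0|^2 and D = 1 - |x|^2, the identity 2 x.(x - x0) = s + D(x0) -
      D(x) turns the Laplacian of the barrier into a positive factor times D k(k-N) + 2(k-N)s + 2k
      D(x0). Every term is nonnegative for k >= N. The bound s <= 4 is the origin of the 4 in the
      condition k(k-N) >= 4K.\<close>
    have Lb: "?Lb x \<ge> K * b x" if xS: "x \<in> S" for x
    proof -
      let ?s = "sq x"
      have s: "?s > 0" using Sne sqpos xS by blast
      have nx: "norm x < 1" using xS by (auto simp: S_def)
      have s4: "?s \<le> 4"
      proof -
        have "norm (x - x0) \<le> 2" using nx x0 norm_triangle_ineq4[of x x0] by linarith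
        then have "(norm (x - x0))\<^sup>2 \<le> 2\<^sup>2" by (intro power_mono) auto
        then show ?thesis by (simp add: sq_def power2_norm_eq_inner)
      qed
      have Dpos: "D x > 0" "D x0 > 0" using nx x0 by (auto simp: D_def power_less_one_iff abs_square_less_1)
      have ip: "2 * (x \<bullet> (x - x0)) = ?s + D x0 - D x"
        by (simp add: sq_def D_def power2_norm_eq_inner inner_diff_left inner_diff_right inner_commute)
      have p1: "?s powr (j - 1) = ?s powr (j - 2) * ?s"
        using s by (simp add: powr_diff field_simps power2_eq_square)
      have p0: "?s powr j = ?s powr (j - 2) * ?s\<^sup>2"
        using s by (simp add: powr_diff field_simps power2_eq_square)
      have p2: "?s powr (j - 1 - 1) = ?s powr (j - 2)" by (simp add: algebra_simps)
      let ?P = "?s powr (j - 2)"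
      let ?N = "real DIM('a)"
      have e1: "?Lb x = ?P * (D x * (2 * ?N * j * ?s + 4 * j * (j - 1) * ?s) - 2 * ?N * ?s\<^sup>2
           - 4 * j * ?s * (2 * (x \<bullet> (x - x0))))"
      proof -
        have "(2 *\<^sub>R (x - x0)) \<bullet> (2 *\<^sub>R (x - x0)) = 4 * ?s"
          "(- 2 *\<^sub>R x) \<bullet> (c *\<^sub>R (2 *\<^sub>R (x - x0))) = - 4 * c * (x \<bullet> (x - x0))" for c
          by (simp_all add: sq_def)
        then show ?thesis
          unfolding p1 p0 p2 by (simp only:) (simp add: distrib_left right_diff_distrib power2_eq_square)
      qed
      also have "\<dots> = ?P * ?s * (D x * (2 * ?N * j + 4 * j * (j - 1)) - 2 * ?N * ?s
           - 4 * j * (?s + D x0 - D x))"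
        unfolding ip by (simp add: algebra_simps power2_eq_square)
      also have "\<dots> = ?P * ?s * (D x * (k * (k - ?N)) + 2 * (k - ?N) * ?s + 2 * k * D x0)"
        unfolding j_def by (simp add: algebra_simps)
      finally have e: "?Lb x = ?P * ?s * (D x * (k * (k - ?N)) + 2 * (k - ?N) * ?s + 2 * k * D x0)" .
      have "K * D x * ?s \<le> D x * (k * (k - ?N)) + 2 * (k - ?N) * ?s + 2 * k * D x0"
      proof -
        have "K * D x * ?s \<le> K * D x * 4" using s4 Dpos \<open>K \<ge> 0\<close> by (intro mult_left_mono) auto
        also have "\<dots> \<le> D x * (k * (k - ?N))" using k(2) Dpos by (simp add: mult.commute mult_left_mono)
        finally have a: "K * D x * ?s \<le> D x * (k * (k - ?N))" .
        have "0 \<le> 2 * (k - ?N) * ?s" "0 \<le> 2 * k * D x0" using k(1) s Dpos kpos by auto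
        then show ?thesis using a by linarith
      qed
      then have "?P * ?s * (K * D x * ?s) \<le> ?Lb x" unfolding e using s by (intro mult_left_mono) auto
      moreover have "K * b x = ?P * ?s * (K * D x * ?s)"
        unfolding b_def qsq p0 D_def by (simp add: power2_eq_square)
      ultimately show ?thesis by (simp only:)
    qed
    \<comment> \<open>Normalised so that the multiple of the barrier is at most \<open>c\<close> on
      the sphere of radius \<open>r\<close> about \<open>x0\<close>.\<close>
    let ?e = "c * r powr k"
    have e0: "?e \<ge> 0" using c by simp
    have comp: "0 \<le> f z - ?e * b z"
    proof (rule weak_maximum_principle[of S _ "\<lambda>x. G x - ?e *\<^sub>R ?Gb x" "\<lambda>x. L x - ?e * ?Lb x" T])
      show "haslap S (\<lambda>x. f x - ?e * b x) (\<lambda>x. G x - ?e *\<^sub>R ?Gb x) (\<lambda>x. L x - ?e * ?Lb x)"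
        by (intro haslap_diff haslap_cmult hb haslap_subset[OF f] oS) (auto simp: S_def)
      show "compact T" unfolding T_def by (intro compact_diff) auto
      show "S \<subseteq> T" by (auto simp: S_def T_def)
      show "T \<subseteq> cball 0 1" by (auto simp: T_def)
      have "continuous_on T b"
        unfolding b_def q_def using r by (intro continuous_intros) (auto simp: T_def)
      then show "continuous_on T (\<lambda>x. f x - ?e * b x)"
        by (intro continuous_intros continuous_on_subset[OF cont]) (auto simp: T_def)
      show "z \<in> T" using False assms(12) by (auto simp: T_def)
      show "0 \<le> f x - ?e * b x" if "x \<in> T - S" for x
      proof (cases "norm x = 1")
        case True then show ?thesis using nonneg[of x] by (simp add: b_def)
      next
        case False
        then have "norm (x - x0) = r" "x \<in> cball x0 r" "norm x \<le> 1"
          using that by (auto simp: S_def T_def dist_norm norm_minus_commute)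
        have "(x - x0) \<bullet> (x - x0) = r powr 2"
          using \<open>norm (x - x0) = r\<close> r by (simp flip: power2_norm_eq_inner)
        then have "q x = r powr (- k)" unfolding q_def by (simp add: powr_powr)
        then have "?e * b x = c * (1 - (norm x)\<^sup>2)" using r by (simp add: b_def powr_minus)
        also have "\<dots> \<le> c * 1" using c by (intro mult_left_mono) auto
        finally show ?thesis using c(2)[OF \<open>x \<in> cball x0 r\<close>] by simp
      qed
      show "L x - ?e * ?Lb x \<le> 0" if "x \<in> S" "f x - ?e * b x < 0" for x
      proof -
        have "L x \<le> K * f x" using L that by (auto simp: S_def)
        moreover have "?e * (K * b x) \<le> ?e * ?Lb x" using e0 Lb[OF that(1)] by (intro mult_left_mono)
        moreover have "K * (f x - ?e * b x) \<le> 0" using that \<open>K \<ge> 0\<close> by (simp add: mult_nonneg_nonpos)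
        ultimately show ?thesis by (simp add: algebra_simps)
      qed
    qed
    \<comment> \<open>Two points of the closed unit ball are at distance at most 2, which costs the
      factor 2^(-k).\<close>
    have "(r/2) powr k * D z \<le> r powr k * b z"
    proof -
      have "z \<noteq> x0" using False r by auto
      have "norm (z - x0) \<le> 2" using assms(12) x0 norm_triangle_ineq4[of z x0] by linarith
      have ip: "(z - x0) \<bullet> (z - x0) = norm (z - x0) powr 2"
        using \<open>z \<noteq> x0\<close> by (simp flip: power2_norm_eq_inner)
      have "q z = norm (z - x0) powr (- k)" unfolding q_def ip powr_powr by simp
      also have "\<dots> \<ge> 2 powr (- k)" 
        using \<open>z \<noteq> x0\<close> \<open>norm (z - x0) \<le> 2\<close> kpos by (intro powr_mono2') auto
      finally have "r powr k * 2 powr (- k) * D z \<le> r powr k * q z * D z"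
        using assms(12) by (intro mult_right_mono mult_left_mono) (auto simp: D_def power_le_one)
      then show ?thesis using r by (simp add: b_def D_def powr_divide powr_minus field_simps)
    qed
    then have "c * ((r/2) powr k * D z) \<le> c * (r powr k * b z)" using c by (intro mult_left_mono)
    then show ?thesis using comp by (simp add: D_def mult.assoc)
  qed
qed

section \<open>The mean value inequality\<close>

text \<open>A continuous weight supported in the closed unit ball takes the place of its indicator
  function: all means become integrals of continuous functions over a box, and neither surface
  measure nor polar coordinates enter.\<close>

definition bump :: "'a::euclidean_space \<Rightarrow> real" where
  "bump y = max 0 (1 - (norm y)\<^sup>2)"

lemma bump_nonneg [simp]: "0 \<le> bump y" by (simp add: bump_def)

lemma bump_eq_0: "1 \<le> norm y \<Longrightarrow> bump y = 0"
  by (simp add: bump_def power_le_one one_le_power)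

lemma bump_continuous: "continuous_on S bump"
  unfolding bump_def by (intro continuous_intros)

abbreviation box2 :: "'a::euclidean_space set" where
  "box2 \<equiv> cbox (- 2 *\<^sub>R One) (2 *\<^sub>R One)"

lemma cball_subset_cbox: "cball x r \<subseteq> cbox (x - r *\<^sub>R One) (x + r *\<^sub>R One)"
  for x :: "'a::euclidean_space"
proof
  fix y assume "y \<in> cball x r"
  then have "\<bar>(y - x) \<bullet> b\<bar> \<le> r" if "b \<in> Basis" for b
    using Basis_le_norm[OF that, of "y - x"] by (simp add: dist_norm norm_minus_commute)
  then show "y \<in> cbox (x - r *\<^sub>R One) (x + r *\<^sub>R One)"
    by (force simp: mem_box inner_diff_left inner_add_left abs_le_iff algebra_simps)
qed

lemma integral_cbox_support:
  fixes F :: "'a::euclidean_space \<Rightarrow> real"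
  assumes "\<And>x. x \<notin> T \<Longrightarrow> F x = 0" "T \<subseteq> S"
  shows "integral S F = integral UNIV F"
proof -
  have "integral S F = integral UNIV (\<lambda>x. if x \<in> S then F x else 0)"
    by (simp add: integral_restrict_UNIV)
  also have "(\<lambda>x. if x \<in> S then F x else 0) = F" by (rule ext) (use assms in auto)
  finally show ?thesis .
qed

text \<open>Differentiate the integral of the translates \<open>F (y + t b)\<close>, which does not depend on \<open>t\<close>.\<close>

lemma integral_directional_derivative:
  fixes F DF :: "'a::euclidean_space \<Rightarrow> real"
  assumes der: "\<And>x. ((\<lambda>t. F (x + t *\<^sub>R b)) has_real_derivative DF x) (at 0)"
    and cont: "continuous_on UNIV F" "continuous_on UNIV DF"
    and supp: "\<And>x. 1 \<le> norm x \<Longrightarrow> F x = 0" and b: "b \<in> Basis"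
  shows "integral box2 DF = 0"
proof -
  let ?I = "\<lambda>t::real. integral (cbox (- 2 *\<^sub>R One) (2 *\<^sub>R One)) (\<lambda>y. F (y + t *\<^sub>R b))"
  have der': "((\<lambda>t. F (x + t *\<^sub>R b)) has_real_derivative DF (x + s *\<^sub>R b)) (at s within T)" for x s T
  proof -
    have "((\<lambda>t. F ((x + s *\<^sub>R b) + (t + - s) *\<^sub>R b)) has_real_derivative DF (x + s *\<^sub>R b)) (at s)"
      using der[of "x + s *\<^sub>R b"] DERIV_shift[of "\<lambda>t. F ((x + s *\<^sub>R b) + t *\<^sub>R b)" _ s "- s"] by simp
    then show ?thesis by (simp add: algebra_simps has_field_derivative_at_within)
  qed
  have "(?I has_real_derivative integral box2 (\<lambda>y. DF (y + 0 *\<^sub>R b))) (at 0 within {-1..1})"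
  proof (rule leibniz_rule_field_derivative[where U="{-1..1}" and fx="\<lambda>t y. DF (y + t *\<^sub>R b)"])
    show "(\<lambda>y. F (y + t *\<^sub>R b)) integrable_on box2" for t
      by (intro integrable_continuous continuous_on_compose2[OF cont(1)] continuous_intros) auto
    show "continuous_on ({- 1..1} \<times> box2) (\<lambda>(t, y). DF (y + t *\<^sub>R b))"
      unfolding split_beta by (intro continuous_on_compose2[OF cont(2)] continuous_intros) auto
  qed (use der' in auto)
  moreover have "?I t = integral UNIV F" if t: "t \<in> {-1..1}" for t
  proof -
    have "?I t = integral (cbox (- 2 *\<^sub>R One + t *\<^sub>R b) (2 *\<^sub>R One + t *\<^sub>R b)) F"
      using integral_shift_cbox_plus[of "- 2 *\<^sub>R One" "2 *\<^sub>R One" F "t *\<^sub>R b"] by (simp add: o_def add.commute)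
    also have "\<dots> = integral UNIV F"
    proof (rule integral_cbox_support[of "cball 0 1"])
      show "F x = 0" if "x \<notin> cball 0 1" for x using supp that by auto
      \<comment> \<open>Translation by |t| <= 1 keeps the support inside the shifted box; this is
        why \<open>box2\<close> has half-width 2.\<close>
      have "cball 0 1 \<subseteq> cball (t *\<^sub>R b) 2"
      proof
        fix x :: 'a assume "x \<in> cball 0 1"
        then have "norm (t *\<^sub>R b - x) \<le> \<bar>t\<bar> * norm b + 1"
          using norm_triangle_ineq4[of "t *\<^sub>R b" x] by simp
        then show "x \<in> cball (t *\<^sub>R b) 2" using b t by (auto simp: dist_norm)
      qed
      then show "cball 0 1 \<subseteq> cbox (- 2 *\<^sub>R One + t *\<^sub>R b) (2 *\<^sub>R One + t *\<^sub>R b)"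
        using cball_subset_cbox[of "t *\<^sub>R b" 2] by (simp add: algebra_simps)
    qed
    finally show ?thesis .
  qed
  ultimately have "((\<lambda>t. integral UNIV F) has_real_derivative integral box2 DF) (at 0 within {-1..1})"
    using has_field_derivative_transform_within[of ?I _ 0 "{-1..1}" 1 "\<lambda>t. integral UNIV F"] by auto
  then have "((\<lambda>t. integral UNIV F) has_real_derivative integral box2 DF) (at 0)"
    by (simp add: at_within_Icc_at)
  then show ?thesis using DERIV_unique DERIV_const by blast
qed

text \<open>\<open>g\<close> is controlled only on the open set \<open>W\<close>. Points with |p x|
  <= 1 lie in \<open>W\<close>, and near a point with |p x| > 1 the product is identically 0, so
  arbitrary values of \<open>g\<close> elsewhere do no harm.\<close>

lemma continuous_on_bump_mult:
  fixes p :: "'b::metric_space \<Rightarrow> 'a::euclidean_space" and g :: "'b \<Rightarrow> real"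
  assumes p: "continuous_on UNIV p" and "open W" "continuous_on W g"
    and W: "\<And>x. x \<in> T \<Longrightarrow> norm (p x) \<le> 1 \<Longrightarrow> x \<in> W"
  shows "continuous_on T (\<lambda>x. bump (p x) * g x)"
proof (rule continuous_at_imp_continuous_on, rule ballI)
  fix x assume x: "x \<in> T"
  show "isCont (\<lambda>x. bump (p x) * g x) x"
  proof (cases "norm (p x) \<le> 1")
    case True
    have "continuous_on W (\<lambda>x. bump (p x) * g x)"
      by (intro continuous_on_mult continuous_on_compose2[OF bump_continuous] continuous_on_subset[OF p] assms) auto
    then show ?thesis using W[OF x True] \<open>open W\<close> continuous_on_eq_continuous_at by blast
  next
    case False
    have "open {x. 1 < norm (p x)}"
      using p by (intro open_Collect_less continuous_on_norm continuous_on_const)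
    moreover have "continuous_on {x. 1 < norm (p x)} (\<lambda>x. bump (p x) * g x)"
      by (rule continuous_on_cong[THEN iffD2, OF refl _ continuous_on_const[of _ 0]]) (simp add: bump_eq_0)
    ultimately have "\<forall>x\<in>{x. 1 < norm (p x)}. isCont (\<lambda>x. bump (p x) * g x) x"
      by (rule continuous_on_eq_continuous_at[THEN iffD1])
    then show ?thesis using False by simp
  qed
qed

text \<open>Squaring removes the kink of the positive part: at 0 the difference quotient is bounded
  by |h|. This is why the square of \<open>bump\<close> can be differentiated on the unit
  sphere.\<close>

lemma max_square_derivative:
  "((\<lambda>s::real. (max 0 s)\<^sup>2) has_real_derivative 2 * max 0 s) (at s)"
proof (cases "s = 0")
  case True
  have "((\<lambda>h::real. (max 0 h)\<^sup>2 / h) \<longlongrightarrow> 0) (at 0)"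
  proof (rule Lim_null_comparison[of _ "\<lambda>h. \<bar>h\<bar>"])
    show "\<forall>\<^sub>F h::real in at 0. norm ((max 0 h)\<^sup>2 / h) \<le> \<bar>h\<bar>"
      by (rule always_eventually) (auto simp: max_def power2_eq_square)
    show "((\<lambda>h::real. \<bar>h\<bar>) \<longlongrightarrow> 0) (at 0)" by (intro tendsto_eq_intros) auto
  qed
  then show ?thesis using True by (simp add: DERIV_def)
next
  case False
  consider "s > 0" | "s < 0" using False by linarith
  then show ?thesis
  proof cases
    case 1
    have "((\<lambda>s::real. s\<^sup>2) has_real_derivative 2 * max 0 s) (at s)"
      using 1 by (auto intro!: derivative_eq_intros)
    then show ?thesis
      by (rule has_field_derivative_transform_within_open[of _ _ _ "{0<..}"]) (use 1 in auto)
  next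
    case 2
    have "((\<lambda>s::real. 0) has_real_derivative 2 * max 0 s) (at s)"
      using 2 by (auto intro!: derivative_eq_intros)
    then show ?thesis
      by (rule has_field_derivative_transform_within_open[of _ _ _ "{..<0}"]) (use 2 in auto)
  qed
qed

lemma bump_square_derivative:
  "((\<lambda>y. (bump y)\<^sup>2 / 4) has_derivative (\<lambda>h. - bump y * (y \<bullet> h))) (at y)"
proof -
  have D: "((\<lambda>y::'a. 1 - y \<bullet> y) has_derivative (\<lambda>h. - 2 * (y \<bullet> h))) (at y)"
    by (auto intro!: derivative_eq_intros simp: inner_commute)
  from has_derivative_compose[OF D, of "\<lambda>s. (max 0 s)\<^sup>2" "(*) (2 * max 0 (1 - y \<bullet> y))"]
  have "((\<lambda>y. (bump y)\<^sup>2) has_derivative (\<lambda>h. (2 * bump y) * (- 2 * (y \<bullet> h)))) (at y)"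
    using max_square_derivative unfolding bump_def power2_norm_eq_inner has_field_derivative_def by simp
  from has_derivative_mult_right[OF this, of "1/4"] show ?thesis by (simp add: mult.assoc)
qed

lemma bump_integral_pos: "0 < integral box2 (bump :: 'a::euclidean_space \<Rightarrow> real)"
proof -
  have i: "bump integrable_on (box2 :: 'a set)" by (intro integrable_continuous bump_continuous)
  have "integral (box2 :: 'a set) bump \<ge> 0" by (intro integral_nonneg i) auto
  moreover have "integral (box2 :: 'a set) bump \<noteq> 0"
  proof
    assume "integral (box2 :: 'a set) bump = 0"
    then have "bump (0::'a) = 0"
      using integral_cbox_eq_0_iff[of "(- 2 *\<^sub>R One) :: 'a" "2 *\<^sub>R One" bump]
      by (auto simp: bump_continuous box_ne_empty mem_box)
    then show False by (simp add: bump_def)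
  qed
  ultimately show ?thesis by linarith
qed

text \<open>The \<open>t\<close>-derivative of the weighted mean over the ball of radius \<open>t\<close> is the integral of
  \<open>bump y * (y \<bullet> \<nabla>f(x0 + t y))\<close>; since \<open>bump y *\<^sub>R y\<close> is minus the gradient of \<open>(bump y)\<^sup>2 / 4\<close>,
  an integration by parts exhibits the Laplacian.\<close>

lemma mean_value_inequality:
  fixes f :: "'a::euclidean_space \<Rightarrow> real"
  assumes f: "haslap S f G L" and r: "0 < r" "cball x0 r \<subseteq> S" and L: "\<And>x. x \<in> S \<Longrightarrow> L x \<le> 0"
  shows "integral box2 (\<lambda>y. bump y * f (x0 + r *\<^sub>R y)) \<le> f x0 * integral box2 (bump :: 'a \<Rightarrow> real)"
proof -
  obtain H where H: "open S" "\<And>x. x \<in> S \<Longrightarrow> (f has_derivative (\<lambda>h. G x \<bullet> h)) (at x)"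
    "\<And>x. x \<in> S \<Longrightarrow> (G has_derivative H x) (at x)"
    "\<And>b. b \<in> Basis \<Longrightarrow> continuous_on S (\<lambda>x. H x b \<bullet> b)"
    "\<And>x. x \<in> S \<Longrightarrow> L x = (\<Sum>b\<in>Basis. H x b \<bullet> b)" by (rule haslapE[OF f]) (rule that)
  note cf = haslap_continuous_on[OF f] and cG = haslap_gradient_continuous_on[OF f]
  define A where "A t = integral box2 (\<lambda>y. bump y * f (x0 + t *\<^sub>R y))" for t
  define A' where "A' t = integral box2 (\<lambda>y. bump y * (G (x0 + t *\<^sub>R y) \<bullet> y))" for t
  have inS: "x0 + t *\<^sub>R y \<in> S" if "t \<in> {0..r}" "norm y \<le> 1" for t y
  proof -
    have "\<bar>t\<bar> * norm y \<le> r * 1" using that r by (intro mult_mono) auto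
    then show ?thesis using r(2) by (auto simp: subset_iff dist_norm)
  qed
  \<comment> \<open>Differentiation under the integral needs continuity jointly in the radius and
    the point, hence an open set of pairs.\<close>
  define W where "W = {z :: real \<times> 'a. x0 + fst z *\<^sub>R snd z \<in> S}"
  have oW: "open W" unfolding W_def
    by (rule open_vimage[OF H(1), unfolded vimage_def]) (intro continuous_intros)
  have oV: "open {y. x0 + t *\<^sub>R y \<in> S}" for t
    by (rule open_vimage[OF H(1), unfolded vimage_def]) (intro continuous_intros)
  have cont_bump: "continuous_on UNIV (\<lambda>y. bump y * g (x0 + t *\<^sub>R y) y)"
    if "continuous_on {y. x0 + t *\<^sub>R y \<in> S} (\<lambda>y. g (x0 + t *\<^sub>R y) y)" "t \<in> {0..r}" for g t
    by (rule continuous_on_bump_mult[OF _ oV that(1), where p="\<lambda>y. y"]) (use inS that(2) in \<open>auto intro: continuous_intros\<close>)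
  have dA: "(A has_real_derivative A' t) (at t within {0..r})" if t: "t \<in> {0..r}" for t
    unfolding A_def A'_def
  proof (rule leibniz_rule_field_derivative[where U="{0..r}" and fx="\<lambda>t y. bump y * (G (x0 + t *\<^sub>R y) \<bullet> y)"])
    fix s y assume s: "s \<in> {0..r}"
    show "((\<lambda>t. bump y * f (x0 + t *\<^sub>R y)) has_real_derivative bump y * (G (x0 + s *\<^sub>R y) \<bullet> y)) (at s within {0..r})"
    proof (cases "norm y < 1")
      case True
      have "((\<lambda>t. x0 + t *\<^sub>R y) has_derivative (\<lambda>h. h *\<^sub>R y)) (at s)"
        by (auto intro!: derivative_eq_intros)
      from has_derivative_compose[OF this H(2)[OF inS[OF s]]] True
      have "((\<lambda>t. f (x0 + t *\<^sub>R y)) has_real_derivative G (x0 + s *\<^sub>R y) \<bullet> y) (at s)"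
        by (simp add: has_field_derivative_def mult_commute_abs)
      then show ?thesis by (rule DERIV_cmult[OF has_field_derivative_at_within])
    qed (simp add: bump_eq_0)
  next
    show "(\<lambda>y. bump y * f (x0 + s *\<^sub>R y)) integrable_on box2" if "s \<in> {0..r}" for s
      by (intro integrable_continuous continuous_on_subset[OF cont_bump[where g="\<lambda>x y. f x"]]
          continuous_on_compose2[OF cf] continuous_intros) (use that in auto)
    have "continuous_on ({0..r} \<times> box2) (\<lambda>z. bump (snd z) * (G (x0 + fst z *\<^sub>R snd z) \<bullet> snd z))"
      by (rule continuous_on_bump_mult[OF _ oW])
         (auto intro!: continuous_intros continuous_on_compose2[OF cG] inS simp: W_def)
    then show "continuous_on ({0..r} \<times> box2) (\<lambda>(t, y). bump y * (G (x0 + t *\<^sub>R y) \<bullet> y))"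
      by (simp add: split_beta)
  qed (use t in auto)
  have A'_le: "A' t \<le> 0" if t: "t \<in> {0..r}" for t
  proof -
    \<comment> \<open>The components of the vector field (bump y)^2/4 times the gradient of
      \<open>f\<close>; \<open>DX b\<close> is the derivative of \<open>X b\<close> in direction
      \<open>b\<close>, and its integral vanishes by compact support.\<close>
    define X where "X b y = (bump y)\<^sup>2 / 4 * (G (x0 + t *\<^sub>R y) \<bullet> b)" for b y
    define DX where "DX b y = (bump y)\<^sup>2 / 4 * (t * (H (x0 + t *\<^sub>R y) b \<bullet> b))
      - bump y * ((y \<bullet> b) * (G (x0 + t *\<^sub>R y) \<bullet> b))" for b y
    have cH: "continuous_on {y. x0 + t *\<^sub>R y \<in> S} (\<lambda>y. H (x0 + t *\<^sub>R y) b \<bullet> b)" if "b \<in> Basis" for b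
      by (rule continuous_on_compose2[OF H(4)[OF that]]) (auto intro!: continuous_intros)
    have cX: "continuous_on UNIV (X b)" for b
    proof -
      have "continuous_on UNIV (\<lambda>y. bump y * (bump y / 4 * (G (x0 + t *\<^sub>R y) \<bullet> b)))"
        by (rule cont_bump[where g="\<lambda>x y. bump y / 4 * (G x \<bullet> b)"])
          (use t in \<open>auto intro!: continuous_intros bump_continuous continuous_on_compose2[OF cG]\<close>)
      then show ?thesis by (simp add: X_def[abs_def] power2_eq_square mult.assoc)
    qed
    have cDX: "continuous_on UNIV (DX b)" if b: "b \<in> Basis" for b
    proof -
      have "continuous_on UNIV (\<lambda>y. bump y * (bump y / 4 * (t * (H (x0 + t *\<^sub>R y) b \<bullet> b)) - (y \<bullet> b) * (G (x0 + t *\<^sub>R y) \<bullet> b)))"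
        by (rule cont_bump[where g="\<lambda>x y. bump y / 4 * (t * (H x b \<bullet> b)) - (y \<bullet> b) * (G x \<bullet> b)"])
          (use t in \<open>auto intro!: continuous_intros bump_continuous cH[OF b] continuous_on_compose2[OF cG]\<close>)
      then show ?thesis by (simp add: DX_def[abs_def] power2_eq_square mult.assoc right_diff_distrib)
    qed
    have DX0: "integral box2 (DX b) = 0" if b: "b \<in> Basis" for b
    proof (rule integral_directional_derivative[OF _ cX[of b] cDX[OF b] _ b])
      show "X b x = 0" if "1 \<le> norm x" for x using that by (simp add: X_def bump_eq_0)
      fix y :: 'a
      show "((\<lambda>s. X b (y + s *\<^sub>R b)) has_real_derivative DX b y) (at 0)"
      proof (cases "norm y \<le> 1")
        case True
        have "((\<lambda>s. y + s *\<^sub>R b) has_derivative (\<lambda>h. h *\<^sub>R b)) (at 0)"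
          by (auto intro!: derivative_eq_intros)
        from has_derivative_compose[OF this, of "\<lambda>y. (bump y)\<^sup>2 / 4" "\<lambda>h. - bump y * (y \<bullet> h)"]
        have "((\<lambda>s. (bump (y + s *\<^sub>R b))\<^sup>2 / 4) has_derivative (\<lambda>h. - bump y * (y \<bullet> (h *\<^sub>R b)))) (at 0)"
          using bump_square_derivative[of y] by simp
        then have 1: "((\<lambda>s. (bump (y + s *\<^sub>R b))\<^sup>2 / 4) has_real_derivative - bump y * (y \<bullet> b)) (at 0)"
          by (rule has_derivative_imp_has_field_derivative) simp
        have "((\<lambda>s. x0 + t *\<^sub>R (y + s *\<^sub>R b)) has_derivative (\<lambda>h. h *\<^sub>R (t *\<^sub>R b))) (at 0)"
          by (auto intro!: derivative_eq_intros simp: algebra_simps)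
        from has_derivative_inner_left[OF has_derivative_compose[OF this, of G "H (x0 + t *\<^sub>R y)"], of b] H(3)[OF inS[OF t True]]
        have "((\<lambda>s. G (x0 + t *\<^sub>R (y + s *\<^sub>R b)) \<bullet> b) has_derivative (\<lambda>h. H (x0 + t *\<^sub>R y) (h *\<^sub>R t *\<^sub>R b) \<bullet> b)) (at 0)"
          by simp
        moreover have "linear (H (x0 + t *\<^sub>R y))" using H(3)[OF inS[OF t True]] has_derivative_linear by blast
        ultimately have 2: "((\<lambda>s. G (x0 + t *\<^sub>R (y + s *\<^sub>R b)) \<bullet> b) has_real_derivative t * (H (x0 + t *\<^sub>R y) b \<bullet> b)) (at 0)"
          by (intro has_derivative_imp_has_field_derivative) (auto simp: linear_scale mult.assoc)
        from DERIV_mult[OF 1 2] show ?thesis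
          unfolding X_def DX_def by (simp add: algebra_simps)
      next
        case False
        have o: "open {s. 1 < norm (y + s *\<^sub>R b)}"
          by (intro open_Collect_less continuous_intros)
        have "((\<lambda>s. 0) has_real_derivative DX b y) (at 0)"
          using False by (simp add: DX_def bump_eq_0)
        then show ?thesis
          by (rule has_field_derivative_transform_within_open[OF _ o]) (use False in \<open>auto simp: X_def bump_eq_0\<close>)
      qed
    qed
    have int: "(\<lambda>y. bump y * (G (x0 + t *\<^sub>R y) \<bullet> y)) integrable_on box2"
      by (intro integrable_continuous continuous_on_subset[OF cont_bump[where g="\<lambda>x y. G x \<bullet> y"]])
         (use t in \<open>auto intro!: continuous_intros continuous_on_compose2[OF cG]\<close>)
    have intD: "(\<lambda>y. \<Sum>b\<in>Basis. DX b y) integrable_on box2"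
      by (intro integrable_sum finite_Basis integrable_continuous continuous_on_subset[OF cDX]) auto
    have "0 = (\<Sum>b\<in>Basis. integral box2 (DX b))" using DX0 by simp
    also have "\<dots> = integral box2 (\<lambda>y. \<Sum>b\<in>Basis. DX b y)"
      by (rule integral_sum[symmetric]) (auto intro!: integrable_continuous continuous_on_subset[OF cDX])
    finally have "A' t = integral box2 (\<lambda>y. bump y * (G (x0 + t *\<^sub>R y) \<bullet> y)) + integral box2 (\<lambda>y. \<Sum>b\<in>Basis. DX b y)"
      unfolding A'_def by simp
    also have "\<dots> = integral box2 (\<lambda>y. bump y * (G (x0 + t *\<^sub>R y) \<bullet> y) + (\<Sum>b\<in>Basis. DX b y))"
      by (rule integral_add[symmetric, OF int intD])
    also have "\<dots> \<le> integral box2 (\<lambda>y::'a. 0)"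
    proof (rule integral_le)
      fix y :: 'a
      show "bump y * (G (x0 + t *\<^sub>R y) \<bullet> y) + (\<Sum>b\<in>Basis. DX b y) \<le> 0"
      proof (cases "norm y \<le> 1")
        case True
        \<comment> \<open>The divergence reproduces the integrand of \<open>A'\<close> with the
          opposite sign, so adding it leaves (bump y)^2 t L / 4, which is nonpositive.\<close>
        have "(\<Sum>b\<in>Basis. DX b y) = (bump y)\<^sup>2 / 4 * t * L (x0 + t *\<^sub>R y) - bump y * (G (x0 + t *\<^sub>R y) \<bullet> y)"
          unfolding DX_def H(5)[OF inS[OF t True]] sum_subtractf euclidean_inner[of "G (x0 + t *\<^sub>R y)" y]
          by (simp add: sum_distrib_left mult_ac)
        moreover have "(bump y)\<^sup>2 / 4 * t * L (x0 + t *\<^sub>R y) \<le> 0"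
          using L[OF inS[OF t True]] t by (intro mult_nonneg_nonpos) auto
        ultimately show ?thesis by simp
      qed (simp add: DX_def bump_eq_0)
    qed (use integrable_add[OF int intD] in auto)
    finally show ?thesis by simp
  qed
  have "A r \<le> A 0"
  proof (rule DERIV_nonpos_imp_decreasing_open[of 0 r])
    show "continuous_on {0..r} A" using dA by (rule DERIV_continuous_on)
    show "\<exists>y. (A has_real_derivative y) (at x) \<and> y \<le> 0" if "0 < x" "x < r" for x
      using dA[of x] A'_le[of x] that by (auto simp: at_within_Icc_at)
  qed (use r in auto)
  then show ?thesis unfolding A_def by (simp add: mult.commute)
qed

section \<open>Weighted means and lower bounds for superharmonic functions\<close>

text \<open>The mean is not normalised: the constant 1 has mean r^N times \<open>bump_mass\<close>.
  Integrating over the whole space allows means with different centres and radii to be compared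
  through their weights pointwise.\<close>

definition bavg :: "'a::euclidean_space \<Rightarrow> real \<Rightarrow> ('a \<Rightarrow> real) \<Rightarrow> real" where
  "bavg x r f = integral UNIV (\<lambda>z. bump ((z - x) /\<^sub>R r) * f z)"

abbreviation bump_mass :: "'a::euclidean_space itself \<Rightarrow> real" where
  "bump_mass _ \<equiv> integral box2 (bump :: 'a \<Rightarrow> real)"

lemma norm_scaled_diff: "0 < r \<Longrightarrow> norm ((z - x) /\<^sub>R r) = dist x z / r"
  for x z :: "'a::real_normed_vector"
  by (simp add: dist_norm norm_minus_commute divide_inverse mult.commute)

lemma bavg_has_integral:
  fixes f :: "'a::euclidean_space \<Rightarrow> real"
  assumes "open S" "continuous_on S f" "0 < r" "cball x r \<subseteq> S"
  shows "((\<lambda>z. bump ((z - x) /\<^sub>R r) * f z) has_integral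
    r ^ DIM('a) * integral box2 (\<lambda>y. bump y * f (x + r *\<^sub>R y))) UNIV"
proof -
  let ?F = "\<lambda>z. bump ((z - x) /\<^sub>R r) * f z"
  let ?Q = "cbox (x - (2 * r) *\<^sub>R One) (x + (2 * r) *\<^sub>R One)"
  note nz = norm_scaled_diff[OF assms(3)]
  have "continuous_on UNIV ?F"
  proof (rule continuous_on_bump_mult[OF _ assms(1,2)])
    show "z \<in> S" if "norm ((z - x) /\<^sub>R r) \<le> 1" for z
      using that assms(3,4) unfolding nz by (auto simp: field_simps)
  qed (intro continuous_intros)
  then have i: "(?F has_integral integral ?Q ?F) ?Q"
    by (rule integrable_integral[OF integrable_continuous[OF continuous_on_subset[OF _ subset_UNIV]]])
  from has_integral_affinity'[OF i assms(3), of x]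
  have "((\<lambda>y. ?F (r *\<^sub>R y + x)) has_integral integral ?Q ?F /\<^sub>R r ^ DIM('a))
      (cbox ((x - (2 * r) *\<^sub>R One - x) /\<^sub>R r) ((x + (2 * r) *\<^sub>R One - x) /\<^sub>R r))" .
  also have "(x - (2 * r) *\<^sub>R One - x) /\<^sub>R r = - 2 *\<^sub>R One" using assms(3) by simp
  also have "(x + (2 * r) *\<^sub>R One - x) /\<^sub>R r = 2 *\<^sub>R One" using assms(3) by simp
  also have "(\<lambda>y. ?F (r *\<^sub>R y + x)) = (\<lambda>y. bump y * f (x + r *\<^sub>R y))"
    using assms(3) by (simp add: add.commute)
  finally have "integral box2 (\<lambda>y. bump y * f (x + r *\<^sub>R y)) = integral ?Q ?F / r ^ DIM('a)"
    by (simp add: integral_unique divide_inverse mult.commute)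
  then have "r ^ DIM('a) * integral box2 (\<lambda>y. bump y * f (x + r *\<^sub>R y)) = integral ?Q ?F"
    using assms(3) by simp
  moreover have "(?F has_integral integral ?Q ?F) UNIV"
  proof (rule has_integral_on_superset[OF i])
    fix z assume "z \<notin> ?Q"
    then have "z \<notin> cball x r" using cball_subset_cbox[of x "2 * r"] assms(3) by (auto simp: subset_iff)
    then have "1 \<le> norm ((z - x) /\<^sub>R r)" unfolding nz using assms(3) by simp
    then show "?F z = 0" by (simp add: bump_eq_0)
  qed auto
  ultimately show ?thesis by simp
qed

lemma bavg_eq:
  fixes f :: "'a::euclidean_space \<Rightarrow> real"
  assumes "open S" "continuous_on S f" "0 < r" "cball x r \<subseteq> S"
  shows "bavg x r f = r ^ DIM('a) * integral box2 (\<lambda>y. bump y * f (x + r *\<^sub>R y))"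
  unfolding bavg_def using bavg_has_integral[OF assms] by (rule integral_unique)

lemma bavg_integrable:
  assumes "open S" "continuous_on S f" "0 < r" "cball x r \<subseteq> S"
  shows "(\<lambda>z. bump ((z - x) /\<^sub>R r) * f z) integrable_on UNIV"
  using bavg_has_integral[OF assms] by blast

lemma bavg_const: "0 < r \<Longrightarrow> bavg x r (\<lambda>_. c) = c * (r ^ DIM('a) * bump_mass TYPE('a))"
  for x :: "'a::euclidean_space"
  using bavg_eq[of UNIV "\<lambda>_. c" r x] by (simp add: mult.commute)

lemma bavg_add:
  assumes "open S" "continuous_on S f" "continuous_on S g" "0 < r" "cball x r \<subseteq> S"
  shows "bavg x r (\<lambda>z. f z + g z) = bavg x r f + bavg x r g"
  unfolding bavg_def distrib_left
  by (rule integral_add[OF bavg_integrable[OF assms(1,2,4,5)] bavg_integrable[OF assms(1,3,4,5)]])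

lemma bavg_cmult: "bavg x r (\<lambda>z. c * f z) = c * bavg x r f"
  unfolding bavg_def by (simp add: mult.left_commute)

lemma bavg_mono:
  fixes f :: "'a::euclidean_space \<Rightarrow> real"
  assumes "open S" "continuous_on S f" "continuous_on S g" "0 < r" "cball x r \<subseteq> S"
    and le: "\<And>z. z \<in> cball x r \<Longrightarrow> f z \<le> g z"
  shows "bavg x r f \<le> bavg x r g"
  unfolding bavg_def
proof (rule integral_le[OF bavg_integrable[OF assms(1,2,4,5)] bavg_integrable[OF assms(1,3,4,5)]])
  fix z :: 'a
  show "bump ((z - x) /\<^sub>R r) * f z \<le> bump ((z - x) /\<^sub>R r) * g z"
  proof (cases "z \<in> cball x r")
    case True then show ?thesis using le by (intro mult_left_mono) auto
  next
    case False
    then have "1 \<le> norm ((z - x) /\<^sub>R r)" using assms(4) unfolding norm_scaled_diff[OF assms(4)] by simp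
    then show ?thesis by (simp add: bump_eq_0)
  qed
qed

lemma bavg_le_superharmonic:
  fixes f :: "'a::euclidean_space \<Rightarrow> real"
  assumes "haslap S f G L" "0 < r" "cball x r \<subseteq> S" "\<And>y. y \<in> S \<Longrightarrow> L y \<le> 0"
  shows "bavg x r f \<le> r ^ DIM('a) * bump_mass TYPE('a) * f x"
  using mean_value_inequality[OF assms] assms(2)
    bavg_eq[OF haslap_open[OF assms(1)] haslap_continuous_on[OF assms(1)] assms(2,3)]
  by (simp add: mult.assoc mult.commute mult_left_mono)

text \<open>A weak Harnack inequality. Points of the ball of radius r about \<open>x0\<close> are
  within 2r of \<open>x\<close>, so there the weight centred at \<open>x\<close> with radius 3r is
  at least 1 - (2/3)^2 = 5/9, whereas the weight centred at \<open>x0\<close> is at most 1. The mean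
  value inequality at \<open>x\<close> finishes the argument.\<close>

lemma superharmonic_ge_bavg:
  fixes f :: "'a::euclidean_space \<Rightarrow> real"
  assumes f: "haslap S f G L" "\<And>y. y \<in> S \<Longrightarrow> L y \<le> 0" "\<And>y. y \<in> S \<Longrightarrow> 0 \<le> f y"
    and r: "0 < r" "cball x0 (4 * r) \<subseteq> S" and x: "x \<in> cball x0 r"
  shows "5 / 9 * bavg x0 r f \<le> (3 * r) ^ DIM('a) * bump_mass TYPE('a) * f x"
proof -
  have sub: "cball x (3 * r) \<subseteq> S" "cball x0 r \<subseteq> S"
  proof -
    have "dist x0 z \<le> 4 * r" if "dist x z \<le> 3 * r" for z
      using dist_triangle[of x0 z x] that x by simp
    then show "cball x (3 * r) \<subseteq> S" "cball x0 r \<subseteq> S" using r by (auto simp: subset_iff)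
  qed
  note fc = haslap_open[OF f(1)] haslap_continuous_on[OF f(1)]
  have r3: "0 < 3 * r" using r by simp
  have "5 / 9 * bavg x0 r f = integral UNIV (\<lambda>z. 5 / 9 * (bump ((z - x0) /\<^sub>R r) * f z))"
    unfolding bavg_def by simp
  also have "\<dots> \<le> bavg x (3 * r) f"
    unfolding bavg_def
  proof (rule integral_le)
    show "(\<lambda>z. 5 / 9 * (bump ((z - x0) /\<^sub>R r) * f z)) integrable_on UNIV"
      using integrable_cmul[OF bavg_integrable[OF fc r(1) sub(2)], of "5/9"] by simp
    show "(\<lambda>z. bump ((z - x) /\<^sub>R (3 * r)) * f z) integrable_on UNIV"
      by (rule bavg_integrable[OF fc r3 sub(1)])
    fix z :: 'a
    have nx: "norm ((z - x) /\<^sub>R (3 * r)) = dist x z / (3 * r)" "norm ((z - x0) /\<^sub>R r) = dist x0 z / r"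
      using r by (simp_all only: norm_scaled_diff[OF r3] norm_scaled_diff[OF r(1)])
    show "5 / 9 * (bump ((z - x0) /\<^sub>R r) * f z) \<le> bump ((z - x) /\<^sub>R (3 * r)) * f z"
    proof (cases "dist x0 z < r")
      case True
      then have fz: "0 \<le> f z" using sub(2) f(3)[of z] by (auto simp: subset_iff)
      have "dist x z \<le> 2 * r" using True x dist_triangle[of x z x0] by (simp add: dist_commute)
      then have "dist x z / (3 * r) \<le> 2 / 3" using r by (simp add: field_simps)
      then have "(dist x z / (3 * r))\<^sup>2 \<le> (2 / 3)\<^sup>2" using r by (intro power_mono) auto
      then have "5 / 9 \<le> bump ((z - x) /\<^sub>R (3 * r))" unfolding bump_def nx by (simp add: power2_eq_square)
      moreover have "bump ((z - x0) /\<^sub>R r) \<le> 1" by (simp add: bump_def)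
      ultimately have "5 / 9 * bump ((z - x0) /\<^sub>R r) \<le> bump ((z - x) /\<^sub>R (3 * r))" by linarith
      then show ?thesis using mult_right_mono[OF _ fz] by (metis mult.assoc)
    next
      case False
      then have "bump ((z - x0) /\<^sub>R r) = 0" using r by (intro bump_eq_0) (simp only: nx, simp add: field_simps)
      moreover have "0 \<le> bump ((z - x) /\<^sub>R (3 * r)) * f z"
      proof (cases "z \<in> cball x (3 * r)")
        case True then show ?thesis using f(3) sub(1) by (intro mult_nonneg_nonneg) auto
      next
        case False
        then have "bump ((z - x) /\<^sub>R (3 * r)) = 0" using r by (intro bump_eq_0) (simp only: nx, simp add: field_simps)
        then show ?thesis by simp
      qed
      ultimately show ?thesis by simp
    qed
  qed
  also have "\<dots> \<le> (3 * r) ^ DIM('a) * bump_mass TYPE('a) * f x"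
    by (rule bavg_le_superharmonic[OF f(1) r3 sub(1) f(2)])
  finally show ?thesis .
qed

text \<open>The product of the weak Harnack constant for r = 1/5, where 3r = 3/5, and the barrier
  factor (r/2)^N = (1/10)^N. The radius 1/5 satisfies 4r < 1.\<close>

definition hopf_const :: "'a::euclidean_space itself \<Rightarrow> real" where
  "hopf_const _ = 5 / (9 * ((3 / 5) ^ DIM('a) * bump_mass TYPE('a))) * (1 / 10) powr real DIM('a)"

lemma hopf_const_pos: "hopf_const TYPE('a::euclidean_space) > 0"
  using bump_integral_pos[where 'a='a] by (simp add: hopf_const_def)

text \<open>Weak Harnack bounds \<open>f\<close> from below on the ball of radius 1/5 by its mean,
  and the barrier with k = N and K = 0 carries this to the boundary. The bound is linear in the
  mean, and means are additive; the oscillation estimate depends on both facts.\<close>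

lemma superharmonic_lower_bound:
  fixes f :: "'a::euclidean_space \<Rightarrow> real"
  assumes f: "haslap (ball 0 1) f G L" "continuous_on (cball 0 1) f"
    "\<And>x. norm x \<le> 1 \<Longrightarrow> 0 \<le> f x" "\<And>x. norm x < 1 \<Longrightarrow> L x \<le> 0" and z: "norm z \<le> 1"
  shows "hopf_const TYPE('a) * bavg 0 (1 / 5) f * (1 - (norm z)\<^sup>2) \<le> f z"
proof -
  define M where "M = (3 / 5) ^ DIM('a) * bump_mass TYPE('a)"
  have M: "M > 0" unfolding M_def using bump_integral_pos[where 'a='a] by simp
  have avg: "5 / (9 * M) * bavg 0 (1 / 5) f \<le> f x" if "x \<in> cball 0 (1 / 5)" for x
  proof -
    have "5 / 9 * bavg 0 (1 / 5) f \<le> (3 * (1 / 5)) ^ DIM('a) * bump_mass TYPE('a) * f x"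
      by (rule superharmonic_ge_bavg[OF f(1) _ _ _ _ that]) (use f in \<open>auto simp: subset_iff\<close>)
    then have "5 / 9 * bavg 0 (1 / 5) f \<le> M * f x" by (simp add: M_def)
    then show ?thesis using M by (simp add: field_simps)
  qed
  have fc: "continuous_on (ball 0 1) f" by (rule haslap_continuous_on[OF f(1)])
  have "bavg 0 (1 / 5) (\<lambda>_::'a. 0) \<le> bavg 0 (1 / 5) f"
    by (rule bavg_mono[of "ball 0 1"]) (use f(3) fc in \<open>auto simp: subset_iff\<close>)
  then have n: "0 \<le> bavg 0 (1 / 5) f" by (simp add: bavg_const)
  have "5 / (9 * M) * bavg 0 (1 / 5) f * ((1 / 5) / 2) powr real DIM('a) * (1 - (norm z)\<^sup>2) \<le> f z"
    by (rule hopf_lower_bound[OF f(1,2), where K=0 and ?x0.0=0])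
      (use f(3,4) z avg n M in \<open>auto simp: subset_iff\<close>)
  then show ?thesis by (simp add: hopf_const_def M_def mult.assoc mult.commute mult.left_commute)
qed

text \<open>Since L >= -\<mu>, the function w + \<mu>/(2N) |x - x0|^2 is subharmonic and its mean
  about \<open>x0\<close> is at least its central value 1. On a ball of radius of order 1/\<mu> the
  quadratic term is at most 1/2, so the normalised mean of \<open>w\<close> is at least 1/2. Weak
  Harnack and the barrier then give the bound; the small radius accounts for the power of
  \<mu>.\<close>

lemma lower_bound_from_maximum:
  fixes w :: "'a::euclidean_space \<Rightarrow> real"
  assumes w: "haslap (ball 0 1) w G L" "continuous_on (cball 0 1) w"
    "\<And>x. norm x \<le> 1 \<Longrightarrow> 0 \<le> w x" "\<And>x. norm x < 1 \<Longrightarrow> L x \<le> 0" "\<And>x. norm x < 1 \<Longrightarrow> - \<mu> \<le> L x"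
    and mu: "1 \<le> \<mu>" "1 / \<mu> \<le> 1 - norm x0" and wx0: "w x0 = 1" and z: "norm z \<le> 1"
  shows "5 / 18 * (1 / 30) powr real DIM('a) * \<mu> powr (- real DIM('a)) * (1 - (norm z)\<^sup>2) \<le> w z"
proof -
  let ?N = "real DIM('a)"
  have N: "?N \<ge> 1" using DIM_positive[where 'a='a] by linarith
  \<comment> \<open>Then 4r < 1/\<mu> <= 1 - |x0|, so the ball required by weak Harnack stays inside
    the unit ball. The final constant is 5/18 (1/3)^N (r/2)^N with r/2 = 1/(10 \<mu>).\<close>
  define r where "r = 1 / (5 * \<mu>)"
  define V where "V = r ^ DIM('a) * bump_mass TYPE('a)"
  have r: "r > 0" using mu by (simp add: r_def)
  have V: "V > 0" unfolding V_def using bump_integral_pos[where 'a='a] r by simp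
  have r4: "cball x0 (4 * r) \<subseteq> ball 0 1"
  proof
    fix x assume "x \<in> cball x0 (4 * r)"
    then have "norm x \<le> norm x0 + 4 * r" using norm_triangle_sub[of x x0] by (simp add: dist_norm norm_minus_commute)
    also have "4 * r < 1 / \<mu>" using mu by (simp add: r_def field_simps)
    finally show "x \<in> ball 0 1" using mu by simp
  qed
  have sub: "cball x0 r \<subseteq> ball 0 1" using r by (intro order_trans[OF _ r4]) (simp add: cball_subset_cball_iff)
  define q where "q x = (x - x0) \<bullet> (x - x0)" for x
  have hf: "haslap (ball 0 1) (\<lambda>x. (- 1) * w x - \<mu> / (2 * ?N) * q x)
      (\<lambda>x. (-1) *\<^sub>R G x - (\<mu> / (2 * ?N)) *\<^sub>R (2 *\<^sub>R (x - x0))) (\<lambda>x. (-1) * L x - \<mu> / (2 * ?N) * real (2 * DIM('a)))"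
    unfolding q_def by (intro haslap_diff haslap_cmult w haslap_dist_sq) auto
  have "bavg x0 r (\<lambda>x. (- 1) * w x + (- 1 / 2)) \<le> bavg x0 r (\<lambda>x. (- 1) * w x - \<mu> / (2 * ?N) * q x)"
  proof (rule bavg_mono[of "ball 0 1", OF _ _ _ r sub])
    fix x assume "x \<in> cball x0 r"
    then have "(norm (x - x0))\<^sup>2 \<le> r\<^sup>2" by (intro power_mono) (auto simp: dist_norm norm_minus_commute)
    then have "q x \<le> r\<^sup>2" by (simp add: q_def power2_norm_eq_inner)
    then have "\<mu> / (2 * ?N) * q x \<le> \<mu> / (2 * ?N) * r\<^sup>2" using mu by (intro mult_left_mono) auto
    also have "\<dots> \<le> 1 / 2"
    proof -
      have "\<mu> * r\<^sup>2 \<le> 1" using mu by (simp add: r_def power2_eq_square field_simps)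
      then have "\<mu> * r\<^sup>2 \<le> ?N" using N by linarith
      then show ?thesis using N by (simp add: field_simps)
    qed
    finally show "(- 1) * w x + (- 1 / 2) \<le> (- 1) * w x - \<mu> / (2 * ?N) * q x" by simp
  qed (use haslap_continuous_on[OF w(1)] haslap_continuous_on[OF hf] in \<open>auto intro!: continuous_intros\<close>)
  also have "\<dots> \<le> V * ((- 1) * w x0 - \<mu> / (2 * ?N) * q x0)"
    unfolding V_def by (rule bavg_le_superharmonic[OF hf r sub]) (use w(5) in \<open>force simp: algebra_simps\<close>)
  also have "bavg x0 r (\<lambda>x. (- 1) * w x + (- 1 / 2)) = bavg x0 r (\<lambda>x. (- 1) * w x) + bavg x0 r (\<lambda>x. - 1 / 2)"
    by (rule bavg_add[of "ball 0 1", OF _ _ _ r sub]) (use haslap_continuous_on[OF w(1)] in \<open>auto intro!: continuous_intros\<close>)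
  also have "\<dots> = (- 1) * bavg x0 r w + (- 1 / 2) * V"
    by (simp only: bavg_cmult bavg_const[OF r] V_def)
  finally have a: "V / 2 \<le> bavg x0 r w" using wx0 by (simp add: q_def)
  have low: "5 / 18 * (1 / 3) powr ?N \<le> w x" if "x \<in> cball x0 r" for x
  proof -
    have "5 / 9 * (V / 2) \<le> 5 / 9 * bavg x0 r w" using a by simp
    also have "\<dots> \<le> (3 * r) ^ DIM('a) * bump_mass TYPE('a) * w x"
      by (rule superharmonic_ge_bavg[OF w(1) _ _ r r4 that]) (use w in auto)
    also have "\<dots> = V * (3 powr ?N * w x)" by (simp add: V_def power_mult_distrib powr_realpow)
    finally have "5 / 18 \<le> 3 powr ?N * w x" using V by simp
    then show ?thesis by (simp add: powr_divide field_simps)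
  qed
  have "(5 / 18 * (1 / 3) powr ?N) * (r / 2) powr ?N * (1 - (norm z)\<^sup>2) \<le> w z"
    by (rule hopf_lower_bound[OF w(1,2), where K=0]) (use w(3,4) z low r sub in auto)
  moreover have "(1 / 3) powr ?N * (r / 2) powr ?N = (1 / 30) powr ?N * \<mu> powr (- ?N)"
    using mu unfolding r_def by (simp add: powr_minus powr_divide powr_mult field_simps flip: powr_mult)
  ultimately show ?thesis by (simp add: mult.assoc)
qed

text \<open>The function \<open>(\<rho>\<^sup>2 - |x - y|\<^sup>2)\<^sup>2\<close> plays the part of the first Dirichlet eigenfunction of the ball.\<close>

lemma supersolution_eigenvalue_bound:
  fixes w :: "'a::euclidean_space \<Rightarrow> real"
  assumes w: "haslap (ball y \<rho>) w G L" "continuous_on (cball y \<rho>) w" and \<rho>: "\<rho> > 0"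
    and pos: "\<And>x. x \<in> cball y \<rho> \<Longrightarrow> 0 < w x" and L: "\<And>x. x \<in> ball y \<rho> \<Longrightarrow> L x \<le> - l * w x"
  shows "l \<le> 2 * real DIM('a) * (real DIM('a) + 2) / \<rho>\<^sup>2"
proof -
  let ?N = "real DIM('a)"
  define s where "s x = \<rho>\<^sup>2 - (x - y) \<bullet> (x - y)" for x
  define \<phi> where "\<phi> x = s x * s x" for x
  have hs: "haslap (ball y \<rho>) s (\<lambda>x. 0 - 2 *\<^sub>R (x - y)) (\<lambda>x. 0 - real (2 * DIM('a)))"
    unfolding s_def by (intro haslap_diff haslap_const haslap_dist_sq) auto
  note h\<phi> = haslap_mult[OF hs hs, folded \<phi>_def]
  let ?L = "\<lambda>x. s x * (0 - real (2 * DIM('a))) + s x * (0 - real (2 * DIM('a))) + 2 * ((0 - 2 *\<^sub>R (x - y)) \<bullet> (0 - 2 *\<^sub>R (x - y)))"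
  have s_eq: "s x = \<rho>\<^sup>2 - (dist y x)\<^sup>2" for x
    by (simp add: s_def dist_norm norm_minus_commute power2_norm_eq_inner)
  have spos: "s x > 0" if "x \<in> ball y \<rho>" for x
    using that \<rho> unfolding s_eq by (simp add: power_strict_mono)
  define C where "C = 2 * ?N * (?N + 2) / \<rho>\<^sup>2"
  have LC: "- ?L x \<le> C * \<phi> x" if "x \<in> ball y \<rho>" for x
  proof -
    have e: "- ?L x = 4 * ?N * s x - 8 * (\<rho>\<^sup>2 - s x)" by (simp add: s_def)
    have "s x * (4 * ?N + 8) \<le> C * s x * s x + 8 * \<rho>\<^sup>2"
    proof -
      \<comment> \<open>After clearing the denominator the claim is a quadratic inequality in
        \<open>s x\<close>. It follows by completing a square, because (N+2)^2/4 <= N(N+2) for N >=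
        1.\<close>
      define E where "E = ?N * (?N + 2) * (s x)\<^sup>2 + 4 * \<rho>\<^sup>2 * \<rho>\<^sup>2 - 2 * (?N + 2) * s x * \<rho>\<^sup>2"
      have id: "C * s x * s x + 8 * \<rho>\<^sup>2 - s x * (4 * ?N + 8) = 2 * E / \<rho>\<^sup>2"
        unfolding C_def E_def using \<rho> by (simp add: field_simps power2_eq_square)
      have "0 \<le> E"
      proof -
        have "0 \<le> ((?N + 2) / 2 * s x - 2 * \<rho>\<^sup>2)\<^sup>2" by simp
        also have "\<dots> = (?N + 2)\<^sup>2 / 4 * (s x)\<^sup>2 + 4 * \<rho>\<^sup>2 * \<rho>\<^sup>2 - 2 * (?N + 2) * s x * \<rho>\<^sup>2"
          by (simp add: power2_eq_square field_simps)
        also have "(?N + 2)\<^sup>2 / 4 \<le> ?N * (?N + 2)"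
        proof -
          have "?N \<ge> 1" using DIM_positive[where 'a='a] by linarith
          then have "?N + 2 \<le> 4 * ?N" by linarith
          then have "(?N + 2) * (?N + 2) \<le> (4 * ?N) * (?N + 2)" by (intro mult_right_mono) auto
          then show ?thesis by (simp add: power2_eq_square)
        qed
        then have "(?N + 2)\<^sup>2 / 4 * (s x)\<^sup>2 + 4 * \<rho>\<^sup>2 * \<rho>\<^sup>2 - 2 * (?N + 2) * s x * \<rho>\<^sup>2
            \<le> ?N * (?N + 2) * (s x)\<^sup>2 + 4 * \<rho>\<^sup>2 * \<rho>\<^sup>2 - 2 * (?N + 2) * s x * \<rho>\<^sup>2"
          using mult_right_mono[of "(?N + 2)\<^sup>2 / 4" "?N * (?N + 2)" "(s x)\<^sup>2"] by simp
        finally show "0 \<le> E" unfolding E_def .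
      qed
      then have "0 \<le> C * s x * s x + 8 * \<rho>\<^sup>2 - s x * (4 * ?N + 8)"
        unfolding id by simp
      then show ?thesis by simp
    qed
    then show ?thesis unfolding e \<phi>_def by (simp add: algebra_simps)
  qed
  have cphi: "continuous_on (cball y \<rho>) (\<lambda>x. \<phi> x / w x)"
    unfolding \<phi>_def s_def using pos by (intro continuous_intros w) (force simp: )
  \<comment> \<open>At a maximum of \<phi>/w the multiple t w touches \<phi> from above, so the
    Laplacian of t w - \<phi> is nonnegative there. The two differential inequalities bound it by t
    w (C - l), whence l <= C.\<close>
  obtain x where x: "x \<in> cball y \<rho>" "\<And>z. z \<in> cball y \<rho> \<Longrightarrow> \<phi> z / w z \<le> \<phi> x / w x"
    using continuous_attains_sup[OF compact_cball _ cphi] \<rho> by auto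
  define t where "t = \<phi> x / w x"
  have "0 < \<phi> y / w y" using spos[of y] pos[of y] \<rho> by (simp add: \<phi>_def)
  then have t: "t > 0" using x(2)[of y] \<rho> unfolding t_def by auto
  have xin: "x \<in> ball y \<rho>"
  proof (rule ccontr)
    assume "x \<notin> ball y \<rho>"
    then have "dist y x = \<rho>" using x(1) by auto
    then have "\<phi> x = 0" by (simp add: \<phi>_def s_eq)
    then show False using t by (simp add: t_def)
  qed
  have hh: "haslap (ball y \<rho>) (\<lambda>x. t * w x - \<phi> x) (\<lambda>x. t *\<^sub>R G x - (s x *\<^sub>R (0 - 2 *\<^sub>R (x - y)) + s x *\<^sub>R (0 - 2 *\<^sub>R (x - y)))) (\<lambda>x. t * L x - ?L x)"
    by (intro haslap_diff haslap_cmult w h\<phi>)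
  have "0 \<le> t * L x - ?L x"
  proof (rule haslap_local_min[OF hh xin zero_less_one])
    fix z assume "z \<in> ball y \<rho>"
    then have "\<phi> z \<le> t * w z"
      using x(2)[of z] pos[of z] by (simp add: t_def pos_divide_le_eq)
    moreover have "t * w x = \<phi> x" using pos[OF x(1)] by (simp add: t_def)
    ultimately show "t * w x - \<phi> x \<le> t * w z - \<phi> z" by simp
  qed
  also have "\<dots> \<le> t * (- l * w x) + C * \<phi> x"
    using LC[OF xin] mult_left_mono[OF L[OF xin], of t] t by linarith
  also have "\<dots> = t * w x * (C - l)" using pos[OF x(1)] by (simp add: t_def algebra_simps)
  finally have "0 \<le> t * w x * (C - l)" .
  moreover have "0 < t * w x" using t pos[OF x(1)] by simp
  ultimately have "0 \<le> C - l" by (simp only: zero_le_mult_iff) linarith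
  then show ?thesis by (simp add: C_def)
qed

section \<open>A priori bounds\<close>

text \<open>Here \<open>w\<close> is a solution divided by its maximum \<open>s\<close>, and \<open>\<mu> = s\<^sup>p\<^sup>-\<^sup>1\<close>. The lower bound
  \<open>w \<ge> const \<mu>\<^sup>-\<^sup>N (1 - |x|\<^sup>2)\<close> turns the equation into \<open>-\<Delta>w \<ge> const \<mu>\<^sup>1\<^sup>/\<^sup>2 w\<close> on a fixed ball, which
  bounds \<open>\<mu>\<close>.\<close>

lemma apriori_bound:
  fixes \<alpha> :: real
  assumes "\<alpha> > 0"
  obtains K c where "K \<ge> 1" "c > 0"
    "\<And>(w::'a::euclidean_space \<Rightarrow> real) G L \<mu> p x0. haslap (ball 0 1) w G L \<Longrightarrow> continuous_on (cball 0 1) w \<Longrightarrow>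
       (\<And>x. norm x \<le> 1 \<Longrightarrow> 0 \<le> w x) \<Longrightarrow> (\<And>x. norm x < 1 \<Longrightarrow> w x \<le> 1) \<Longrightarrow>
       (\<And>x. norm x < 1 \<Longrightarrow> L x = - (\<mu> * norm x powr \<alpha> * w x powr p)) \<Longrightarrow>
       1 < p \<Longrightarrow> p \<le> 1 + 1 / (2 * real DIM('a)) \<Longrightarrow> 1 \<le> \<mu> \<Longrightarrow> 1 / \<mu> \<le> 1 - norm x0 \<Longrightarrow> w x0 = 1 \<Longrightarrow>
       \<mu> \<le> K \<and> (\<forall>z. norm z \<le> 1 \<longrightarrow> c * (1 - (norm z)\<^sup>2) \<le> w z)"
proof -
  let ?N = "real DIM('a)"
  have N: "?N \<ge> 1" using DIM_positive[where 'a='a] by linarith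
  define c0 where "c0 = 5 / 18 * (1 / 30::real) powr ?N"
  have "(1 / 30::real) powr ?N \<le> 1" using N by (intro powr_le1) auto
  then have c0: "c0 > 0" "c0 < 1" by (auto simp: c0_def)
  \<comment> \<open>The factor 7/16 is 1 - (3/4)^2, the least value of 1 - |x|^2 on the test ball
    used below.\<close>
  define e where "e = 7 / 16 * c0"
  have e: "e > 0" "e < 1" using c0 by (auto simp: e_def)
  \<comment> \<open>The eigenvalue bound 2N(N+2)/\<rho>^2 for \<rho> = 1/4, divided by the lower
    bounds for the weight and for the profile on the test ball.\<close>
  define C where "C = 32 * ?N * (?N + 2) / ((1 / 4) powr \<alpha> * e)"
  define K where "K = max 1 (C\<^sup>2)"
  show ?thesis
  proof (rule that[of K "c0 * K powr (- ?N)"])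
    show "1 \<le> K" by (simp add: K_def)
    then show "0 < c0 * K powr (- ?N)" using c0 by simp
    fix w :: "'a \<Rightarrow> real" and G L and \<mu> p :: real and x0 :: 'a
    assume w: "haslap (ball 0 1) w G L" "continuous_on (cball 0 1) w"
       "\<And>x. norm x \<le> 1 \<Longrightarrow> 0 \<le> w x" "\<And>x. norm x < 1 \<Longrightarrow> w x \<le> 1"
       "\<And>x. norm x < 1 \<Longrightarrow> L x = - (\<mu> * norm x powr \<alpha> * w x powr p)"
      and p: "1 < p" "p \<le> 1 + 1 / (2 * real DIM('a))" and mu: "1 \<le> \<mu>" "1 / \<mu> \<le> 1 - norm x0" and wx0: "w x0 = 1"
    have L0: "L x \<le> 0" if "norm x < 1" for x
      using w(3)[of x] w(5)[OF that] that mu by simp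
    have L1: "- \<mu> \<le> L x" if "norm x < 1" for x
    proof -
      have "norm x powr \<alpha> * w x powr p \<le> 1 * 1"
        using that w(3)[of x] w(4)[OF that] p assms by (intro mult_mono powr_le1) auto
      then have "\<mu> * (norm x powr \<alpha> * w x powr p) \<le> \<mu> * 1" using mu by (intro mult_left_mono) auto
      then show ?thesis using w(5)[OF that] by (simp add: mult.assoc)
    qed
    have lw: "c0 * \<mu> powr (- ?N) * (1 - (norm z)\<^sup>2) \<le> w z" if "norm z \<le> 1" for z
      unfolding c0_def by (rule lower_bound_from_maximum[OF w(1-3) L0 L1 mu wx0 that])
    have "\<mu> \<le> K"
    proof -
      obtain b :: 'a where b: "b \<in> Basis" using nonempty_Basis by blast
      \<comment> \<open>The test ball of radius 1/4 is centred at distance 1/2 from the origin, away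
        from 0, where the weight vanishes, and from the sphere, where the lower bound for
        \<open>w\<close> degenerates.\<close>
      define y :: 'a where "y = (1 / 2) *\<^sub>R b"
      have ny: "norm y = 1 / 2" using b by (simp add: y_def)
      have nx: "1 / 4 \<le> norm x" "norm x \<le> 3 / 4" if "x \<in> cball y (1 / 4)" for x
        using that norm_triangle_ineq2[of y x] norm_triangle_ineq2[of x y] ny
        by (auto simp: dist_norm norm_minus_commute)
      have wl: "e * \<mu> powr (- ?N) \<le> w x" if "x \<in> cball y (1 / 4)" for x
      proof -
        have "(norm x)\<^sup>2 \<le> (3 / 4)\<^sup>2" using nx[OF that] by (intro power_mono) auto
        then have "7 / 16 \<le> 1 - (norm x)\<^sup>2" by (simp add: power2_eq_square)
        then have "c0 * \<mu> powr (- ?N) * (7 / 16) \<le> c0 * \<mu> powr (- ?N) * (1 - (norm x)\<^sup>2)"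
          using c0 by (intro mult_left_mono) auto
        then show ?thesis using lw[of x] nx[OF that] by (simp add: e_def mult_ac)
      qed
      have epos: "e * \<mu> powr (- ?N) > 0" using e mu by simp
      have "(1 / 4) powr \<alpha> * e * \<mu> powr (1 / 2) \<le> 2 * ?N * (?N + 2) / (1 / 4)\<^sup>2"
      proof (rule supersolution_eigenvalue_bound[of y _ w G L])
        have sub: "cball y (1 / 4) \<subseteq> ball 0 1" using nx by (force simp: subset_iff)
        show "haslap (ball y (1 / 4)) w G L"
          by (rule haslap_subset[OF w(1)]) (use sub in \<open>auto simp: subset_iff\<close>)
        show "continuous_on (cball y (1 / 4)) w"
          by (rule continuous_on_subset[OF w(2)]) (use sub in \<open>auto simp: subset_iff\<close>)
        show "0 < w x" if "x \<in> cball y (1 / 4)" for x using wl[OF that] epos by linarith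
        fix x assume "x \<in> ball y (1 / 4)"
        then have x: "x \<in> cball y (1 / 4)" by auto
        have wx: "w x > 0" using wl[OF x] epos by linarith
        \<comment> \<open>The upper bound on \<open>p\<close> is spent here: N(p-1) <= 1/2 limits
          the loss to \<mu>^(-1/2), and e < 1 with p - 1 <= 1 allows e^(p-1) to be replaced by
          \<open>e\<close>.\<close>
        have "e * \<mu> powr (- 1 / 2) \<le> (e * \<mu> powr (- ?N)) powr (p - 1)"
        proof -
          have "e = e powr 1" using e by simp
          also have "\<dots> \<le> e powr (p - 1)"
          proof (rule powr_mono')
            have "1 / (2 * ?N) \<le> 1" by (rule divide_le_eq_1_pos[THEN iffD2]) (use N in linarith)+
            then show "p - 1 \<le> 1" using p by linarith
          qed (use e in auto)
          finally have 1: "e \<le> e powr (p - 1)" .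
          have "?N * (p - 1) \<le> ?N * (1 / (2 * ?N))" using p N by (intro mult_left_mono) auto
          then have "?N * (p - 1) \<le> 1 / 2" by simp
          then have "\<mu> powr (- 1 / 2) \<le> \<mu> powr (- ?N * (p - 1))" using mu by (intro powr_mono) auto
          also have "\<dots> = (\<mu> powr (- ?N)) powr (p - 1)" by (simp add: powr_powr)
          finally have "e * \<mu> powr (- 1 / 2) \<le> e powr (p - 1) * (\<mu> powr (- ?N)) powr (p - 1)"
            using 1 e by (intro mult_mono) auto
          then show ?thesis using e mu by (simp add: powr_mult)
        qed
        also have "\<dots> \<le> w x powr (p - 1)" using wl[OF x] epos p by (intro powr_mono2) auto
        finally have "(1 / 4) powr \<alpha> * (e * \<mu> powr (- 1 / 2)) \<le> norm x powr \<alpha> * w x powr (p - 1)"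
          using nx[OF x] assms e by (intro mult_mono powr_mono2) auto
        then have "\<mu> * ((1 / 4) powr \<alpha> * (e * \<mu> powr (- 1 / 2))) * w x \<le> \<mu> * (norm x powr \<alpha> * w x powr (p - 1)) * w x"
          using mu wx by (intro mult_right_mono mult_left_mono) auto
        moreover have "L x = - (\<mu> * (norm x powr \<alpha> * w x powr (p - 1)) * w x)"
        proof -
          have "w x powr p = w x powr (p - 1) * w x" using wx by (simp add: powr_diff)
          then show ?thesis using w(5)[of x] nx[OF x] by (simp add: mult.assoc)
        qed
        moreover have "\<mu> * ((1 / 4) powr \<alpha> * (e * \<mu> powr (- 1 / 2))) * w x = (1 / 4) powr \<alpha> * e * \<mu> powr (1 / 2) * w x"
        proof -
          have e3: "\<mu> * \<mu> powr (- 1 / 2) = \<mu> powr (1 / 2)"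
            using mu powr_add[of \<mu> 1 "- 1 / 2"] by simp
          have "\<mu> * ((1 / 4) powr \<alpha> * (e * \<mu> powr (- 1 / 2))) * w x = (1 / 4) powr \<alpha> * e * (\<mu> * \<mu> powr (- 1 / 2)) * w x"
            by (simp add: mult_ac)
          then show ?thesis by (simp only: e3)
        qed
        ultimately show "L x \<le> - ((1 / 4) powr \<alpha> * e * \<mu> powr (1 / 2)) * w x" unfolding mult_minus_left by linarith
      qed simp
      then have "(1 / 4) powr \<alpha> * e * \<mu> powr (1 / 2) \<le> 32 * ?N * (?N + 2)"
        by (simp add: power2_eq_square)
      then have "\<mu> powr (1 / 2) \<le> C" unfolding C_def using e by (simp add: pos_le_divide_eq mult_ac)
      then have "(\<mu> powr (1 / 2)) ^ 2 \<le> C\<^sup>2" using mu by (intro power_mono) auto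
      also have "(\<mu> powr (1 / 2)) ^ 2 = \<mu>" using mu by (simp add: powr_half_sqrt)
      finally show ?thesis by (simp add: K_def)
    qed
    moreover have "c0 * K powr (- ?N) * (1 - (norm z)\<^sup>2) \<le> w z" if "norm z \<le> 1" for z
    proof -
      have "K powr (- ?N) \<le> \<mu> powr (- ?N)" using \<open>\<mu> \<le> K\<close> mu N by (intro powr_mono2') auto
      then have "c0 * K powr (- ?N) * (1 - (norm z)\<^sup>2) \<le> c0 * \<mu> powr (- ?N) * (1 - (norm z)\<^sup>2)"
        using c0 that by (intro mult_right_mono mult_left_mono) (auto simp: power_le_one)
      then show ?thesis using lw[OF that] by simp
    qed
    ultimately show "\<mu> \<le> K \<and> (\<forall>z. norm z \<le> 1 \<longrightarrow> c0 * K powr (- ?N) * (1 - (norm z)\<^sup>2) \<le> w z)"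
      by blast
  qed
qed

text \<open>Up to the corrector \<open>k (1 - |x|\<^sup>2)\<close>, both \<open>f - m U\<close> and \<open>M U - f\<close> are nonnegative superharmonic
  functions whose quotients by \<open>U\<close> have infimum 0, so both have small means; the means add up to
  \<open>M - m\<close> times the mean of \<open>U\<close>.\<close>

lemma oscillation_estimate:
  fixes f U :: "'a::euclidean_space \<Rightarrow> real" and m M b k :: real
  assumes f: "haslap (ball 0 1) f Gf Lf" and U: "haslap (ball 0 1) U GU LU"
    and c: "continuous_on (cball 0 1) f" "continuous_on (cball 0 1) U"
    and m: "\<And>x. norm x \<le> 1 \<Longrightarrow> m * U x \<le> f x" and M: "\<And>x. norm x \<le> 1 \<Longrightarrow> f x \<le> M * U x"
    and b: "0 < b" "\<And>x. norm x < 1 \<Longrightarrow> U x \<le> b * (1 - (norm x)\<^sup>2)"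
    and om: "\<And>m'. (\<And>x. norm x < 1 \<Longrightarrow> m' * U x \<le> f x) \<Longrightarrow> m' \<le> m"
    and oM: "\<And>M'. (\<And>x. norm x < 1 \<Longrightarrow> f x \<le> M' * U x) \<Longrightarrow> M \<le> M'" and k: "0 \<le> k"
    and Lm: "\<And>x. norm x < 1 \<Longrightarrow> Lf x - m * LU x \<le> 2 * real DIM('a) * k"
    and LM: "\<And>x. norm x < 1 \<Longrightarrow> M * LU x - Lf x \<le> 2 * real DIM('a) * k"
  shows "hopf_const TYPE('a) * (M - m) * bavg 0 (1 / 5) U \<le> 2 * k"
proof -
  let ?\<kappa> = "hopf_const TYPE('a)"
  note \<kappa> = hopf_const_pos[where 'a='a]
  have half: "?\<kappa> * bavg 0 (1 / 5) h \<le> k"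
    if h: "haslap (ball 0 1) h G L" "continuous_on (cball 0 1) h" "\<And>x. norm x \<le> 1 \<Longrightarrow> 0 \<le> h x"
      and k: "0 \<le> k" "\<And>x. norm x < 1 \<Longrightarrow> L x \<le> 2 * real DIM('a) * k"
      and b: "0 < b" "\<And>x. norm x < 1 \<Longrightarrow> U x \<le> b * (1 - (norm x)\<^sup>2)"
      and opt: "\<And>m'. (\<And>x. norm x < 1 \<Longrightarrow> m' * U x \<le> h x) \<Longrightarrow> m' \<le> 0"
    for h U :: "'a \<Rightarrow> real" and G L and b k :: real
  proof (rule ccontr)
    assume "\<not> ?thesis"
    then have pos: "0 < ?\<kappa> * bavg 0 (1 / 5) h - k" by simp
    let ?d = "\<lambda>x::'a. 1 - (norm x)\<^sup>2"
    have d: "0 \<le> ?d x" if "norm x \<le> 1" for x using that by (simp add: power_le_one)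
    have hh: "haslap (ball 0 1) (\<lambda>x. h x + k * ?d x) (\<lambda>x. G x + k *\<^sub>R (- 2 *\<^sub>R x)) (\<lambda>x. L x + k * (- 2 * DIM('a)))"
      by (intro haslap_add haslap_cmult haslap_one_minus_sq h) auto
    have ch: "continuous_on (cball 0 1) (\<lambda>x. h x + k * ?d x)" by (intro continuous_intros h)
    have "bavg 0 (1 / 5) h \<le> bavg 0 (1 / 5) (\<lambda>x. h x + k * ?d x)"
      by (rule bavg_mono[of "ball 0 1"])
        (use haslap_continuous_on[OF h(1)] haslap_continuous_on[OF hh] k d in \<open>auto simp: subset_iff\<close>)
    then have le: "?\<kappa> * bavg 0 (1 / 5) h \<le> ?\<kappa> * bavg 0 (1 / 5) (\<lambda>x. h x + k * ?d x)"
      using \<kappa> by simp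
    \<comment> \<open>If the mean of \<open>h\<close> exceeded the asserted size, the Hopf bound
      minus the corrector would still be a positive multiple of 1 - |x|^2, hence of
      \<open>U\<close>. Then \<open>h\<close> would lie above a positive multiple of
      \<open>U\<close>, against optimality.\<close>
    let ?t = "(?\<kappa> * bavg 0 (1 / 5) h - k) / b"
    have "?t \<le> 0"
    proof (rule opt)
      fix x :: 'a assume x: "norm x < 1"
      have "?t * U x \<le> ?t * (b * ?d x)" using b x pos by (intro mult_left_mono) auto
      also have "\<dots> = ?\<kappa> * bavg 0 (1 / 5) h * ?d x - k * ?d x" using b(1) by (simp add: field_simps)
      also have "\<dots> \<le> ?\<kappa> * bavg 0 (1 / 5) (\<lambda>x. h x + k * ?d x) * ?d x - k * ?d x"
        using le d[of x] x by (intro diff_right_mono mult_right_mono) auto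
      also have "\<dots> \<le> h x"
      proof -
        have "?\<kappa> * bavg 0 (1 / 5) (\<lambda>x. h x + k * ?d x) * ?d x \<le> h x + k * ?d x"
        proof (rule superharmonic_lower_bound[OF hh ch])
          show "0 \<le> h y + k * ?d y" if "norm y \<le> 1" for y
            using h(3)[OF that] k(1) d[OF that] by (intro add_nonneg_nonneg mult_nonneg_nonneg)
        qed (use k x in \<open>auto simp: mult_ac\<close>)
        then show ?thesis by simp
      qed
      finally show "?t * U x \<le> h x" .
    qed
    then show False using pos b by (simp add: divide_le_0_iff)
  qed
    have hm: "haslap (ball 0 1) (\<lambda>x. f x - m * U x) (\<lambda>x. Gf x - m *\<^sub>R GU x) (\<lambda>x. Lf x - m * LU x)"
      and hM: "haslap (ball 0 1) (\<lambda>x. M * U x - f x) (\<lambda>x. M *\<^sub>R GU x - Gf x) (\<lambda>x. M * LU x - Lf x)"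
      by (intro haslap_diff haslap_cmult f U)+
    have 1: "?\<kappa> * bavg 0 (1 / 5) (\<lambda>x. f x - m * U x) \<le> k"
    proof (rule half[OF hm])
      show "m' \<le> 0" if "\<And>x. norm x < 1 \<Longrightarrow> m' * U x \<le> f x - m * U x" for m'
      proof -
        have "m + m' \<le> m"
        proof (rule om)
          fix x :: 'a assume "norm x < 1"
          then show "(m + m') * U x \<le> f x" using that[of x] by (simp add: distrib_right)
        qed
        then show ?thesis by simp
      qed
    qed (use m k b Lm in \<open>auto intro!: continuous_intros c\<close>)
    have 2: "?\<kappa> * bavg 0 (1 / 5) (\<lambda>x. M * U x - f x) \<le> k"
    proof (rule half[OF hM])
      show "m' \<le> 0" if "\<And>x. norm x < 1 \<Longrightarrow> m' * U x \<le> M * U x - f x" for m'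
      proof -
        have "M \<le> M - m'"
        proof (rule oM)
          fix x :: 'a assume "norm x < 1"
          then show "f x \<le> (M - m') * U x" using that[of x] by (simp add: left_diff_distrib)
        qed
        then show ?thesis by simp
      qed
    qed (use M k b LM in \<open>auto intro!: continuous_intros c\<close>)
    have "bavg 0 (1 / 5) (\<lambda>x. (f x - m * U x) + (M * U x - f x)) =
        bavg 0 (1 / 5) (\<lambda>x. f x - m * U x) + bavg 0 (1 / 5) (\<lambda>x. M * U x - f x)"
      by (rule bavg_add[of "ball 0 1"])
        (use haslap_continuous_on[OF hm] haslap_continuous_on[OF hM] in \<open>auto simp: subset_iff\<close>)
    also have "(\<lambda>x. (f x - m * U x) + (M * U x - f x)) = (\<lambda>x. (M - m) * U x)"
      by (simp add: left_diff_distrib)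
    finally show ?thesis
      using 1 2 by (simp add: bavg_cmult distrib_left mult.assoc)
qed

section \<open>Translation between the classical C^2 class and \<open>haslap\<close>\<close>

lemma partial_eq: "(f has_derivative D) (at x) \<Longrightarrow> partial b f x = D b"
  unfolding partial_def using frechet_derivative_at by metis

lemma Ck_on_2_haslap:
  fixes f :: "'a::euclidean_space \<Rightarrow> real"
  assumes "open S" "Ck_on 2 S f"
  shows "haslap S f (\<lambda>x. \<Sum>b\<in>Basis. partial b f x *\<^sub>R b) (laplacian f)"
proof -
  have C: "\<And>x. x \<in> S \<Longrightarrow> f differentiable (at x)"
    "\<And>b x. b \<in> Basis \<Longrightarrow> x \<in> S \<Longrightarrow> partial b f differentiable (at x)"
    "\<And>b b'. b \<in> Basis \<Longrightarrow> b' \<in> Basis \<Longrightarrow> continuous_on S (partial b' (partial b f))"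
    using assms(2) by (auto simp: numeral_2_eq_2)
  show ?thesis
  proof (rule haslapI[where H="\<lambda>x h. \<Sum>b\<in>Basis. frechet_derivative (partial b f) (at x) h *\<^sub>R b"])
    fix x assume x: "x \<in> S"
    have D: "(f has_derivative frechet_derivative f (at x)) (at x)"
      using C(1)[OF x] frechet_derivative_works by blast
    have "frechet_derivative f (at x) h = (\<Sum>b\<in>Basis. partial b f x *\<^sub>R b) \<bullet> h" for h
    proof -
      have "frechet_derivative f (at x) h = frechet_derivative f (at x) (\<Sum>b\<in>Basis. (h \<bullet> b) *\<^sub>R b)"
        by (simp add: euclidean_representation)
      also have "\<dots> = (\<Sum>b\<in>Basis. (h \<bullet> b) * partial b f x)"
        using has_derivative_linear[OF D] by (simp add: linear_sum linear_scale partial_def)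
      finally show ?thesis by (simp add: inner_sum_left mult.commute inner_commute[of h])
    qed
    then have "frechet_derivative f (at x) = (\<lambda>h. (\<Sum>b\<in>Basis. partial b f x *\<^sub>R b) \<bullet> h)" by (rule ext)
    then show "(f has_derivative (\<lambda>h. (\<Sum>b\<in>Basis. partial b f x *\<^sub>R b) \<bullet> h)) (at x)"
      using D by simp
    have "(partial b f has_derivative frechet_derivative (partial b f) (at x)) (at x)" if "b \<in> Basis" for b
      using C(2)[OF that x] frechet_derivative_works by blast
    then show "((\<lambda>x. \<Sum>b\<in>Basis. partial b f x *\<^sub>R b) has_derivative
        (\<lambda>h. \<Sum>b\<in>Basis. frechet_derivative (partial b f) (at x) h *\<^sub>R b)) (at x)"
      by (intro has_derivative_sum has_derivative_scaleR_left) auto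
    show "laplacian f x = (\<Sum>b\<in>Basis. (\<Sum>b'\<in>Basis. frechet_derivative (partial b' f) (at x) b *\<^sub>R b') \<bullet> b)"
      unfolding laplacian_def partial_def[symmetric]
      by (rule sum.cong) (auto simp: inner_sum_left inner_Basis if_distrib cong: if_cong)
  next
    fix b :: 'a assume b: "b \<in> Basis"
    have "(\<lambda>x. (\<Sum>b'\<in>Basis. frechet_derivative (partial b' f) (at x) b *\<^sub>R b') \<bullet> b) = partial b (partial b f)"
      unfolding partial_def[symmetric] using b
      by (intro ext) (simp add: inner_sum_left inner_Basis if_distrib cong: if_cong)
    then show "continuous_on S (\<lambda>x. (\<Sum>b'\<in>Basis. frechet_derivative (partial b' f) (at x) b *\<^sub>R b') \<bullet> b)"
      using C(3)[OF b b] by (simp only:)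
  qed (rule assms(1))
qed

lemma second_partial_eq:
  fixes f :: "'a::euclidean_space \<Rightarrow> real"
  assumes "open S" "\<And>x. x \<in> S \<Longrightarrow> (f has_derivative (\<lambda>h. G x \<bullet> h)) (at x)"
    "(G has_derivative H) (at x)" "x \<in> S"
  shows "(partial b f has_derivative (\<lambda>h. H h \<bullet> b)) (at x)"
proof -
  have "((\<lambda>y. G y \<bullet> b) has_derivative (\<lambda>h. H h \<bullet> b)) (at x)"
    by (rule has_derivative_inner_left[OF assms(3)])
  then show ?thesis
    by (rule has_derivative_transform_within_open[OF _ assms(1,4)]) (simp add: partial_eq[OF assms(2)])
qed

lemma haslap_laplacian: "haslap S f G L \<Longrightarrow> x \<in> S \<Longrightarrow> laplacian f x = L x"
proof (erule haslapE)
  fix H assume H: "open S" "\<And>x. x \<in> S \<Longrightarrow> (f has_derivative (\<bullet>) (G x)) (at x)"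
    "\<And>x. x \<in> S \<Longrightarrow> (G has_derivative H x) (at x)" "\<And>x. x \<in> S \<Longrightarrow> L x = (\<Sum>b\<in>Basis. H x b \<bullet> b)"
    and x: "x \<in> S"
  show "laplacian f x = L x"
    unfolding laplacian_def using partial_eq[OF second_partial_eq[OF H(1,2) H(3)[OF x] x]] H(4)[OF x] by simp
qed

lemma Ck_on_2I:
  fixes f :: "'a::euclidean_space \<Rightarrow> real"
  assumes "open S" "\<And>x. x \<in> S \<Longrightarrow> (f has_derivative (\<lambda>h. G x \<bullet> h)) (at x)"
    "\<And>x. x \<in> S \<Longrightarrow> (G has_derivative H x) (at x)"
    "\<And>b b'. b \<in> Basis \<Longrightarrow> b' \<in> Basis \<Longrightarrow> continuous_on S (\<lambda>x. H x b' \<bullet> b)"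
  shows "Ck_on 2 S f"
proof -
  have D: "(partial b f has_derivative (\<lambda>h. H x h \<bullet> b)) (at x)" if "x \<in> S" for x b
    by (rule second_partial_eq[OF assms(1,2) assms(3)[OF that] that])
  have "continuous_on S (partial b' (partial b f))" if "b \<in> Basis" "b' \<in> Basis" for b b'
    by (rule continuous_on_cong[THEN iffD2, OF refl _ assms(4)[OF that]]) (simp add: partial_eq[OF D])
  moreover have "f differentiable (at x)" "partial b f differentiable (at x)" if "x \<in> S" for x b
    using assms(2)[OF that] D[OF that] by (auto intro: differentiableI)
  ultimately show ?thesis by (auto simp: numeral_2_eq_2)
qed

text \<open>Derivatives at a point of an open set see only nearby values. This is used to pass from
  a smooth radial function to its extension by zero, which agrees with it only inside the
  ball.\<close>

lemma Ck_on_2_cong: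
  assumes "open S" "Ck_on 2 S f" "\<And>x. x \<in> S \<Longrightarrow> g x = f x"
  shows "Ck_on 2 S g"
proof -
  have C: "\<And>x. x \<in> S \<Longrightarrow> f differentiable (at x)"
    "\<And>b x. b \<in> Basis \<Longrightarrow> x \<in> S \<Longrightarrow> partial b f differentiable (at x)"
    "\<And>b b'. b \<in> Basis \<Longrightarrow> b' \<in> Basis \<Longrightarrow> continuous_on S (partial b' (partial b f))"
    using assms(2) by (auto simp: numeral_2_eq_2)
  have step: "k differentiable (at x)" "partial b k x = partial b h x"
    if "h differentiable (at x)" "\<And>x. x \<in> S \<Longrightarrow> k x = h x" "x \<in> S" for h k :: "'a \<Rightarrow> real" and x b
  proof -
    have "(h has_derivative frechet_derivative h (at x)) (at x)" using that(1) frechet_derivative_works by blast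
    then have "(k has_derivative frechet_derivative h (at x)) (at x)"
      by (rule has_derivative_transform_within_open[OF _ assms(1) that(3)]) (use that in auto)
    then show "k differentiable (at x)" "partial b k x = partial b h x"
      by (auto simp: differentiable_def partial_eq) (simp add: partial_def)
  qed
  have p: "partial b g x = partial b f x" if "x \<in> S" for x b
    using step(2)[OF C(1)] assms(3) that by blast
  have "partial b g differentiable (at x)" "partial b' (partial b g) x = partial b' (partial b f) x"
    if "b \<in> Basis" "x \<in> S" for b b' x
    using step[OF C(2)[OF that]] p that by blast+
  moreover have "g differentiable (at x)" if "x \<in> S" for x using step(1)[OF C(1)] assms(3) that by blast
  moreover have "continuous_on S (partial b' (partial b g))" if "b \<in> Basis" "b' \<in> Basis" for b b'
    by (rule continuous_on_cong[THEN iffD2, OF refl _ C(3)[OF that]]) (use calculation(2)[OF that(1)] in simp)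
  ultimately show ?thesis by (auto simp: numeral_2_eq_2)
qed

section \<open>Radial solutions\<close>

text \<open>For s > 0 this is s^(-n-1) times the integral of t^n g(t) over [0, s]. The rescaling to
  [0, 1] makes it meaningful and continuous for all real s, including the singular point 0.\<close>

definition ravg :: "nat \<Rightarrow> (real \<Rightarrow> real) \<Rightarrow> real \<Rightarrow> real" where
  "ravg n g s = integral {0..1} (\<lambda>\<tau>. \<tau> ^ n * g (s * \<tau>))"

lemma ravg_integrable:
  fixes g :: "real \<Rightarrow> real"
  assumes "continuous_on UNIV g"
  shows "(\<lambda>\<tau>. \<tau> ^ n * g (s * \<tau>)) integrable_on {0..1}"
  by (rule integrable_continuous_interval)
    (auto intro!: continuous_intros continuous_on_compose2[OF assms])

lemma ravg_diff:
  assumes "continuous_on UNIV g" "continuous_on UNIV h"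
  shows "ravg n (\<lambda>t. g t - h t) s = ravg n g s - ravg n h s"
  unfolding ravg_def right_diff_distrib
  by (rule integral_diff[OF ravg_integrable[OF assms(1)] ravg_integrable[OF assms(2)]])

lemma ravg_continuous_param:
  fixes q :: "real \<Rightarrow> real \<Rightarrow> real"
  assumes "continuous_on UNIV (\<lambda>(l, t). q l t)"
  shows "continuous_on UNIV (\<lambda>(l, s). ravg n (q l) s)"
proof -
  have c: "continuous_on UNIV (\<lambda>p. q (fst p) (snd p))" using assms by (simp add: split_beta)
  have "continuous_on (UNIV \<times> cbox 0 1) (\<lambda>(p, \<tau>). \<tau> ^ n * q (fst p) (snd p * \<tau>))"
  proof -
    have "continuous_on (UNIV \<times> cbox 0 1)
        (\<lambda>z. q (fst (fst (fst z), snd (fst z) * snd z)) (snd (fst (fst z), snd (fst z) * snd z)))"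
      by (rule continuous_on_compose2[OF c]) (auto intro!: continuous_intros)
    then have "continuous_on (UNIV \<times> cbox 0 1) (\<lambda>z. q (fst (fst z)) (snd (fst z) * snd z))" by simp
    then show ?thesis unfolding split_beta by (intro continuous_intros)
  qed
  from integral_continuous_on_param[OF this] show ?thesis
    unfolding ravg_def split_beta by (simp add: split_beta)
qed

lemma ravg_continuous: "continuous_on UNIV g \<Longrightarrow> continuous_on UNIV (ravg n g)"
proof -
  assume g: "continuous_on UNIV g"
  have "continuous_on UNIV (\<lambda>(l::real, t). g t)"
    unfolding split_beta by (rule continuous_on_compose2[OF g]) (auto intro!: continuous_intros)
  from ravg_continuous_param[OF this, of n]
  have "continuous_on UNIV (\<lambda>p::real \<times> real. ravg n g (snd p))" by (simp add: split_beta)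
  then have "continuous_on UNIV (\<lambda>s. ravg n g (snd (0::real, s)))"
    by (rule continuous_on_compose2) (auto intro!: continuous_intros)
  then show ?thesis by simp
qed

lemma ravg_substitution:
  assumes g: "continuous_on UNIV g" and s: "s > 0"
  shows "s ^ Suc n * ravg n g s = integral {0..s} (\<lambda>t. t ^ n * g t)"
proof -
  have "((\<lambda>t. t ^ n * g t) has_integral integral {0..s} (\<lambda>t. t ^ n * g t)) (cbox 0 s)"
    unfolding cbox_interval
    by (intro integrable_integral integrable_continuous_interval continuous_intros continuous_on_subset[OF g]) auto
  from has_integral_affinity'[OF this s, of 0]
  have "((\<lambda>\<tau>. (s * \<tau>) ^ n * g (s * \<tau>)) has_integral integral {0..s} (\<lambda>t. t ^ n * g t) / s) {0..1}"
    using s by (simp add: divide_inverse mult.commute)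
  then have "integral {0..1} (\<lambda>\<tau>. s ^ n * (\<tau> ^ n * g (s * \<tau>))) = integral {0..s} (\<lambda>t. t ^ n * g t) / s"
    by (intro integral_unique) (simp add: power_mult_distrib mult.assoc)
  then have "s ^ n * ravg n g s = integral {0..s} (\<lambda>t. t ^ n * g t) / s"
    by (simp add: ravg_def)
  then show ?thesis using s by (simp add: field_simps)
qed

lemma ravg_derivative:
  assumes g: "continuous_on UNIV g" and s: "s > 0"
  shows "(ravg n g has_real_derivative (g s - (1 + n) * ravg n g s) / s) (at s)"
proof -
  let ?I = "\<lambda>s. integral {0..s} (\<lambda>t. t ^ n * g t)"
  have "(?I has_real_derivative s ^ n * g s) (at s within {0..s + 1})"
    by (rule integral_has_real_derivative) (use s in \<open>auto intro!: continuous_intros continuous_on_subset[OF g]\<close>)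
  then have I: "(?I has_real_derivative s ^ n * g s) (at s)"
    using s by (simp add: at_within_Icc_at)
  have eq: "ravg n g t = ?I t / t ^ Suc n" if "t > 0" for t
    using ravg_substitution[OF g that, of n] that by (simp add: field_simps)
  have P: "((\<lambda>t. t ^ Suc n) has_real_derivative (1 + n) * s ^ n) (at s)"
    by (rule derivative_eq_intros refl)+ simp
  have "((\<lambda>t. ?I t / t ^ Suc n) has_real_derivative
      (s ^ n * g s * s ^ Suc n - ?I s * ((1 + n) * s ^ n)) / (s ^ Suc n * s ^ Suc n)) (at s)"
    by (rule DERIV_divide[OF I P]) (use s in simp)
  also have "?I s = s ^ Suc n * ravg n g s" by (rule ravg_substitution[OF g s, symmetric])
  also have "(s ^ n * g s * s ^ Suc n - s ^ Suc n * ravg n g s * ((1 + n) * s ^ n)) / (s ^ Suc n * s ^ Suc n)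
      = (g s - (1 + n) * ravg n g s) / s"
  proof -
    have "s ^ n \<noteq> 0" using s by simp
    have "s ^ n * g s * s ^ Suc n - s ^ Suc n * ravg n g s * ((1 + n) * s ^ n) = (s ^ Suc n * s ^ n) * (g s - (1 + n) * ravg n g s)"
      by (simp add: right_diff_distrib mult_ac)
    moreover have "s ^ Suc n * s ^ Suc n = (s ^ Suc n * s ^ n) * s" by (simp add: mult_ac)
    ultimately show ?thesis using s by simp
  qed
  finally have "(ravg n g has_real_derivative (g s - real (1 + n) * ravg n g s) / s) (at s)"
    by (rule has_field_derivative_transform_within_open[of _ _ _ "{0<..}"]) (use s eq in auto)
  then show ?thesis by simp
qed

lemma ravg_0: "ravg n g 0 = g 0 / (1 + n)"
proof -
  have "((\<lambda>t::real. t ^ n) has_integral (1 ^ Suc n / (1 + n) - 0 ^ Suc n / (1 + n))) {0..1}"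
  proof (rule fundamental_theorem_of_calculus)
    fix x :: real
    have "((\<lambda>t. t ^ Suc n) has_real_derivative (1 + n) * x ^ n) (at x within {0..1})"
      using DERIV_power[where f="\<lambda>t. t" and n="Suc n", OF DERIV_ident] by simp
    from DERIV_cdivide[OF this, of "1 + n"]
    have "((\<lambda>t. t ^ Suc n / (1 + n)) has_real_derivative (1 + n) * x ^ n / (1 + n)) (at x within {0..1})" .
    then show "((\<lambda>t. t ^ Suc n / (1 + n)) has_vector_derivative x ^ n) (at x within {0..1})"
      by (simp add: has_real_derivative_iff_has_vector_derivative)
  qed simp
  then have "integral {0..1} (\<lambda>t::real. t ^ n) = 1 / (1 + n)" by (simp add: integral_unique)
  then show ?thesis by (simp add: ravg_def)
qed

text \<open>This is \<open>\<integral>\<^sub>0\<^sup>r s\<^sup>-\<^sup>n \<integral>\<^sub>0\<^sup>s t\<^sup>n g(t) dt ds\<close>, rescaled so that the singular factor \<open>s\<^sup>-\<^sup>n\<close> disappears;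
  in dimension \<open>n + 1\<close> it has the radial Laplacian \<open>g\<close>.\<close>

abbreviation rpot :: "nat \<Rightarrow> (real \<Rightarrow> real) \<Rightarrow> real \<Rightarrow> real" where
  "rpot n g r \<equiv> r\<^sup>2 * ravg 1 (ravg n g) r"

lemma rpot_derivative:
  assumes g: "continuous_on UNIV g" and r: "r > 0"
  shows "(rpot n g has_real_derivative r * ravg n g r) (at r)"
proof -
  have "(rpot n g has_real_derivative
      (2 * r) * ravg 1 (ravg n g) r + ((ravg n g r - (1 + 1) * ravg 1 (ravg n g) r) / r) * r\<^sup>2) (at r)"
  proof (rule DERIV_mult)
    show "(power2 has_real_derivative 2 * r) (at r)" by (auto intro!: derivative_eq_intros)
    show "(ravg 1 (ravg n g) has_real_derivative (ravg n g r - (1 + 1) * ravg 1 (ravg n g) r) / r) (at r)"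
      using ravg_derivative[OF ravg_continuous[OF g, of n] r, of 1] by simp
  qed
  also have "(2 * r) * ravg 1 (ravg n g) r + ((ravg n g r - (1 + 1) * ravg 1 (ravg n g) r) / r) * r\<^sup>2 = r * ravg n g r"
    using r by (simp add: field_simps power2_eq_square)
  finally show ?thesis .
qed

lemma continuous_tendsto_0:
  fixes k :: "'a::real_normed_vector \<Rightarrow> real"
  assumes "continuous_on UNIV k" "k 0 = 0"
  shows "(k \<longlongrightarrow> 0) (at 0)"
proof -
  have "isCont k 0" using assms(1) continuous_on_eq_continuous_at[OF open_UNIV] by blast
  then show ?thesis using assms(2) by (simp add: isCont_def)
qed

text \<open>With V = \<open>ravg (N-1) g\<close>, the gradient of \<open>f\<close> is -V(|x|) x and
  the Hessian is -(V id + W x x^T), where W = (g - N V)/|x|^2. The only danger is the origin: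
  because N V(0) = g(0), the entries of W x x^T are dominated by |g - N V|, which tends to 0
  there.\<close>

lemma radial_solution:
  fixes g :: "real \<Rightarrow> real" and a :: real
  assumes g: "continuous_on UNIV g"
  defines "f \<equiv> \<lambda>x::'a::euclidean_space. a - rpot (DIM('a) - 1) g (norm x)"
  shows "Ck_on 2 UNIV f" "haslap UNIV f (\<lambda>x. - (ravg (DIM('a) - 1) g (norm x) *\<^sub>R x)) (\<lambda>x. - g (norm x))"
proof -
  define n where "n = DIM('a) - 1"
  let ?N = "real DIM('a)"
  have n: "1 + real n = ?N" using DIM_positive[where 'a='a] by (simp add: n_def)
  define V where "V = ravg n g"
  define W where "W x = (g (norm x) - ?N * V (norm x)) / (norm x)\<^sup>2" for x :: 'a
  define H where "H x h = - (V (norm x) *\<^sub>R h + (W x * (x \<bullet> h)) *\<^sub>R x)" for x h :: 'a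
  have cV: "continuous_on UNIV V" unfolding V_def by (rule ravg_continuous[OF g])
  have V0: "?N * V 0 = g 0" unfolding V_def ravg_0 n[symmetric] by simp
  have f_eq: "f = (\<lambda>x. a - rpot n g (norm x))" by (simp add: f_def n_def)
  have cn: "continuous_on UNIV (\<lambda>x::'a. k (norm x))" if "continuous_on UNIV k" for k :: "real \<Rightarrow> real"
    by (rule continuous_on_compose2[OF that]) (auto intro!: continuous_intros)
  have df: "(f has_derivative (\<lambda>h. - (V (norm x) *\<^sub>R x) \<bullet> h)) (at x)" for x
  proof (cases "x = 0")
    case True
    let ?R = "\<lambda>h::'a. ravg 1 V (norm h)"
    have "continuous_on UNIV (\<lambda>h. norm h * \<bar>?R h\<bar>)"
      by (intro continuous_intros cn ravg_continuous cV)
    then have "((\<lambda>h. norm h * \<bar>?R h\<bar>) \<longlongrightarrow> 0) (at 0)"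
      by (rule continuous_tendsto_0) simp
    moreover have "\<forall>\<^sub>F h in at 0. norm h * \<bar>?R h\<bar> = norm (f (0 + h) - f 0 - 0) / norm h"
      by (auto simp: eventually_at_filter f_eq V_def abs_mult power2_eq_square intro!: always_eventually)
    ultimately have "((\<lambda>h. norm (f (0 + h) - f 0 - 0) / norm h) \<longlongrightarrow> 0) (at 0)"
      by (rule Lim_transform_eventually)
    then have "(f has_derivative (\<lambda>h. 0)) (at 0)" by (simp add: has_derivative_at)
    then show ?thesis using True by simp
  next
    case False
    then have r: "norm x > 0" by simp
    have "(rpot n g has_derivative (*) (norm x * V (norm x))) (at (norm x))"
      using rpot_derivative[OF g r] by (simp add: has_field_derivative_def V_def)
    from has_derivative_compose[OF has_derivative_norm[OF False] this]
    have "((\<lambda>x. rpot n g (norm x)) has_derivative (\<lambda>h. norm x * V (norm x) * (sgn x \<bullet> h))) (at x)"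
      by (simp add: inner_commute)
    also have "(\<lambda>h. norm x * V (norm x) * (sgn x \<bullet> h)) = (\<lambda>h. V (norm x) * (x \<bullet> h))"
      using r by (auto simp: sgn_div_norm field_simps)
    finally have "((\<lambda>x. rpot n g (norm x)) has_derivative (\<lambda>h. V (norm x) * (x \<bullet> h))) (at x)" .
    from has_derivative_diff[OF has_derivative_const this, of a] show ?thesis
      unfolding f_eq by simp
  qed
  have dV: "((\<lambda>x. - (V (norm x) *\<^sub>R x)) has_derivative H x) (at x)" for x
  proof (cases "x = 0")
    case True
    have "continuous_on UNIV (\<lambda>h::'a. \<bar>V (norm h) - V 0\<bar>)"
      by (intro continuous_intros cn cV)
    then have "((\<lambda>h::'a. \<bar>V (norm h) - V 0\<bar>) \<longlongrightarrow> 0) (at 0)"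
      by (rule continuous_tendsto_0) simp
    moreover have "\<bar>V (norm h) - V 0\<bar> = norm (V (norm (0 + h)) *\<^sub>R (0 + h) - V (norm (0::'a)) *\<^sub>R 0 - V 0 *\<^sub>R h) / norm h"
      if "h \<noteq> 0" for h :: 'a
      using that by (simp flip: scaleR_left_diff_distrib)
    then have "\<forall>\<^sub>F h::'a in at 0. \<bar>V (norm h) - V 0\<bar> = norm (V (norm (0 + h)) *\<^sub>R (0 + h) - V (norm (0::'a)) *\<^sub>R 0 - V 0 *\<^sub>R h) / norm h"
      by (simp add: eventually_at_filter)
    ultimately have "((\<lambda>h::'a. norm (V (norm (0 + h)) *\<^sub>R (0 + h) - V (norm (0::'a)) *\<^sub>R 0 - V 0 *\<^sub>R h) / norm h) \<longlongrightarrow> 0) (at 0)"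
      by (rule Lim_transform_eventually)
    then have "((\<lambda>x::'a. V (norm x) *\<^sub>R x) has_derivative (\<lambda>h. V 0 *\<^sub>R h)) (at 0)"
      by (simp add: has_derivative_at bounded_linear_scaleR_right)
    from has_derivative_minus[OF this] show ?thesis using True by (simp add: H_def[abs_def])
  next
    case False
    then have r: "norm x > 0" by simp
    have "(V has_derivative (*) ((g (norm x) - ?N * V (norm x)) / norm x)) (at (norm x))"
      using ravg_derivative[OF g r, of n] n by (simp add: has_field_derivative_def V_def)
    from has_derivative_compose[OF has_derivative_norm[OF False] this]
    have "((\<lambda>x. V (norm x)) has_derivative (\<lambda>h. (g (norm x) - ?N * V (norm x)) / norm x * (sgn x \<bullet> h))) (at x)"
      by (simp add: inner_commute)
    also have "(\<lambda>h. (g (norm x) - ?N * V (norm x)) / norm x * (sgn x \<bullet> h)) = (\<lambda>h. W x * (x \<bullet> h))"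
      unfolding W_def sgn_div_norm by (auto simp: divide_inverse power2_eq_square)
    finally have "((\<lambda>x. V (norm x)) has_derivative (\<lambda>h. W x * (x \<bullet> h))) (at x)" .
    from has_derivative_minus[OF has_derivative_scaleR[OF this has_derivative_ident]] show ?thesis
      by (simp add: H_def[abs_def])
  qed
  have cW: "continuous_on UNIV (\<lambda>x. W x * ((x \<bullet> b') * (x \<bullet> b)))" if b: "b \<in> Basis" "b' \<in> Basis" for b b'
  proof (rule continuous_at_imp_continuous_on, rule ballI)
    fix x :: 'a
    let ?F = "\<lambda>x. W x * ((x \<bullet> b') * (x \<bullet> b))"
    show "isCont ?F x"
    proof (cases "x = 0")
      case False
      have "continuous_on (- {0}) ?F"
        unfolding W_def by (intro continuous_intros continuous_on_subset[OF cn] g cV) auto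
      moreover have "open (- {0::'a})" by (simp add: open_Compl)
      ultimately show ?thesis using False continuous_on_eq_continuous_at by blast
    next
      case True
      let ?B = "\<lambda>x::'a. \<bar>g (norm x) - ?N * V (norm x)\<bar>"
      have "continuous_on UNIV ?B" by (intro continuous_intros cn g cV)
      then have "(?B \<longlongrightarrow> 0) (at 0)"
        by (rule continuous_tendsto_0) (use V0 in simp)
      moreover have "norm (?F x) \<le> ?B x" for x
      proof (cases "x = 0")
        case False
        have "\<bar>x \<bullet> b'\<bar> * \<bar>x \<bullet> b\<bar> \<le> norm x * norm x"
          using Basis_le_norm b by (intro mult_mono) auto
        then have "?B x / (norm x)\<^sup>2 * (\<bar>x \<bullet> b'\<bar> * \<bar>x \<bullet> b\<bar>) \<le> ?B x / (norm x)\<^sup>2 * (norm x * norm x)"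
          by (intro mult_left_mono) auto
        then show ?thesis using False by (simp add: W_def abs_mult power2_eq_square)
      qed simp
      ultimately have "(?F \<longlongrightarrow> 0) (at 0)"
        by (intro Lim_null_comparison[of ?F ?B] always_eventually) auto
      then show ?thesis using True by (simp add: isCont_def)
    qed
  qed
  have cH: "continuous_on UNIV (\<lambda>x. H x b' \<bullet> b)" if b: "b \<in> Basis" "b' \<in> Basis" for b b'
  proof -
    have "continuous_on UNIV (\<lambda>x. - (V (norm x) * (b' \<bullet> b) + W x * ((x \<bullet> b') * (x \<bullet> b))))"
      by (intro continuous_intros cW[OF b] cn cV)
    then show ?thesis by (simp add: H_def inner_add_left inner_diff_left mult.assoc)
  qed
  have tr: "- g (norm x) = (\<Sum>b\<in>Basis. H x b \<bullet> b)" for x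
  proof -
    have "(\<Sum>b\<in>Basis. H x b \<bullet> b) = - (\<Sum>b\<in>Basis. V (norm x) + W x * ((x \<bullet> b) * (x \<bullet> b)))"
      unfolding sum_negf[symmetric] by (rule sum.cong) (auto simp: H_def inner_add_left inner_diff_left mult.assoc)
    also have "\<dots> = - (?N * V (norm x) + W x * (x \<bullet> x))"
      by (simp add: sum.distrib euclidean_inner[of x x] sum_distrib_left)
    also have "\<dots> = - g (norm x)"
      using V0 by (cases "x = 0") (auto simp: W_def power2_norm_eq_inner)
    finally show ?thesis by simp
  qed
  show "Ck_on 2 UNIV f" by (rule Ck_on_2I[where G="\<lambda>x. - (V (norm x) *\<^sub>R x)" and H=H]) (use df dV cH in auto)
  show "haslap UNIV f (\<lambda>x. - (ravg (DIM('a) - 1) g (norm x) *\<^sub>R x)) (\<lambda>x. - g (norm x))"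
    by (rule haslapI[where H=H]) (use df dV cH tr in \<open>auto simp: V_def n_def\<close>)
qed

text \<open>The outer integral carries the factor r^2 times the integration variable, so the
  Gaussian weight integrates exactly and yields the gain 1/(2k). With k equal to the Lipschitz
  constant this becomes the contraction factor 1/2.\<close>

lemma rpot_bound:
  assumes q: "continuous_on UNIV q" "\<And>t. \<bar>q t\<bar> \<le> D * exp (k * t\<^sup>2)" and k: "k > 0" and D: "D \<ge> 0"
  shows "\<bar>rpot n q r\<bar> \<le> D / (2 * k) * exp (k * r\<^sup>2)"
proof -
  have G: "\<bar>ravg n q s\<bar> \<le> D * exp (k * s\<^sup>2)" for s
  proof -
    have "norm (ravg n q s) \<le> integral {0..1} (\<lambda>\<tau>::real. D * exp (k * s\<^sup>2))"
      unfolding ravg_def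
    proof (rule integral_norm_bound_integral[OF ravg_integrable[OF q(1)]])
      fix \<tau> :: real assume t: "\<tau> \<in> {0..1}"
      have "\<bar>q (s * \<tau>)\<bar> \<le> D * exp (k * (s * \<tau>)\<^sup>2)" by (rule q(2))
      also have "(s * \<tau>)\<^sup>2 \<le> s\<^sup>2" using t by (simp add: power_mult_distrib mult_left_le power_le_one)
      then have "D * exp (k * (s * \<tau>)\<^sup>2) \<le> D * exp (k * s\<^sup>2)" using k D by (simp add: mult_left_mono)
      finally have "\<bar>\<tau> ^ n\<bar> * \<bar>q (s * \<tau>)\<bar> \<le> 1 * (D * exp (k * s\<^sup>2))"
        using t by (intro mult_mono) (auto simp: power_le_one)
      then show "norm (\<tau> ^ n * q (s * \<tau>)) \<le> D * exp (k * s\<^sup>2)" by (simp add: abs_mult)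
    qed auto
    then show ?thesis by simp
  qed
  have E: "((\<lambda>\<sigma>. r\<^sup>2 * \<sigma> * (D * exp (k * (r * \<sigma>)\<^sup>2))) has_integral
     (D / (2 * k) * exp (k * (r * 1)\<^sup>2) - D / (2 * k) * exp (k * (r * 0)\<^sup>2))) {0..1}"
  proof (rule fundamental_theorem_of_calculus)
    fix x :: real
    have "((\<lambda>\<sigma>. D / (2 * k) * exp (k * (r * \<sigma>)\<^sup>2)) has_real_derivative
        D / (2 * k) * (exp (k * (r * x)\<^sup>2) * (k * (2 * (r * x) * r)))) (at x within {0..1})"
      by (auto intro!: derivative_eq_intros)
    also have "D / (2 * k) * (exp (k * (r * x)\<^sup>2) * (k * (2 * (r * x) * r))) = r\<^sup>2 * x * (D * exp (k * (r * x)\<^sup>2))"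
      using k by (simp add: field_simps power2_eq_square)
    finally show "((\<lambda>\<sigma>. D / (2 * k) * exp (k * (r * \<sigma>)\<^sup>2)) has_vector_derivative
        r\<^sup>2 * x * (D * exp (k * (r * x)\<^sup>2))) (at x within {0..1})"
      by (simp add: has_real_derivative_iff_has_vector_derivative)
  qed simp
  have "rpot n q r = integral {0..1} (\<lambda>\<sigma>. r\<^sup>2 * (\<sigma> ^ 1 * ravg n q (r * \<sigma>)))"
    by (simp only: ravg_def[of 1 "ravg n q"] integral_mult_right)
  also have "norm \<dots> \<le> integral {0..1} (\<lambda>\<sigma>. r\<^sup>2 * \<sigma> * (D * exp (k * (r * \<sigma>)\<^sup>2)))"
  proof (rule integral_norm_bound_integral)
    show "(\<lambda>\<sigma>. r\<^sup>2 * (\<sigma> ^ 1 * ravg n q (r * \<sigma>))) integrable_on {0..1}"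
      using integrable_cmul[OF ravg_integrable[OF ravg_continuous[OF q(1)], of 1], of "r\<^sup>2"] by simp
    show "(\<lambda>\<sigma>. r\<^sup>2 * \<sigma> * (D * exp (k * (r * \<sigma>)\<^sup>2))) integrable_on {0..1}" using E by blast
    fix \<sigma> :: real assume s: "\<sigma> \<in> {0..1}"
    have "r\<^sup>2 * \<sigma> * \<bar>ravg n q (r * \<sigma>)\<bar> \<le> r\<^sup>2 * \<sigma> * (D * exp (k * (r * \<sigma>)\<^sup>2))"
      using s G by (intro mult_left_mono) auto
    then show "norm (r\<^sup>2 * (\<sigma> ^ 1 * ravg n q (r * \<sigma>))) \<le> r\<^sup>2 * \<sigma> * (D * exp (k * (r * \<sigma>)\<^sup>2))"
      using s by (simp add: abs_mult mult.assoc)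
  qed
  also have "\<dots> = D / (2 * k) * exp (k * (r * 1)\<^sup>2) - D / (2 * k) * exp (k * (r * 0)\<^sup>2)"
    by (rule integral_unique[OF E])
  also have "\<dots> \<le> D / (2 * k) * exp (k * r\<^sup>2)" using k D by simp
  finally show ?thesis by simp
qed

text \<open>Picard iteration in the weighted norm \<open>sup |exp (-L r\<^sup>2) y|\<close>, in which the integral operator
  contracts by the factor \<open>1/2\<close>; carrying the parameter \<open>l\<close> along gives continuous dependence.\<close>

lemma radial_initial_value_problem:
  fixes h :: "real \<Rightarrow> real \<Rightarrow> real \<Rightarrow> real"
  assumes cont: "continuous_on UNIV (\<lambda>(l, t, y). h l t y)" and L: "L > 0"
    and lip: "\<And>l t y z. \<bar>h l t y - h l t z\<bar> \<le> L * \<bar>y - z\<bar>" and bd: "\<And>l t. \<bar>h l t 0\<bar> \<le> B"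
  obtains \<phi> :: "real \<Rightarrow> real \<Rightarrow> real" where "continuous_on UNIV (\<lambda>(l, r). \<phi> l r)"
    "\<And>l r. \<phi> l r = a - rpot n (\<lambda>t. h l t (\<phi> l t)) r"
proof -
  have cont': "continuous_on UNIV (\<lambda>p. h (fst p) (fst (snd p)) (snd (snd p)))" using cont by (simp add: split_beta)
  \<comment> \<open>The fixed point is sought as a bounded continuous function \<open>y\<close>; the
    actual solution is exp(L t^2) times \<open>y\<close>.\<close>
  define q where "q y l t = h l t (exp (L * t\<^sup>2) * apply_bcontfun y (l, t))"
    for y :: "(real \<times> real) \<Rightarrow>\<^sub>C real" and l t
  have cq: "continuous_on UNIV (\<lambda>(l, t). q y l t)" for y
  proof -
    let ?P = "\<lambda>p. (fst p, snd p, exp (L * (snd p)\<^sup>2) * apply_bcontfun y p)"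
    have "continuous_on UNIV (\<lambda>p. h (fst (?P p)) (fst (snd (?P p))) (snd (snd (?P p))))"
      by (rule continuous_on_compose2[OF cont']) (auto intro!: continuous_intros)
    then show ?thesis by (simp add: q_def split_beta)
  qed
  have cq1: "continuous_on UNIV (q y l)" for y l
  proof -
    have "continuous_on UNIV (\<lambda>p. q y (fst p) (snd p))" using cq[of y] by (simp add: split_beta)
    then have "continuous_on UNIV (\<lambda>t. q y (fst (l, t)) (snd (l, t)))"
      by (rule continuous_on_compose2) (auto intro!: continuous_intros)
    then show ?thesis by simp
  qed
  define T where "T y = (\<lambda>(l, r). exp (- L * r\<^sup>2) * (a - rpot n (q y l) r))" for y
  have expc: "exp (- L * r\<^sup>2) * (X * exp (L * r\<^sup>2)) = X" for X r by (simp add: exp_minus)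
  have B0: "B \<ge> 0" using bd[of 0 0] by linarith
  have Tb: "T y \<in> bcontfun" for y
  proof (rule bcontfun_normI)
    have "continuous_on UNIV (\<lambda>p. ravg 1 (ravg n (q y (fst p))) (snd p))"
      using ravg_continuous_param[OF ravg_continuous_param[OF cq[of y], of n], of 1] by (simp add: split_beta)
    then show "continuous_on UNIV (T y)" unfolding T_def split_beta by (intro continuous_intros)
    fix p :: "real \<times> real"
    obtain l r where p: "p = (l, r)" by fastforce
    have qb: "\<bar>q y l t\<bar> \<le> (B + L * norm y) * exp (L * t\<^sup>2)" for t
    proof -
      have "\<bar>q y l t\<bar> \<le> \<bar>h l t 0\<bar> + L * \<bar>exp (L * t\<^sup>2) * apply_bcontfun y (l, t)\<bar>"
        using lip[of l t "exp (L * t\<^sup>2) * apply_bcontfun y (l, t)" 0] unfolding q_def by simp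
      also have "\<dots> \<le> B * exp (L * t\<^sup>2) + L * (exp (L * t\<^sup>2) * norm y)"
      proof (intro add_mono mult_left_mono)
        have "B * 1 \<le> B * exp (L * t\<^sup>2)" using B0 L by (intro mult_left_mono) auto
        then show "\<bar>h l t 0\<bar> \<le> B * exp (L * t\<^sup>2)" using bd[of l t] by simp
        show "\<bar>exp (L * t\<^sup>2) * apply_bcontfun y (l, t)\<bar> \<le> exp (L * t\<^sup>2) * norm y"
          using norm_bounded[of y "(l, t)"] by (simp add: abs_mult)
      qed (use L in auto)
      finally show ?thesis by (simp add: algebra_simps)
    qed
    have "\<bar>rpot n (q y l) r\<bar> \<le> (B + L * norm y) / (2 * L) * exp (L * r\<^sup>2)"
      by (rule rpot_bound[OF cq1 qb L]) (use B0 L in auto)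
    then have "exp (- L * r\<^sup>2) * \<bar>rpot n (q y l) r\<bar> \<le> exp (- L * r\<^sup>2) * ((B + L * norm y) / (2 * L) * exp (L * r\<^sup>2))"
      by (intro mult_left_mono) auto
    also have "\<dots> = (B + L * norm y) / (2 * L)" by (rule expc)
    finally have "exp (- L * r\<^sup>2) * \<bar>rpot n (q y l) r\<bar> \<le> (B + L * norm y) / (2 * L)" .
    moreover have "exp (- L * r\<^sup>2) * \<bar>a\<bar> \<le> 1 * \<bar>a\<bar>" using L by (intro mult_right_mono) auto
    moreover have "norm (T y p) \<le> exp (- L * r\<^sup>2) * (\<bar>a\<bar> + \<bar>rpot n (q y l) r\<bar>)"
      unfolding T_def p using abs_triangle_ineq4[of a "rpot n (q y l) r"] by (simp add: abs_mult mult_left_mono)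
    ultimately show "norm (T y p) \<le> \<bar>a\<bar> + (B + L * norm y) / (2 * L)" by (simp add: distrib_left)
  qed
  have app: "apply_bcontfun (Bcontfun (T y)) = T y" for y using Tb by (simp add: Bcontfun_inverse)
  have "\<exists>!y. Bcontfun (T y) = y"
  proof (rule banach_fix_type[of "1/2"])
    show "\<forall>y z. dist (Bcontfun (T y)) (Bcontfun (T z)) \<le> 1 / 2 * dist y z"
    proof (intro allI dist_bound)
      fix y z :: "(real \<times> real) \<Rightarrow>\<^sub>C real" and p :: "real \<times> real"
      obtain l r where p: "p = (l, r)" by fastforce
      have "\<bar>q y l t - q z l t\<bar> \<le> (L * dist y z) * exp (L * t\<^sup>2)" for t
      proof -
        have "\<bar>q y l t - q z l t\<bar> \<le> L * \<bar>exp (L * t\<^sup>2) * apply_bcontfun y (l, t) - exp (L * t\<^sup>2) * apply_bcontfun z (l, t)\<bar>"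
          unfolding q_def by (rule lip)
        also have "\<dots> = L * (exp (L * t\<^sup>2) * dist (apply_bcontfun y (l, t)) (apply_bcontfun z (l, t)))"
          by (simp add: dist_real_def abs_mult flip: right_diff_distrib)
        also have "\<dots> \<le> L * (exp (L * t\<^sup>2) * dist y z)"
          using L dist_bounded by (intro mult_left_mono) auto
        finally show ?thesis by (simp add: mult_ac)
      qed
      then have "\<bar>rpot n (\<lambda>t. q y l t - q z l t) r\<bar> \<le> (L * dist y z) / (2 * L) * exp (L * r\<^sup>2)"
        using L by (intro rpot_bound continuous_on_diff cq1) auto
      moreover have "ravg n (\<lambda>t. q y l t - q z l t) = (\<lambda>s. ravg n (q y l) s - ravg n (q z l) s)"
        by (rule ext) (rule ravg_diff[OF cq1 cq1])
      then have "rpot n (\<lambda>t. q y l t - q z l t) r = rpot n (q y l) r - rpot n (q z l) r"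
        by (simp add: ravg_diff ravg_continuous cq1 right_diff_distrib)
      ultimately have "\<bar>rpot n (q y l) r - rpot n (q z l) r\<bar> \<le> dist y z / 2 * exp (L * r\<^sup>2)" using L by simp
      then have "exp (- L * r\<^sup>2) * \<bar>rpot n (q y l) r - rpot n (q z l) r\<bar> \<le> exp (- L * r\<^sup>2) * (dist y z / 2 * exp (L * r\<^sup>2))"
        by (intro mult_left_mono) auto
      also have "\<dots> = 1 / 2 * dist y z" unfolding expc by simp
      also have "exp (- L * r\<^sup>2) * \<bar>rpot n (q y l) r - rpot n (q z l) r\<bar> = \<bar>T y p - T z p\<bar>"
      proof -
        have "T y p - T z p = exp (- L * r\<^sup>2) * (rpot n (q z l) r - rpot n (q y l) r)"
          unfolding T_def p by (simp add: algebra_simps)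
        then show ?thesis by (simp add: abs_mult abs_minus_commute)
      qed
      finally show "dist (apply_bcontfun (Bcontfun (T y)) p) (apply_bcontfun (Bcontfun (T z)) p) \<le> 1 / 2 * dist y z"
        by (simp add: app dist_real_def)
    qed
  qed auto
  then obtain y where y: "Bcontfun (T y) = y" by blast
  define \<phi> where "\<phi> l r = exp (L * r\<^sup>2) * apply_bcontfun y (l, r)" for l r
  have "\<phi> l r = a - rpot n (\<lambda>t. h l t (\<phi> l t)) r" for l r
  proof -
    have "apply_bcontfun y (l, r) = T y (l, r)" using app[of y] y by simp
    then show ?thesis by (simp add: \<phi>_def T_def q_def[abs_def] exp_minus field_simps)
  qed
  moreover have "continuous_on UNIV (\<lambda>(l, r). \<phi> l r)"
    unfolding \<phi>_def split_beta by (intro continuous_intros) auto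
  ultimately show ?thesis using that by blast
qed

section \<open>Eigenfunctions of the linearised problem\<close>

lemma one_minus_sq_pos: "norm x < 1 \<Longrightarrow> 0 < 1 - (norm x)\<^sup>2"
  by (simp add: abs_square_less_1)

lemma bavg_one_minus_sq_pos: "0 < bavg 0 (1 / 5) (\<lambda>x::'a::euclidean_space. 1 - (norm x)\<^sup>2)"
proof -
  have "bavg 0 (1 / 5) (\<lambda>x::'a. 24 / 25) \<le> bavg 0 (1 / 5) (\<lambda>x::'a. 1 - (norm x)\<^sup>2)"
  proof (rule bavg_mono[of UNIV])
    fix z :: 'a assume "z \<in> cball 0 (1 / 5)"
    then have "(norm z)\<^sup>2 \<le> (1 / 5)\<^sup>2" by (intro power_mono) auto
    then show "24 / 25 \<le> 1 - (norm z)\<^sup>2" by (simp add: power2_eq_square)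
  qed (auto intro!: continuous_intros)
  moreover have "0 < 24 / 25 * ((1 / 5) ^ DIM('a) * bump_mass TYPE('a))"
    using bump_integral_pos[where 'a='a] by simp
  ultimately show ?thesis by (simp only: bavg_const)
qed

text \<open>C/(2N) (1 - |x|^2) has Laplacian -C and vanishes on the sphere, so it dominates
  \<open>v\<close> by comparison.\<close>

lemma poisson_upper_bound:
  fixes v :: "'a::euclidean_space \<Rightarrow> real"
  assumes v: "haslap (ball 0 1) v G L" "continuous_on (cball 0 1) v" "\<And>x. norm x = 1 \<Longrightarrow> v x \<le> 0"
    and L: "\<And>x. norm x < 1 \<Longrightarrow> - C \<le> L x" and z: "norm z \<le> 1"
  shows "v z \<le> C / (2 * DIM('a)) * (1 - (norm z)\<^sup>2)"
proof -
  let ?c = "C / (2 * DIM('a))"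
  have "0 \<le> ?c * (1 - (norm z)\<^sup>2) - v z"
  proof (rule weak_maximum_principle_ball[OF _ _ _ _ z])
    show "haslap (ball 0 1) (\<lambda>x. ?c * (1 - (norm x)\<^sup>2) - v x) (\<lambda>x. ?c *\<^sub>R (- 2 *\<^sub>R x) - G x)
        (\<lambda>x. ?c * (- 2 * DIM('a)) - L x)"
      by (intro haslap_diff haslap_cmult haslap_one_minus_sq v) auto
    show "continuous_on (cball 0 1) (\<lambda>x. ?c * (1 - (norm x)\<^sup>2) - v x)" by (intro continuous_intros v)
    show "0 \<le> ?c * (1 - (norm x)\<^sup>2) - v x" if "norm x = 1" for x using v(3)[OF that] that by simp
    show "?c * (- 2 * DIM('a)) - L x \<le> 0" if "norm x < 1" for x
      using L[OF that] by simp
  qed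
  then show ?thesis by simp
qed

text \<open>\<open>m\<close> is the infimum of f/U. Stating it through products suits the
  contradiction arguments, which improve an inequality m U <= f to a larger constant.\<close>

lemma optimal_lower:
  fixes f U :: "'a \<Rightarrow> real"
  assumes "S \<noteq> {}" "\<And>x. x \<in> S \<Longrightarrow> 0 < U x" "\<And>x. x \<in> S \<Longrightarrow> a * U x \<le> f x"
  obtains m where "a \<le> m" "\<And>x. x \<in> S \<Longrightarrow> m * U x \<le> f x"
    "\<And>m'. (\<And>x. x \<in> S \<Longrightarrow> m' * U x \<le> f x) \<Longrightarrow> m' \<le> m"
proof -
  let ?Q = "(\<lambda>x. f x / U x) ` S"
  have le: "b \<le> f x / U x \<longleftrightarrow> b * U x \<le> f x" if "x \<in> S" for b x
    using assms(2)[OF that] by (simp add: pos_le_divide_eq)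
  have bdd: "bdd_below ?Q" using assms(3) le by (intro bdd_belowI2[of _ a]) auto
  have g: "b \<le> Inf ?Q" if "\<And>x. x \<in> S \<Longrightarrow> b * U x \<le> f x" for b
    using that le assms(1) by (intro cINF_greatest) auto
  have "Inf ?Q * U x \<le> f x" if "x \<in> S" for x
    using le[OF that] cINF_lower[OF bdd that] by simp
  then show ?thesis using that[of "Inf ?Q"] g assms(3) by blast
qed

lemma optimal_upper:
  fixes f U :: "'a \<Rightarrow> real"
  assumes "S \<noteq> {}" "\<And>x. x \<in> S \<Longrightarrow> 0 < U x" "\<And>x. x \<in> S \<Longrightarrow> f x \<le> a * U x"
  obtains M where "M \<le> a" "\<And>x. x \<in> S \<Longrightarrow> f x \<le> M * U x"
    "\<And>M'. (\<And>x. x \<in> S \<Longrightarrow> f x \<le> M' * U x) \<Longrightarrow> M \<le> M'"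
proof -
  have "- a * U x \<le> - f x" if "x \<in> S" for x using assms(3)[OF that] by simp
  from optimal_lower[of S U "- a" "\<lambda>x. - f x", OF assms(1,2) this]
  obtain m where m: "- a \<le> m" "\<And>x. x \<in> S \<Longrightarrow> m * U x \<le> - f x"
    "\<And>m'. (\<And>x. x \<in> S \<Longrightarrow> m' * U x \<le> - f x) \<Longrightarrow> m' \<le> m"
    by blast
  show ?thesis
  proof (rule that[of "- m"])
    show "f x \<le> - m * U x" if "x \<in> S" for x using m(2)[OF that] by simp
    show "- m \<le> M'" if M': "\<And>x. x \<in> S \<Longrightarrow> f x \<le> M' * U x" for M'
    proof -
      have "- M' \<le> m"
      proof (rule m(3))
        fix x assume "x \<in> S"
        then show "- M' * U x \<le> - f x" using M'[of x] by simp
      qed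
      then show ?thesis by simp
    qed
  qed (use m(1) in simp)
qed

text \<open>In the application \<open>u\<close> solves the Henon equation, \<open>V = |x|\<^sup>\<alpha> u\<^sup>p\<^sup>-\<^sup>1\<close>, \<open>s\<close> is the maximum of \<open>u\<close>, and \<open>K\<close>
  and \<open>c\<close> depend on \<open>\<alpha>\<close> and the dimension only.\<close>

locale ground_profile =
  fixes u V :: "'a::euclidean_space \<Rightarrow> real" and Gu :: "'a \<Rightarrow> 'a" and p K c s :: real
  assumes u: "haslap (ball 0 1) u Gu (\<lambda>x. - (V x * u x))" "continuous_on (cball 0 1) u"
    and u0: "\<And>x. norm x = 1 \<Longrightarrow> u x = 0"
    and V: "\<And>x. norm x < 1 \<Longrightarrow> 0 \<le> V x" "\<And>x. norm x < 1 \<Longrightarrow> V x \<le> K"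
    and const: "1 < p" "0 < K" "0 < c" "0 < s"
    and u_lower: "\<And>x. norm x < 1 \<Longrightarrow> s * c * (1 - (norm x)\<^sup>2) \<le> u x"
    and u_upper: "\<And>x. norm x < 1 \<Longrightarrow> u x \<le> s * K * (1 - (norm x)\<^sup>2)"
    and u_le: "\<And>x. norm x < 1 \<Longrightarrow> u x \<le> s"
    and small: "(p - 1) * K < hopf_const TYPE('a) * (c * bavg 0 (1 / 5) (\<lambda>x::'a. 1 - (norm x)\<^sup>2))"
begin

text \<open>In contrast to \<open>eigenspace\<close>, nothing is prescribed outside the closed ball
  and the potential is the abstract \<open>V\<close>.\<close>

definition eigenfunction :: "real \<Rightarrow> ('a \<Rightarrow> real) \<Rightarrow> bool" where
  "eigenfunction lam v \<longleftrightarrow> continuous_on (cball 0 1) v \<and> (\<forall>x. norm x = 1 \<longrightarrow> v x = 0) \<and>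
     (\<exists>G. haslap (ball 0 1) v G (\<lambda>x. - ((p * V x + lam) * v x)))"

lemma u_pos: "norm x < 1 \<Longrightarrow> 0 < u x"
  using u_lower[of x] const one_minus_sq_pos[of x]
  by (meson less_le_trans mult_pos_pos)

lemma eigenfunction_uminus: "eigenfunction lam v \<Longrightarrow> eigenfunction lam (\<lambda>x. - v x)"
proof -
  assume "eigenfunction lam v"
  then obtain G where v: "continuous_on (cball 0 1) v" "\<And>x. norm x = 1 \<Longrightarrow> v x = 0"
    "haslap (ball 0 1) v G (\<lambda>x. - ((p * V x + lam) * v x))" by (auto simp: eigenfunction_def)
  have "haslap (ball 0 1) (\<lambda>x. - v x) (\<lambda>x. - 1 *\<^sub>R G x) (\<lambda>x. - ((p * V x + lam) * - v x))"
    using haslap_cmult[OF v(3), of "- 1"] by simp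
  then show ?thesis using v by (auto simp: eigenfunction_def intro!: continuous_intros)
qed

lemma eigenfunction_diff:
  assumes "eigenfunction lam v" "eigenfunction lam w"
  shows "eigenfunction lam (\<lambda>x. v x - r * w x)"
proof -
  obtain G where v: "continuous_on (cball 0 1) v" "\<And>x. norm x = 1 \<Longrightarrow> v x = 0"
    "haslap (ball 0 1) v G (\<lambda>x. - ((p * V x + lam) * v x))" using assms(1) by (auto simp: eigenfunction_def)
  obtain G' where w: "continuous_on (cball 0 1) w" "\<And>x. norm x = 1 \<Longrightarrow> w x = 0"
    "haslap (ball 0 1) w G' (\<lambda>x. - ((p * V x + lam) * w x))" using assms(2) by (auto simp: eigenfunction_def)
  have "haslap (ball 0 1) (\<lambda>x. v x - r * w x) (\<lambda>x. G x - r *\<^sub>R G' x) (\<lambda>x. - ((p * V x + lam) * (v x - r * w x)))"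
    by (rule haslap_cong_lap[OF haslap_diff[OF v(3) haslap_cmult[OF w(3)]]]) (simp add: algebra_simps)
  then show ?thesis using v w by (auto simp: eigenfunction_def intro!: continuous_intros)
qed

text \<open>The right-hand side of the equation is bounded, so |v| is at most a multiple of 1 -
  |x|^2, which the profile bound compares with \<open>u\<close>. Hence v/u is bounded and optimal
  constants exist.\<close>

lemma eigenfunction_le_u:
  assumes "eigenfunction lam v"
  obtains C where "C > 0" "\<And>x. norm x \<le> 1 \<Longrightarrow> \<bar>v x\<bar> \<le> C * u x"
proof -
  obtain G where v: "continuous_on (cball 0 1) v" "\<And>x. norm x = 1 \<Longrightarrow> v x = 0"
    "haslap (ball 0 1) v G (\<lambda>x. - ((p * V x + lam) * v x))" using assms by (auto simp: eigenfunction_def)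
  have "bounded (v ` cball 0 1)" by (intro compact_imp_bounded compact_continuous_image v) auto
  then obtain A where A: "A > 0" "\<And>x. norm x \<le> 1 \<Longrightarrow> \<bar>v x\<bar> \<le> A"
    unfolding bounded_pos by auto
  define D where "D = (p * K + \<bar>lam\<bar>) * A"
  have D: "\<bar>(p * V x + lam) * v x\<bar> \<le> D" if "norm x < 1" for x
    unfolding D_def abs_mult
  proof (rule mult_mono)
    have "\<bar>p * V x\<bar> \<le> p * K" using V[OF that] const by (simp add: abs_mult mult_left_mono)
    then show "\<bar>p * V x + lam\<bar> \<le> p * K + \<bar>lam\<bar>" by linarith
  qed (use A const that in auto)
  have D0: "D \<ge> 0" using D[of 0] by auto
  define C where "C = (D / (2 * DIM('a)) + 1) / (s * c)"
  have C: "C > 0" using D0 const by (auto simp: C_def intro!: divide_pos_pos add_nonneg_pos)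
  have "\<bar>v x\<bar> \<le> C * u x" if "norm x \<le> 1" for x
  proof (cases "norm x = 1")
    case True then show ?thesis using v(2) u0 by simp
  next
    case False
    then have x: "norm x < 1" using that by simp
    have 1: "v x \<le> D / (2 * DIM('a)) * (1 - (norm x)\<^sup>2)"
      by (rule poisson_upper_bound[OF v(3,1)]) (use v(2) D that in \<open>auto simp: abs_le_iff\<close>)
    have "haslap (ball 0 1) (\<lambda>x. (- 1) * v x) (\<lambda>x. (- 1) *\<^sub>R G x) (\<lambda>x. (- 1) * - ((p * V x + lam) * v x))"
      by (rule haslap_cmult[OF v(3)])
    then have "(- 1) * v x \<le> D / (2 * DIM('a)) * (1 - (norm x)\<^sup>2)"
    proof (rule poisson_upper_bound)
      show "- D \<le> (- 1) * - ((p * V x + lam) * v x)" if "norm x < 1" for x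
        using D[OF that] by (simp add: abs_le_iff)
    qed (use v that in \<open>auto intro!: continuous_intros\<close>)
    then have "\<bar>v x\<bar> \<le> D / (2 * DIM('a)) * (1 - (norm x)\<^sup>2)" using 1 by simp
    also have "\<dots> \<le> (D / (2 * DIM('a)) + 1) * (1 - (norm x)\<^sup>2)"
      using one_minus_sq_pos[OF x] by (simp add: distrib_right)
    also have "\<dots> = C * (s * c * (1 - (norm x)\<^sup>2))" using const by (simp add: C_def)
    also have "\<dots> \<le> C * u x" using C u_lower[OF x] by (intro mult_left_mono) auto
    finally show ?thesis .
  qed
  then show ?thesis using that[OF C] by blast
qed

text \<open>A quantitative strong maximum principle. Where f < \<tau> u, the Laplacian of f - \<tau>
  u is at most (\<tau>(K + K') - e) u, which is 0 for the chosen \<tau>. Thus a strict deficit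
  \<open>e * u\<close> in the differential inequality becomes a strict improvement of f >=
  0.\<close>

lemma strict_supersolution:
  assumes f: "haslap (ball 0 1) f G L" "continuous_on (cball 0 1) f" "\<And>x. norm x \<le> 1 \<Longrightarrow> 0 \<le> f x"
    and L: "\<And>x. norm x < 1 \<Longrightarrow> L x \<le> K' * f x - e * u x" and "e > 0" "K' \<ge> 0"
  shows "\<exists>\<tau>>0. \<forall>x. norm x \<le> 1 \<longrightarrow> \<tau> * u x \<le> f x"
proof -
  define \<tau> where "\<tau> = e / (K + K')"
  have \<tau>: "\<tau> > 0" using assms const by (simp add: \<tau>_def add_pos_nonneg)
  have e: "\<tau> * (K + K') = e" using const assms by (simp add: \<tau>_def)
  have "0 \<le> f z - \<tau> * u z" if z: "norm z \<le> 1" for z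
  proof (rule weak_maximum_principle_ball[OF _ _ _ _ z])
    show "haslap (ball 0 1) (\<lambda>x. f x - \<tau> * u x) (\<lambda>x. G x - \<tau> *\<^sub>R Gu x) (\<lambda>x. L x - \<tau> * - (V x * u x))"
      by (intro haslap_diff haslap_cmult f u)
    show "continuous_on (cball 0 1) (\<lambda>x. f x - \<tau> * u x)" by (intro continuous_intros f u)
    show "0 \<le> f x - \<tau> * u x" if "norm x = 1" for x using f(3)[of x] u0[OF that] that by simp
    show "L x - \<tau> * - (V x * u x) \<le> 0" if x: "norm x < 1" and neg: "f x - \<tau> * u x < 0" for x
    proof -
      have "K' * f x \<le> K' * (\<tau> * u x)" using neg \<open>K' \<ge> 0\<close> by (intro mult_left_mono) auto
      moreover have "\<tau> * (V x * u x) \<le> \<tau> * (K * u x)"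
        using V(2)[OF x] u_pos[OF x] \<tau> by (intro mult_left_mono mult_right_mono) auto
      ultimately have "L x + \<tau> * (V x * u x) \<le> (\<tau> * (K + K') - e) * u x"
        using L[OF x] by (simp add: algebra_simps)
      then show ?thesis by (simp add: e)
    qed
  qed
  then show ?thesis using \<tau> by auto
qed

text \<open>Let M be the supremum of v/u. For lam < -(p-1)K the function \<open>u\<close> is a
  strict supersolution, so if M > 0 then M u - v satisfies its inequality with a deficit
  proportional to \<open>u\<close>, and M could be lowered.\<close>

lemma no_very_negative_eigenvalue_aux:
  assumes v: "eigenfunction lam v" and lam: "lam < - ((p - 1) * K)" and x: "norm x < 1"
  shows "v x \<le> 0"
proof -
  obtain G where hv: "continuous_on (cball 0 1) v" "\<And>x. norm x = 1 \<Longrightarrow> v x = 0"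
    "haslap (ball 0 1) v G (\<lambda>x. - ((p * V x + lam) * v x))" using v by (auto simp: eigenfunction_def)
  obtain C where C: "C > 0" "\<And>x. norm x \<le> 1 \<Longrightarrow> \<bar>v x\<bar> \<le> C * u x" by (rule eigenfunction_le_u[OF v]) blast
  obtain M where M: "\<And>x. x \<in> ball 0 1 \<Longrightarrow> v x \<le> M * u x"
    "\<And>M'. (\<And>x. x \<in> ball 0 1 \<Longrightarrow> v x \<le> M' * u x) \<Longrightarrow> M \<le> M'"
    by (rule optimal_upper[of "ball 0 1" u v C]) (use C u_pos in \<open>force simp: abs_le_iff\<close>)+
  have "M \<le> 0"
  proof (rule ccontr)
    assume "\<not> M \<le> 0"
    then have Mp: "M > 0" by simp
    let ?e = "- (M * ((p - 1) * K + lam))"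
    have e: "?e > 0" using Mp lam by (simp add: mult_pos_neg)
    have hf: "haslap (ball 0 1) (\<lambda>x. M * u x - v x) (\<lambda>x. M *\<^sub>R Gu x - G x)
        (\<lambda>x. M * - (V x * u x) - - ((p * V x + lam) * v x))"
      by (intro haslap_diff haslap_cmult u hv)
    have cf: "continuous_on (cball 0 1) (\<lambda>x. M * u x - v x)" by (intro continuous_intros u hv)
    have f0: "0 \<le> M * u x - v x" if "norm x \<le> 1" for x
      using M(1)[of x] u0[of x] hv(2)[of x] that by (cases "norm x = 1") auto
    have "\<exists>\<tau>>0. \<forall>x. norm x \<le> 1 \<longrightarrow> \<tau> * u x \<le> M * u x - v x"
    proof (rule strict_supersolution[OF hf cf f0 _ e abs_ge_zero[of lam]])
      fix x :: 'a assume x: "norm x < 1"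
      let ?f = "M * u x - v x"
      have "M * - (V x * u x) - - ((p * V x + lam) * v x) = M * ((p - 1) * V x + lam) * u x - p * V x * ?f - lam * ?f"
        by (simp add: algebra_simps)
      also have "\<dots> \<le> M * ((p - 1) * K + lam) * u x - 0 + \<bar>lam\<bar> * ?f"
      proof -
        have "M * ((p - 1) * V x + lam) * u x \<le> M * ((p - 1) * K + lam) * u x"
          using Mp u_pos[OF x] V(2)[OF x] const by (intro mult_right_mono mult_left_mono add_mono) auto
        moreover have "0 \<le> p * V x * ?f" using const V(1)[OF x] f0[of x] x by (intro mult_nonneg_nonneg) auto
        moreover have "- lam * ?f \<le> \<bar>lam\<bar> * ?f" using f0[of x] x by (intro mult_right_mono) auto
        ultimately show ?thesis by linarith
      qed
      finally show "M * - (V x * u x) - - ((p * V x + lam) * v x) \<le> \<bar>lam\<bar> * ?f - ?e * u x" by simp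
    qed
    then obtain \<tau> where \<tau>: "\<tau> > 0" "\<And>x. norm x \<le> 1 \<Longrightarrow> \<tau> * u x \<le> M * u x - v x" by blast
    have "M \<le> M - \<tau>"
    proof (rule M(2))
      fix x :: 'a assume "x \<in> ball 0 1"
      then show "v x \<le> (M - \<tau>) * u x" using \<tau>(2)[of x] by (simp add: left_diff_distrib)
    qed
    then show False using \<tau>(1) by simp
  qed
  then show ?thesis using M(1)[of x] u_pos[OF x] x by (smt (verit) mem_ball_0 mult_nonpos_nonneg)
qed

lemma no_very_negative_eigenvalue:
  assumes "eigenfunction lam v" "lam < - ((p - 1) * K)" "norm x < 1"
  shows "v x = 0"
  using no_very_negative_eigenvalue_aux[OF assms] 
    no_very_negative_eigenvalue_aux[OF eigenfunction_uminus[OF assms(1)] assms(2,3)] by simp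

text \<open>If the infimum m and the supremum M of v/u do not have a common strict sign, then |v| <=
  (M - m) u. Writing -\<Delta>v = V v + ((p-1)V + lam) v compares \<open>v\<close> with
  \<open>u\<close>, up to an error of size (p-1)K(M - m)s. The oscillation estimate bounds M - m by
  itself times a factor that the assumption \<open>small\<close> makes less than 1, so M = m and
  \<open>v\<close> vanishes.\<close>

lemma eigenfunction_dichotomy:
  assumes v: "eigenfunction lam v" and lam: "- ((p - 1) * K) \<le> lam" "lam \<le> 0"
  obtains (zero) "\<And>x. norm x < 1 \<Longrightarrow> v x = 0"
  | (pos) t where "t > 0" "\<And>x. norm x < 1 \<Longrightarrow> t * u x \<le> v x"
  | (neg) t where "t > 0" "\<And>x. norm x < 1 \<Longrightarrow> t * u x \<le> - v x"
proof -
  obtain G where hv: "continuous_on (cball 0 1) v" "\<And>x. norm x = 1 \<Longrightarrow> v x = 0"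
    "haslap (ball 0 1) v G (\<lambda>x. - ((p * V x + lam) * v x))" using v by (auto simp: eigenfunction_def)
  obtain C where C: "C > 0" "\<And>x. norm x \<le> 1 \<Longrightarrow> \<bar>v x\<bar> \<le> C * u x" by (rule eigenfunction_le_u[OF v]) blast
  obtain M where M: "\<And>x. x \<in> ball 0 1 \<Longrightarrow> v x \<le> M * u x"
    "\<And>M'. (\<And>x. x \<in> ball 0 1 \<Longrightarrow> v x \<le> M' * u x) \<Longrightarrow> M \<le> M'"
    by (rule optimal_upper[of "ball 0 1" u v C]) (use C u_pos in \<open>force simp: abs_le_iff\<close>)+
  have low: "- C * u x \<le> v x" if "x \<in> ball 0 1" for x using C(2)[of x] that by (simp add: abs_le_iff)
  obtain m where m: "\<And>x. x \<in> ball 0 1 \<Longrightarrow> m * u x \<le> v x"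
    "\<And>m'. (\<And>x. x \<in> ball 0 1 \<Longrightarrow> m' * u x \<le> v x) \<Longrightarrow> m' \<le> m"
    by (rule optimal_lower[of "ball 0 1" u "- C" v, OF _ _ low]) (use u_pos in auto)
  consider "m > 0" | "M < 0" | "m \<le> 0" "0 \<le> M" by linarith
  then show ?thesis
  proof cases
    case 1 then show ?thesis using pos[of m] m(1) by simp
  next
    case 2
    have "- M * u x \<le> - v x" if "norm x < 1" for x using M(1)[of x] that by simp
    then show ?thesis using neg[of "- M"] 2 by simp
  next
    case 3
    let ?A = "M - m"
    let ?k = "(p - 1) * K * ?A * s / (2 * real DIM('a))"
    have A0: "?A \<ge> 0" using 3 by simp
    have vA: "\<bar>v x\<bar> \<le> ?A * u x" if "norm x < 1" for x
    proof -
      have "v x \<le> M * u x" "m * u x \<le> v x" using M(1) m(1) that by auto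
      moreover have "0 \<le> M * u x" "m * u x \<le> 0" using 3 u_pos[OF that] by (auto simp: mult_nonpos_nonneg)
      ultimately show ?thesis by (simp add: abs_le_iff left_diff_distrib)
    qed
    have err: "\<bar>((p - 1) * V x + lam) * v x\<bar> \<le> (p - 1) * K * ?A * s" if x: "norm x < 1" for x
    proof -
      have "0 \<le> (p - 1) * V x" "(p - 1) * V x \<le> (p - 1) * K" using V[OF x] const by (auto intro: mult_left_mono)
      then have "\<bar>(p - 1) * V x + lam\<bar> \<le> (p - 1) * K" using lam by linarith
      moreover have "\<bar>v x\<bar> \<le> ?A * s" using vA[OF x] mult_left_mono[OF u_le[OF x] A0] by linarith
      ultimately have "\<bar>(p - 1) * V x + lam\<bar> * \<bar>v x\<bar> \<le> ((p - 1) * K) * (?A * s)"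
        using const by (intro mult_mono) auto
      then show ?thesis by (simp add: abs_mult mult.assoc)
    qed
    have "hopf_const TYPE('a) * ?A * bavg 0 (1 / 5) u \<le> 2 * ?k"
    proof (rule oscillation_estimate[OF hv(3) u(1) hv(1) u(2)])
      show "m * u x \<le> v x" "v x \<le> M * u x" if "norm x \<le> 1" for x
        using m(1)[of x] M(1)[of x] u0[of x] hv(2)[of x] that by (cases "norm x = 1"; auto)+
      show "0 < s * K" using const by simp
      show "u x \<le> s * K * (1 - (norm x)\<^sup>2)" if "norm x < 1" for x by (rule u_upper[OF that])
      show "0 \<le> ?k" using A0 const by simp
      show "m' \<le> m" if "\<And>x. norm x < 1 \<Longrightarrow> m' * u x \<le> v x" for m' using m(2) that by simp
      show "M \<le> M'" if "\<And>x. norm x < 1 \<Longrightarrow> v x \<le> M' * u x" for M' using M(2) that by simp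
      have k2: "2 * real DIM('a) * ?k = (p - 1) * K * ?A * s" by simp
      fix x :: 'a assume x: "norm x < 1"
      \<comment> \<open>These are the contributions of the common potential \<open>V\<close>; they
        have the favourable sign, and only the error of order p - 1 has to be estimated.\<close>
      have Vu: "0 \<le> V x * (v x - m * u x)" "0 \<le> V x * (M * u x - v x)"
        using V(1)[OF x] m(1)[of x] M(1)[of x] x by (auto intro!: mult_nonneg_nonneg)
      have "- ((p * V x + lam) * v x) - m * - (V x * u x) = - (((p - 1) * V x + lam) * v x) - V x * (v x - m * u x)"
        by (simp add: algebra_simps)
      then show "- ((p * V x + lam) * v x) - m * - (V x * u x) \<le> 2 * real DIM('a) * ?k"
        unfolding k2 using err[OF x] Vu by linarith
      have "M * - (V x * u x) - - ((p * V x + lam) * v x) = ((p - 1) * V x + lam) * v x - V x * (M * u x - v x)"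
        by (simp add: algebra_simps)
      then show "M * - (V x * u x) - - ((p * V x + lam) * v x) \<le> 2 * real DIM('a) * ?k"
        unfolding k2 using err[OF x] Vu by linarith
    qed
    also have "2 * ?k = (p - 1) * K * ?A * s / real DIM('a)" by simp
    also have "\<dots> \<le> (p - 1) * K * ?A * s / 1"
      using A0 const DIM_positive[where 'a='a] by (intro divide_left_mono mult_nonneg_nonneg) auto
    finally have 1: "hopf_const TYPE('a) * ?A * bavg 0 (1 / 5) u \<le> (p - 1) * K * ?A * s" by simp
    let ?B = "bavg 0 (1 / 5) (\<lambda>x::'a. 1 - (norm x)\<^sup>2)"
    have "bavg 0 (1 / 5) (\<lambda>x::'a. s * c * (1 - (norm x)\<^sup>2)) \<le> bavg 0 (1 / 5) u"
      by (rule bavg_mono[of "ball 0 1"])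
        (use haslap_continuous_on[OF u(1)] u_lower in \<open>auto intro!: continuous_intros simp: subset_iff\<close>)
    then have "s * c * ?B \<le> bavg 0 (1 / 5) u" by (simp only: bavg_cmult)
    then have "hopf_const TYPE('a) * ?A * (s * c * ?B) \<le> hopf_const TYPE('a) * ?A * bavg 0 (1 / 5) u"
      using A0 hopf_const_pos[where 'a='a] by (intro mult_left_mono mult_nonneg_nonneg) auto
    then have "(?A * s) * (hopf_const TYPE('a) * (c * ?B)) \<le> (?A * s) * ((p - 1) * K)"
      using 1 by (simp add: mult_ac)
    then have "?A * s \<le> 0" using mult_strict_left_mono[OF small, of "?A * s"] by linarith
    then have "?A = 0" using A0 const by (simp add: mult_le_0_iff)
    then show ?thesis using zero vA by simp
  qed
qed

text \<open>This replaces orthogonality of eigenfunctions. If mu < lam and m is the infimum of v/w,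
  then v - m w satisfies its inequality with deficit (lam - mu) v >= (lam - mu) t u. It therefore
  exceeds a multiple of \<open>u\<close>, hence of \<open>w\<close>, and m was not optimal.\<close>

lemma positive_eigenfunction_comparison:
  assumes v: "eigenfunction lam v" "t > 0" "\<And>x. norm x < 1 \<Longrightarrow> t * u x \<le> v x"
    and w: "eigenfunction mu w" "r > 0" "\<And>x. norm x < 1 \<Longrightarrow> r * u x \<le> w x"
  shows "lam \<le> mu"
proof (rule ccontr)
  assume "\<not> lam \<le> mu"
  then have lm: "mu < lam" by simp
  obtain G where hv: "continuous_on (cball 0 1) v" "\<And>x. norm x = 1 \<Longrightarrow> v x = 0"
    "haslap (ball 0 1) v G (\<lambda>x. - ((p * V x + lam) * v x))" using v by (auto simp: eigenfunction_def)
  obtain G' where hw: "continuous_on (cball 0 1) w" "\<And>x. norm x = 1 \<Longrightarrow> w x = 0"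
    "haslap (ball 0 1) w G' (\<lambda>x. - ((p * V x + mu) * w x))" using w by (auto simp: eigenfunction_def)
  obtain C where C: "C > 0" "\<And>x. norm x \<le> 1 \<Longrightarrow> \<bar>w x\<bar> \<le> C * u x" by (rule eigenfunction_le_u[OF w(1)]) blast
  have wpos: "0 < w x" "0 < v x" if "norm x < 1" for x
    using w(3)[OF that] v(3)[OF that] u_pos[OF that] w(2) v(2) by (meson less_le_trans mult_pos_pos)+
  have vw0: "0 * w x \<le> v x" if "x \<in> ball 0 1" for x using wpos[of x] that by simp
  obtain m where m: "0 \<le> m" "\<And>x. x \<in> ball 0 1 \<Longrightarrow> m * w x \<le> v x"
    "\<And>m'. (\<And>x. x \<in> ball 0 1 \<Longrightarrow> m' * w x \<le> v x) \<Longrightarrow> m' \<le> m"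
    by (rule optimal_lower[of "ball 0 1" w 0 v, OF _ _ vw0]) (use wpos in auto)
  have hf: "haslap (ball 0 1) (\<lambda>x. v x - m * w x) (\<lambda>x. G x - m *\<^sub>R G' x)
      (\<lambda>x. - ((p * V x + lam) * v x) - m * - ((p * V x + mu) * w x))"
    by (intro haslap_diff haslap_cmult hv hw)
  have cf: "continuous_on (cball 0 1) (\<lambda>x. v x - m * w x)" by (intro continuous_intros hv hw)
  have f0: "0 \<le> v x - m * w x" if "norm x \<le> 1" for x
    using m(2)[of x] hv(2)[of x] hw(2)[of x] that by (cases "norm x = 1") auto
  have e: "(lam - mu) * t > 0" using lm v(2) by simp
  have "\<exists>\<tau>>0. \<forall>x. norm x \<le> 1 \<longrightarrow> \<tau> * u x \<le> v x - m * w x"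
  proof (rule strict_supersolution[OF hf cf f0 _ e abs_ge_zero[of mu]])
    fix x :: 'a assume x: "norm x < 1"
    let ?f = "v x - m * w x"
    have "- ((p * V x + lam) * v x) - m * - ((p * V x + mu) * w x) = - (p * V x * ?f) - mu * ?f - (lam - mu) * v x"
      by (simp add: algebra_simps)
    moreover have "0 \<le> p * V x * ?f" using const V(1)[OF x] f0[of x] x by (intro mult_nonneg_nonneg) auto
    moreover have "- mu * ?f \<le> \<bar>mu\<bar> * ?f" using f0[of x] x by (intro mult_right_mono) auto
    moreover have "(lam - mu) * (t * u x) \<le> (lam - mu) * v x" using lm v(3)[OF x] by (intro mult_left_mono) auto
    ultimately show "- ((p * V x + lam) * v x) - m * - ((p * V x + mu) * w x) \<le> \<bar>mu\<bar> * ?f - (lam - mu) * t * u x"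
      unfolding mult.assoc by linarith
  qed
  then obtain \<tau> where \<tau>: "\<tau> > 0" "\<And>x. norm x \<le> 1 \<Longrightarrow> \<tau> * u x \<le> v x - m * w x" by blast
  have "m + \<tau> / C \<le> m"
  proof (rule m(3))
    fix x :: 'a assume x: "x \<in> ball 0 1"
    have "\<tau> / C * w x \<le> \<tau> / C * (C * u x)" using \<tau>(1) C x by (intro mult_left_mono) (auto simp: abs_le_iff)
    also have "\<dots> = \<tau> * u x" using C by simp
    finally show "(m + \<tau> / C) * w x \<le> v x" using \<tau>(2)[of x] x by (simp add: distrib_right)
  qed
  then show False using \<tau>(1) C(1) by (simp add: divide_le_0_iff)
qed

text \<open>Subtract the largest multiple of \<open>w\<close> that stays below \<open>v\<close>. The
  difference is again an eigenfunction for \<open>lam\<close>; by the dichotomy it vanishes or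
  dominates a multiple of \<open>u\<close>, and the latter contradicts maximality.\<close>

lemma eigenfunction_multiple:
  assumes v: "eigenfunction lam v" and w: "eigenfunction lam w" "t > 0" "\<And>x. norm x < 1 \<Longrightarrow> t * u x \<le> w x"
    and lam: "- ((p - 1) * K) \<le> lam" "lam \<le> 0"
  obtains r where "\<And>x. norm x < 1 \<Longrightarrow> v x = r * w x"
proof -
  obtain C where C: "C > 0" "\<And>x. norm x \<le> 1 \<Longrightarrow> \<bar>v x\<bar> \<le> C * u x" by (rule eigenfunction_le_u[OF v]) blast
  obtain D where D: "D > 0" "\<And>x. norm x \<le> 1 \<Longrightarrow> \<bar>w x\<bar> \<le> D * u x" by (rule eigenfunction_le_u[OF w(1)]) blast
  have wpos: "0 < w x" if "norm x < 1" for x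
    using w(3)[OF that] u_pos[OF that] w(2) by (meson less_le_trans mult_pos_pos)
  have low: "- (C / t) * w x \<le> v x" if "x \<in> ball 0 1" for x
  proof -
    have "C * u x = C / t * (t * u x)" using w(2) by simp
    also have "\<dots> \<le> C / t * w x" using C w(2) w(3)[of x] that by (intro mult_left_mono) auto
    finally show ?thesis using C(2)[of x] that by (simp add: abs_le_iff)
  qed
  obtain m where m: "\<And>x. x \<in> ball 0 1 \<Longrightarrow> m * w x \<le> v x"
    "\<And>m'. (\<And>x. x \<in> ball 0 1 \<Longrightarrow> m' * w x \<le> v x) \<Longrightarrow> m' \<le> m"
    by (rule optimal_lower[of "ball 0 1" w "- (C / t)" v, OF _ _ low]) (use wpos in auto)
  show ?thesis
  proof (rule eigenfunction_dichotomy[OF eigenfunction_diff[OF v w(1), of m] lam])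
    assume "\<And>x. norm x < 1 \<Longrightarrow> v x - m * w x = 0"
    then show ?thesis using that[of m] by simp
  next
    fix \<tau> :: real assume \<tau>: "\<tau> > 0" "\<And>x. norm x < 1 \<Longrightarrow> \<tau> * u x \<le> v x - m * w x"
    have "m + \<tau> / D \<le> m"
    proof (rule m(2))
      fix x :: 'a assume x: "x \<in> ball 0 1"
      have "\<tau> / D * w x \<le> \<tau> / D * (D * u x)" using \<tau>(1) D x by (intro mult_left_mono) (auto simp: abs_le_iff)
      also have "\<dots> = \<tau> * u x" using D by simp
      finally show "(m + \<tau> / D) * w x \<le> v x" using \<tau>(2)[of x] x by (simp add: distrib_right)
    qed
    then have False using \<tau>(1) D(1) by (simp add: divide_le_0_iff)
    then show ?thesis ..
  next
    fix \<tau> :: real assume \<tau>: "\<tau> > 0" "\<And>x. norm x < 1 \<Longrightarrow> \<tau> * u x \<le> - (v x - m * w x)"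
    have "0 < \<tau> * u 0" using \<tau>(1) u_pos[of 0] by simp
    then show ?thesis using \<tau>(2)[of 0] m(1)[of 0] by simp
  qed
qed

end

section \<open>Existence\<close>

lemma powr_bernoulli:
  fixes x p :: real
  assumes "0 < x" "1 \<le> p"
  shows "1 + p * (x - 1) \<le> x powr p"
proof -
  define y where "y = x powr (p - 1)"
  have y: "y > 0" using assms by (simp add: y_def)
  have "1 + (p - 1) * ln x \<le> y"
    using exp_ge_add_one_self[of "(p - 1) * ln x"] assms by (simp add: y_def powr_def)
  then have "x * (1 + (p - 1) * ln x) \<le> x * y" using assms by (intro mult_left_mono) auto
  moreover have "x * y = x powr p" using assms powr_add[of x 1 "p - 1"] by (simp add: y_def)
  moreover have "(p - 1) * (x - 1) \<le> (p - 1) * (x * ln x)"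
  proof -
    have "1 - 1 / x \<le> ln x" using ln_le_minus_one[of "1 / x"] assms(1) by (simp add: ln_div)
    then have "x * (1 - 1 / x) \<le> x * ln x" using assms by (intro mult_left_mono) auto
    then show ?thesis using assms by (intro mult_left_mono) (auto simp: right_diff_distrib)
  qed
  ultimately show ?thesis by (simp add: algebra_simps)
qed

text \<open>Bernoulli's inequality applied to x/y gives the bound with the factor y^p/y, which is at
  most 1 on the unit interval. It makes the clamped nonlinearity globally Lipschitz.\<close>

lemma powr_lipschitz_unit:
  fixes a b p :: real
  assumes "1 \<le> p" "0 \<le> a" "a \<le> 1" "0 \<le> b" "b \<le> 1"
  shows "\<bar>a powr p - b powr p\<bar> \<le> p * \<bar>a - b\<bar>"
proof -
  have *: "y powr p - x powr p \<le> p * (y - x)" if xy: "0 \<le> x" "x < y" "y \<le> 1" for x y :: real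
  proof -
    have "y powr p \<le> y" using powr_mono'[of 1 p y] assms(1) xy by simp
    have 1: "1 + p * (x / y - 1) \<le> (x / y) powr p"
    proof (cases "x = 0")
      case False
      then have q: "0 < x / y" using xy by simp
      then show ?thesis by (rule powr_bernoulli[OF _ assms(1)])
    qed (use assms in simp)
    have "y powr p * (1 + p * (x / y - 1)) \<le> y powr p * (x / y) powr p"
      using 1 by (intro mult_left_mono) auto
    also have "y powr p * (x / y) powr p = x powr p" using xy by (simp flip: powr_mult)
    finally have "y powr p - x powr p \<le> y powr p / y * (p * (y - x))"
      using xy by (simp add: field_simps)
    also have "\<dots> \<le> 1 * (p * (y - x))"
      using \<open>y powr p \<le> y\<close> xy assms(1) by (intro mult_right_mono) auto
    finally show ?thesis by simp
  qed
  have mono: "x powr p \<le> y powr p" if "0 \<le> x" "x < y" for x y :: real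
    using that assms(1) by (intro powr_mono2) auto
  consider "a < b" | "b < a" | "a = b" by linarith
  then show ?thesis using *[of a b] *[of b a] mono[of a b] mono[of b a] assms
    by cases (auto simp: abs_if)
qed

lemma continuous_on_powr_nonneg:
  fixes f :: "'a::topological_space \<Rightarrow> real"
  assumes "continuous_on S f" "\<And>x. x \<in> S \<Longrightarrow> 0 \<le> f x" "0 < a"
  shows "continuous_on S (\<lambda>x. f x powr a)"
  by (rule continuous_on_powr'[OF assms(1) continuous_on_const]) (use assms in auto)

lemma ravg_nonneg:
  assumes "continuous_on UNIV g" "0 \<le> s" "\<And>t. 0 \<le> t \<Longrightarrow> t \<le> s \<Longrightarrow> 0 \<le> g t"
  shows "0 \<le> ravg n g s"
  unfolding ravg_def
proof (rule integral_nonneg[OF ravg_integrable[OF assms(1)]])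
  fix \<tau> :: real assume t: "\<tau> \<in> {0..1}"
  then have "s * \<tau> \<le> s" using assms(2) by (simp add: mult_left_le)
  then show "0 \<le> \<tau> ^ n * g (s * \<tau>)" using t assms by auto
qed

lemma rpot_nonneg:
  assumes "continuous_on UNIV g" "0 \<le> r" "\<And>t. 0 \<le> t \<Longrightarrow> t \<le> r \<Longrightarrow> 0 \<le> g t"
  shows "0 \<le> rpot n g r"
proof -
  have "0 \<le> ravg n g s" if "0 \<le> s" "s \<le> r" for s
    by (rule ravg_nonneg[OF assms(1) that(1)]) (use assms(3) that in \<open>meson order_trans\<close>)
  then have "0 \<le> ravg 1 (ravg n g) r"
    by (intro ravg_nonneg[OF ravg_continuous[OF assms(1)] assms(2)])
  then show ?thesis by simp
qed

text \<open>The Laplacian of a dilated function picks up R^2; this moves solutions between the ball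
  of radius R and the unit ball.\<close>

lemma rpot_scale:
  "rpot n (\<lambda>t. C * R\<^sup>2 * g (R * t)) r = C * rpot n g (R * r)"
proof -
  have "ravg n (\<lambda>t. C * R\<^sup>2 * g (R * t)) = (\<lambda>s. C * R\<^sup>2 * ravg n g (R * s))"
    unfolding ravg_def by (intro ext) (simp add: mult.left_commute[of _ "C * R\<^sup>2"] mult.assoc[of R])
  moreover have "ravg 1 (\<lambda>s. C * R\<^sup>2 * k (R * s)) r = C * R\<^sup>2 * ravg 1 k (R * r)" for k
    unfolding ravg_def by (simp add: mult.left_commute[of _ "C * R\<^sup>2"] mult.assoc[of R])
  ultimately show ?thesis by (simp add: power_mult_distrib)
qed

lemma first_zero:
  fixes \<phi> :: "real \<Rightarrow> real"
  assumes c: "continuous_on UNIV \<phi>" and "0 < \<phi> 0" "0 \<le> r1" "\<phi> r1 \<le> 0"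
  obtains r0 where "0 < r0" "r0 \<le> r1" "\<phi> r0 = 0" "\<And>r. 0 \<le> r \<Longrightarrow> r < r0 \<Longrightarrow> 0 < \<phi> r"
proof -
  have ivt: "\<exists>z. 0 \<le> z \<and> z \<le> r \<and> \<phi> z = 0" if "0 \<le> r" "\<phi> r \<le> 0" for r
    using IVT2'[of \<phi> r 0 0] that assms(2) continuous_on_subset[OF c] by auto
  define Z where "Z = {0..r1} \<inter> \<phi> -` {0}"
  have "closed (\<phi> -` {0})" by (rule closed_vimage[OF closed_singleton c])
  then have "compact Z" unfolding Z_def by (intro compact_Int_closed) auto
  moreover have "Z \<noteq> {}" using ivt[OF assms(3,4)] by (auto simp: Z_def)
  ultimately obtain r0 where r0: "r0 \<in> Z" "\<And>z. z \<in> Z \<Longrightarrow> r0 \<le> z"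
    using compact_attains_inf[of Z] by metis
  show ?thesis
  proof (rule that[of r0])
    have "r0 \<noteq> 0" using r0(1) assms(2) by (auto simp: Z_def)
    then show "0 < r0" "r0 \<le> r1" "\<phi> r0 = 0" using r0(1) by (auto simp: Z_def)
    fix r assume r: "0 \<le> r" "r < r0"
    show "0 < \<phi> r"
    proof (rule ccontr)
      assume "\<not> 0 < \<phi> r"
      then obtain z where "0 \<le> z" "z \<le> r" "\<phi> z = 0" using ivt[OF r(1)] by auto
      then show False using r0(2)[of z] r \<open>r0 \<le> r1\<close> by (auto simp: Z_def)
    qed
  qed
qed

lemma dirichlet_class_haslap:
  "v \<in> dirichlet_class \<Longrightarrow> haslap (ball 0 1) v (\<lambda>x. \<Sum>b\<in>Basis. partial b v x *\<^sub>R b) (laplacian v)"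
  by (rule Ck_on_2_haslap) (auto simp: dirichlet_class_def)

lemma radial_dirichlet_class:
  fixes g :: "real \<Rightarrow> real" and a :: real
  assumes g: "continuous_on UNIV g"
  defines "f \<equiv> \<lambda>x::'a::euclidean_space. a - rpot (DIM('a) - 1) g (norm x)"
  assumes bd: "a - rpot (DIM('a) - 1) g 1 = 0"
  defines "u \<equiv> \<lambda>x. if norm x < 1 then f x else 0"
  shows "u \<in> dirichlet_class" "\<And>x. norm x < 1 \<Longrightarrow> laplacian u x = - g (norm x)"
proof -
  note R = radial_solution[OF g, of a, where 'a='a, folded f_def]
  have C: "Ck_on 2 (ball 0 1) f"
    using R(1) by (auto simp: numeral_2_eq_2 intro: continuous_on_subset[OF _ subset_UNIV])
  have Cu: "Ck_on 2 (ball 0 1) u" by (rule Ck_on_2_cong[OF _ C]) (auto simp: u_def)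
  have "u x = f x" if "x \<in> cball 0 1" for x
    using bd that by (cases "norm x = 1") (auto simp: u_def f_def)
  then have "continuous_on (cball 0 1) u \<longleftrightarrow> continuous_on (cball 0 1) f" by (intro continuous_on_cong) auto
  moreover have "continuous_on (cball 0 1) f" using haslap_continuous_on[OF R(2)] continuous_on_subset by blast
  ultimately have "continuous_on (cball 0 1) u" by simp
  then show "u \<in> dirichlet_class" using Cu by (auto simp: dirichlet_class_def u_def)
  fix x :: 'a assume x: "norm x < 1"
  have "haslap (ball 0 1) f (\<lambda>x. - (ravg (DIM('a) - 1) g (norm x) *\<^sub>R x)) (\<lambda>x. - g (norm x))"
    by (rule haslap_subset[OF R(2)]) auto
  then have "haslap (ball 0 1) u (\<lambda>x. - (ravg (DIM('a) - 1) g (norm x) *\<^sub>R x)) (\<lambda>x. - g (norm x))"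
    unfolding haslap_def
    using has_derivative_transform_within_open[of f _ _ UNIV "ball 0 1" u] by (force simp: u_def)
  from haslap_laplacian[OF this, of x] x show "laplacian u x = - g (norm x)" by simp
qed

section \<open>Existence of a radial solution by solving from the centre\<close>

lemma henon_radial_solution_exists:
  fixes \<alpha> p :: real
  assumes \<alpha>: "\<alpha> > 0" and p: "1 < p" "p \<le> 1 + 1 / (2 * real DIM('a::euclidean_space))"
  shows "\<exists>u::'a \<Rightarrow> real. henon_solution \<alpha> p u \<and> radial u"
proof -
  obtain K c where K: "K \<ge> 1" and ap:
    "\<And>(w::'a \<Rightarrow> real) G L \<mu> p x0. haslap (ball 0 1) w G L \<Longrightarrow> continuous_on (cball 0 1) w \<Longrightarrow>
       (\<And>x. norm x \<le> 1 \<Longrightarrow> 0 \<le> w x) \<Longrightarrow> (\<And>x. norm x < 1 \<Longrightarrow> w x \<le> 1) \<Longrightarrow>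
       (\<And>x. norm x < 1 \<Longrightarrow> L x = - (\<mu> * norm x powr \<alpha> * w x powr p)) \<Longrightarrow>
       1 < p \<Longrightarrow> p \<le> 1 + 1 / (2 * real DIM('a)) \<Longrightarrow> 1 \<le> \<mu> \<Longrightarrow> 1 / \<mu> \<le> 1 - norm x0 \<Longrightarrow> w x0 = 1 \<Longrightarrow>
       \<mu> \<le> K \<and> (\<forall>z. norm z \<le> 1 \<longrightarrow> c * (1 - (norm z)\<^sup>2) \<le> w z)"
  proof (rule apriori_bound[OF \<alpha>, where 'a='a], goal_cases)
    case (1 K c) show ?case by (rule 1(1)[OF 1(2)]) (fact 1(4))
  qed
  define n where "n = DIM('a) - 1"
  \<comment> \<open>A solution positive up to radius R would rescale to one with \<mu> =
    R^(2+\<alpha>) >= R > K, beyond the a priori bound.\<close>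
  define R where "R = K + 1"
  have R: "R \<ge> 1" using K by (simp add: R_def)
  \<comment> \<open>Clamping the value to [0, 1] and the radius to at most R makes the nonlinearity
    globally Lipschitz. It changes nothing up to the first zero, where 0 <= \<phi> <= 1. The
    parameter \<open>l\<close> is a dummy here.\<close>
  define cl where "cl y = max 0 (min y 1)" for y :: real
  define h where "h l t y = min \<bar>t\<bar> R powr \<alpha> * cl y powr p" for l t y :: real
  have cl: "0 \<le> cl y" "cl y \<le> 1" "\<bar>cl y - cl z\<bar> \<le> \<bar>y - z\<bar>" for y z by (auto simp: cl_def)
  have cont_h: "continuous_on UNIV (\<lambda>(l, t, y). h l t y)"
    unfolding h_def split_beta cl_def using \<alpha> p R
    by (intro continuous_on_mult continuous_on_powr_nonneg continuous_intros) auto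
  have lip: "\<bar>h l t y - h l t z\<bar> \<le> (R powr \<alpha> * p) * \<bar>y - z\<bar>" for l t y z
  proof -
    have "\<bar>h l t y - h l t z\<bar> = min \<bar>t\<bar> R powr \<alpha> * \<bar>cl y powr p - cl z powr p\<bar>"
      by (simp add: h_def abs_mult flip: right_diff_distrib)
    also have "\<dots> \<le> R powr \<alpha> * (p * \<bar>y - z\<bar>)"
    proof (intro mult_mono)
      show "min \<bar>t\<bar> R powr \<alpha> \<le> R powr \<alpha>" using \<alpha> R by (intro powr_mono2) auto
      have "\<bar>cl y powr p - cl z powr p\<bar> \<le> p * \<bar>cl y - cl z\<bar>" using p cl by (intro powr_lipschitz_unit) auto
      also have "\<dots> \<le> p * \<bar>y - z\<bar>" using p cl by (intro mult_left_mono) auto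
      finally show "\<bar>cl y powr p - cl z powr p\<bar> \<le> p * \<bar>y - z\<bar>" .
    qed auto
    finally show ?thesis by (simp add: mult.assoc)
  qed
  have h0: "\<bar>h l t 0\<bar> \<le> 0" for l t by (simp add: h_def cl_def)
  have Lpos: "R powr \<alpha> * p > 0" using R p by simp
  obtain \<Phi> :: "real \<Rightarrow> real \<Rightarrow> real" where \<Phi>: "continuous_on UNIV (\<lambda>(l, r). \<Phi> l r)"
    "\<And>l r. \<Phi> l r = 1 - rpot n (\<lambda>t. h l t (\<Phi> l t)) r"
    by (rule radial_initial_value_problem[OF cont_h Lpos lip h0, of 1 n]) blast
  define \<phi> where "\<phi> = \<Phi> 0"
  define g where "g t = h 0 t (\<phi> t)" for t
  have c\<phi>: "continuous_on UNIV \<phi>"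
  proof -
    have "continuous_on UNIV (\<lambda>p. \<Phi> (fst p) (snd p))" using \<Phi>(1) by (simp add: split_beta)
    then have "continuous_on UNIV (\<lambda>r. \<Phi> (fst (0::real, r)) (snd (0::real, r)))"
      by (rule continuous_on_compose2) (auto intro!: continuous_intros)
    then show ?thesis by (simp add: \<phi>_def)
  qed
  have cg: "continuous_on UNIV g"
    unfolding g_def h_def cl_def using \<alpha> p R
    by (intro continuous_on_mult continuous_on_powr_nonneg continuous_intros c\<phi>) auto
  have \<phi>_eq: "\<phi> r = 1 - rpot n g r" for r unfolding \<phi>_def g_def[abs_def] by (rule \<Phi>(2))
  have g0: "0 \<le> g t" for t by (simp add: g_def h_def)
  have \<phi>1: "\<phi> r \<le> 1" if "0 \<le> r" for r using rpot_nonneg[OF cg that g0, of n] by (simp add: \<phi>_eq)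
  have \<phi>0: "\<phi> 0 = 1" by (simp add: \<phi>_eq)
  have gs: "continuous_on UNIV (\<lambda>t. C * \<rho>\<^sup>2 * g (\<rho> * t))" for C \<rho>
    by (intro continuous_intros continuous_on_compose2[OF cg]) auto
  have sc: "C * \<phi> (\<rho> * r) = C - rpot n (\<lambda>t. C * \<rho>\<^sup>2 * g (\<rho> * t)) r" for C \<rho> r
    unfolding rpot_scale by (simp add: \<phi>_eq right_diff_distrib)
  have g_eq: "g t = t powr \<alpha> * \<phi> t powr p" if "0 \<le> t" "t \<le> R" "0 \<le> \<phi> t" for t
    using \<phi>1[OF that(1)] that by (simp add: g_def h_def cl_def min_def)
  have "\<exists>r1. 0 \<le> r1 \<and> r1 \<le> R \<and> \<phi> r1 \<le> 0"
  proof (rule ccontr)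
    assume "\<not> ?thesis"
    then have pos: "0 < \<phi> r" if "0 \<le> r" "r \<le> R" for r using that by (meson not_less)
    \<comment> \<open>The a priori bound asks for no boundary values, so it applies to this function
      although it is still positive on the unit sphere. Its maximum 1 is attained at the
      centre.\<close>
    define w where "w x = \<phi> (R * norm x)" for x :: 'a
    define \<mu> where "\<mu> = R\<^sup>2 * R powr \<alpha>"
    have w_eq: "w = (\<lambda>x. 1 - rpot n (\<lambda>t. 1 * R\<^sup>2 * g (R * t)) (norm x))"
      by (rule ext) (use sc[of 1 R] in \<open>simp add: w_def\<close>)
    have Rx: "0 \<le> R * norm x" "R * norm x \<le> R" if "norm x \<le> 1" for x :: 'a
      using R that mult_left_mono[of "norm x" 1 R] by auto
    have hw: "haslap (ball 0 1) w (\<lambda>x. - (ravg n (\<lambda>t. 1 * R\<^sup>2 * g (R * t)) (norm x) *\<^sub>R x)) (\<lambda>x. - (1 * R\<^sup>2 * g (R * norm x)))"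
      unfolding w_eq n_def by (rule haslap_subset[OF radial_solution(2)[OF gs]]) auto
    have mu: "R \<le> \<mu>"
    proof -
      have "1 \<le> R powr \<alpha>" using R \<alpha> by (simp add: ge_one_powr_ge_zero)
      moreover have "R * 1 \<le> R * R" using R by (intro mult_left_mono) auto
      ultimately have "(R * 1) * 1 \<le> (R * R) * R powr \<alpha>" using R by (intro mult_mono) auto
      then show ?thesis by (simp add: \<mu>_def power2_eq_square)
    qed
    have "\<mu> \<le> K \<and> (\<forall>z::'a. norm z \<le> 1 \<longrightarrow> c * (1 - (norm z)\<^sup>2) \<le> w z)"
    proof (rule ap[OF hw _ _ _ _ p, where ?x0.0=0])
      show "continuous_on (cball 0 1) w" unfolding w_def
        by (intro continuous_on_compose2[OF c\<phi>] continuous_intros) auto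
      show "0 \<le> w x" if "norm x \<le> 1" for x using pos[OF Rx[OF that]] by (simp add: w_def)
      show "w x \<le> 1" if "norm x < 1" for x using \<phi>1[OF Rx(1)] that by (simp add: w_def)
      show "- (1 * R\<^sup>2 * g (R * norm x)) = - (\<mu> * norm x powr \<alpha> * w x powr p)" if x: "norm x < 1" for x
      proof -
        have "g (R * norm x) = (R * norm x) powr \<alpha> * \<phi> (R * norm x) powr p"
          using Rx[of x] pos[of "R * norm x"] x by (intro g_eq) auto
        then show ?thesis using R by (simp add: \<mu>_def w_def powr_mult)
      qed
      show "1 \<le> \<mu>" using mu R by simp
      then show "1 / \<mu> \<le> 1 - norm (0::'a)" by simp
    qed (simp add: w_def \<phi>0)
    then show False using mu by (simp add: R_def)
  qed
  then obtain r1 where r1: "0 \<le> r1" "r1 \<le> R" "\<phi> r1 \<le> 0" by blast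
  obtain r0 where r0: "0 < r0" "r0 \<le> r1" "\<phi> r0 = 0" "\<And>r. 0 \<le> r \<Longrightarrow> r < r0 \<Longrightarrow> 0 < \<phi> r"
    by (rule first_zero[OF c\<phi> _ r1(1,3)]) (use \<phi>0 in auto)
  \<comment> \<open>Chosen so that C^(p-1) = r0^(2+\<alpha>): then C \<phi>(r0 |x|) solves the
    equation with coefficient 1. The exponent is available because p > 1.\<close>
  define C where "C = r0 powr ((2 + \<alpha>) / (p - 1))"
  have C: "C > 0" using r0 by (simp add: C_def)
  have Cp: "C powr p = C * (r0\<^sup>2 * r0 powr \<alpha>)"
  proof -
    have "C powr (p - 1) = r0 powr (2 + \<alpha>)" using p by (simp add: C_def powr_powr)
    also have "\<dots> = r0\<^sup>2 * r0 powr \<alpha>" using r0 by (simp add: powr_add)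
    finally have "C powr (p - 1) = r0\<^sup>2 * r0 powr \<alpha>" .
    then show ?thesis using C powr_add[of C 1 "p - 1"] by simp
  qed
  define G where "G t = C * r0\<^sup>2 * g (r0 * t)" for t
  define u where "u x = (if norm x < 1 then C - rpot n G (norm x) else 0)" for x :: 'a
  have cG: "continuous_on UNIV G" unfolding G_def by (rule gs)
  have bd: "C - rpot n G 1 = 0" using sc[of C r0 1] r0(3) by (simp add: G_def[abs_def])
  have u: "u \<in> dirichlet_class" "\<And>x. norm x < 1 \<Longrightarrow> laplacian u x = - G (norm x)"
    using radial_dirichlet_class[OF cG, where a=C and 'a='a] bd unfolding u_def[abs_def] n_def by blast+
  have u_eq: "u x = C * \<phi> (r0 * norm x)" if "norm x < 1" for x
    using that sc[of C r0 "norm x"] by (simp add: u_def G_def[abs_def])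
  have rx: "0 \<le> r0 * norm x" "r0 * norm x < r0" if "norm x < 1" for x :: 'a
    using r0 that by auto
  have "henon_solution \<alpha> p u"
    unfolding henon_solution_def
  proof (intro conjI ballI)
    show "u \<in> dirichlet_class" by fact
    fix x :: 'a assume "x \<in> ball 0 1"
    then have x: "norm x < 1" by simp
    have \<phi>p: "0 < \<phi> (r0 * norm x)" by (rule r0(4)[OF rx[OF x]])
    then show "0 < u x" using C by (simp add: u_eq[OF x])
    have "g (r0 * norm x) = (r0 * norm x) powr \<alpha> * \<phi> (r0 * norm x) powr p"
    proof (rule g_eq)
      show "r0 * norm x \<le> R" using rx[OF x] r0(2) r1(2) by linarith
    qed (use rx[OF x] \<phi>p in auto)
    also have "\<dots> = r0 powr \<alpha> * norm x powr \<alpha> * \<phi> (r0 * norm x) powr p"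
      using r0 by (simp add: powr_mult)
    finally have "G (norm x) = norm x powr \<alpha> * (C powr p * \<phi> (r0 * norm x) powr p)"
      unfolding Cp by (simp add: G_def mult_ac)
    also have "C powr p * \<phi> (r0 * norm x) powr p = u x powr p"
      using C \<phi>p by (simp add: u_eq[OF x] powr_mult)
    finally show "- laplacian u x = norm x powr \<alpha> * u x powr p" using u(2)[OF x] by simp
  qed
  moreover have "radial u" unfolding radial_def by (rule exI[of _ "\<lambda>r. C * \<phi> (r0 * r)"]) (simp add: u_eq)
  ultimately show ?thesis by blast
qed

text \<open>Let \<open>ls\<close> be the supremum of the parameters for which the radial solution
  with value 1 at the centre is positive on [0, 1]. By continuity the solution for \<open>ls\<close>
  is nonnegative, and the barrier makes it positive inside. Comparison with \<open>u\<close> shows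
  ls < 0, so there is room above \<open>ls\<close>, and maximality forces a zero at radius
  1.\<close>

lemma (in ground_profile) ground_state_exists:
  fixes q :: "real \<Rightarrow> real"
  assumes q: "continuous_on UNIV q" "\<And>t. \<bar>q t\<bar> \<le> K" "\<And>x. norm x < 1 \<Longrightarrow> V x = q (norm x)"
  shows "\<exists>lam<0. \<exists>w t. eigenfunction lam w \<and> w \<in> dirichlet_class \<and>
    t > 0 \<and> (\<forall>x. norm x < 1 \<longrightarrow> t * u x \<le> w x)"
proof -
  define n where "n = DIM('a) - 1"
  \<comment> \<open>At l = -\<Lambda> the coefficient p q + l is nonpositive, so the solution cannot
    come down from 1 to 0. Clamping \<open>l\<close> to [-\<Lambda>, 0] keeps the Lipschitz constant
    uniform in the parameter.\<close>
  define \<Lambda> where "\<Lambda> = p * K"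
  have \<Lambda>: "\<Lambda> > 0" using const by (simp add: \<Lambda>_def)
  define h where "h l t y = (p * q t + max (- \<Lambda>) (min l 0)) * y" for l t y :: real
  have cont_h: "continuous_on UNIV (\<lambda>(l, t, y). h l t y)"
    unfolding h_def split_beta by (intro continuous_intros continuous_on_compose2[OF q(1)]) auto
  have pq: "\<bar>p * q t\<bar> \<le> \<Lambda>" for t using q(2)[of t] const by (simp add: \<Lambda>_def abs_mult mult_left_mono)
  have lip: "\<bar>h l t y - h l t z\<bar> \<le> (2 * \<Lambda>) * \<bar>y - z\<bar>" for l t y z
  proof -
    have "\<bar>p * q t + max (- \<Lambda>) (min l 0)\<bar> \<le> 2 * \<Lambda>" using pq[of t] \<Lambda> by (auto simp: max_def min_def)
    then show ?thesis unfolding h_def by (simp add: abs_mult mult_right_mono flip: right_diff_distrib)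
  qed
  have h0: "\<bar>h l t 0\<bar> \<le> 0" for l t by (simp add: h_def)
  have L2: "2 * \<Lambda> > 0" using \<Lambda> by simp
  obtain \<Phi> :: "real \<Rightarrow> real \<Rightarrow> real" where \<Phi>: "continuous_on UNIV (\<lambda>(l, r). \<Phi> l r)"
    "\<And>l r. \<Phi> l r = 1 - rpot n (\<lambda>t. h l t (\<Phi> l t)) r"
    by (rule radial_initial_value_problem[OF cont_h L2 lip h0, of 1 n]) blast
  have c\<Phi>: "continuous_on UNIV (\<lambda>p. \<Phi> (fst p) (snd p))" using \<Phi>(1) by (simp add: split_beta)
  have c1: "continuous_on UNIV (\<Phi> l)" for l
  proof -
    have "continuous_on UNIV (\<lambda>r. \<Phi> (fst (l, r)) (snd (l, r)))"
      by (rule continuous_on_compose2[OF c\<Phi>]) (auto intro!: continuous_intros)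
    then show ?thesis by simp
  qed
  have c2: "continuous_on UNIV (\<lambda>l. \<Phi> l r)" for r
  proof -
    have "continuous_on UNIV (\<lambda>l. \<Phi> (fst (l, r)) (snd (l, r)))"
      by (rule continuous_on_compose2[OF c\<Phi>]) (auto intro!: continuous_intros)
    then show ?thesis by simp
  qed
  have \<Phi>0: "\<Phi> l 0 = 1" for l using \<Phi>(2)[of l 0] by simp
  define g where "g l t = (p * q t + l) * \<Phi> l t" for l t
  have cg: "continuous_on UNIV (g l)" for l unfolding g_def by (intro continuous_intros q c1)
  have \<Phi>_eq: "\<Phi> l = (\<lambda>r. 1 - rpot n (g l) r)" if "l \<in> {- \<Lambda>..0}" for l
  proof -
    have eq: "(\<lambda>t. h l t (\<Phi> l t)) = g l" using that by (auto simp: g_def h_def max_def min_def)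
    show ?thesis unfolding eq[symmetric] by (rule ext) (rule \<Phi>(2))
  qed
  define W where "W l x = \<Phi> l (norm x)" for l and x :: 'a
  have hW: "haslap (ball 0 1) (W l) (\<lambda>x. - (ravg n (g l) (norm x) *\<^sub>R x)) (\<lambda>x. - ((p * V x + l) * W l x))"
    if l: "l \<in> {- \<Lambda>..0}" for l
  proof -
    have "W l = (\<lambda>x. 1 - rpot n (g l) (norm x))" using \<Phi>_eq[OF l] by (simp add: W_def[abs_def])
    then have "haslap UNIV (W l) (\<lambda>x. - (ravg n (g l) (norm x) *\<^sub>R x)) (\<lambda>x. - g l (norm x))"
      using radial_solution(2)[OF cg[of l], of 1, where 'a='a] by (simp add: n_def)
    then have "haslap (ball 0 1) (W l) (\<lambda>x. - (ravg n (g l) (norm x) *\<^sub>R x)) (\<lambda>x. - g l (norm x))"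
      by (rule haslap_subset) auto
    then show ?thesis by (rule haslap_cong_lap) (simp add: g_def W_def q(3))
  qed
  have cW: "continuous_on S (W l)" for S l
    unfolding W_def by (intro continuous_on_compose2[OF c1] continuous_intros) auto
  define P where "P = {l \<in> {- \<Lambda>..0}. \<forall>r\<in>{0..1}. 0 < \<Phi> l r}"
  have "- \<Lambda> \<in> P"
  proof -
    have l: "- \<Lambda> \<in> {- \<Lambda>..0}" using \<Lambda> by simp
    have "0 < \<Phi> (- \<Lambda>) r" if r: "r \<in> {0..1}" for r
    proof (rule ccontr)
      assume "\<not> 0 < \<Phi> (- \<Lambda>) r"
      then have neg: "\<Phi> (- \<Lambda>) r \<le> 0" by simp
      obtain r0 where r0: "0 < r0" "r0 \<le> r" "\<Phi> (- \<Lambda>) r0 = 0" "\<And>r. 0 \<le> r \<Longrightarrow> r < r0 \<Longrightarrow> 0 < \<Phi> (- \<Lambda>) r"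
        by (rule first_zero[OF c1 _ _ neg]) (use \<Phi>0 r in auto)
      have "0 \<le> rpot n (\<lambda>t. 0 - g (- \<Lambda>) t) r0"
      proof (rule rpot_nonneg)
        fix t assume t: "0 \<le> t" "t \<le> r0"
        have "0 \<le> \<Phi> (- \<Lambda>) t" using r0(3) r0(4)[of t] t by (cases "t = r0") auto
        then show "0 \<le> 0 - g (- \<Lambda>) t" using pq[of t] by (simp add: g_def abs_le_iff mult_nonpos_nonneg)
      qed (use r0 in \<open>auto intro!: continuous_intros cg\<close>)
      moreover have "ravg n (\<lambda>t. 0 - g (- \<Lambda>) t) = (\<lambda>s. 0 - ravg n (g (- \<Lambda>)) s)"
        using ravg_diff[OF _ cg, of "\<lambda>_. 0"] by (simp add: ravg_def fun_eq_iff)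
      then have "rpot n (\<lambda>t. 0 - g (- \<Lambda>) t) r0 = - rpot n (g (- \<Lambda>)) r0"
        using ravg_diff[OF _ ravg_continuous[OF cg], of "\<lambda>_. 0"] by (simp add: ravg_def fun_eq_iff)
      ultimately have "1 \<le> \<Phi> (- \<Lambda>) r0" by (simp add: \<Phi>_eq[OF l])
      then show False using r0(3) by simp
    qed
    then show ?thesis using l by (auto simp: P_def)
  qed
  then have Pne: "P \<noteq> {}" by blast
  have bdd: "bdd_above P" by (rule bdd_aboveI[of _ 0]) (auto simp: P_def)
  define ls where "ls = Sup P"
  have ls: "ls \<in> {- \<Lambda>..0}"
    using cSup_upper[OF \<open>- \<Lambda> \<in> P\<close> bdd] cSup_least[OF Pne, of 0] by (auto simp: ls_def P_def)
  have ls_nonneg: "0 \<le> \<Phi> ls r" if r: "r \<in> {0..1}" for r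
  proof (rule ccontr)
    assume "\<not> ?thesis"
    then have neg: "\<Phi> ls r < 0" by simp
    have "isCont (\<lambda>l. \<Phi> l r) ls" using c2[of r] continuous_on_eq_continuous_at[OF open_UNIV] by blast
    then obtain d where d: "d > 0" "\<And>l. dist l ls < d \<Longrightarrow> dist (\<Phi> l r) (\<Phi> ls r) < - \<Phi> ls r"
      using neg unfolding continuous_at_eps_delta dist_real_def by (metis neg_0_less_iff_less)
    obtain l where l: "l \<in> P" "ls - d < l" using less_cSup_iff[OF Pne bdd, of "ls - d"] d(1) by (auto simp: ls_def)
    have "l \<le> ls" using cSup_upper[OF l(1) bdd] by (simp add: ls_def)
    then have "dist (\<Phi> l r) (\<Phi> ls r) < - \<Phi> ls r" using l(2) by (intro d) (simp add: dist_real_def)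
    moreover have "0 < \<Phi> l r" using l(1) r by (auto simp: P_def)
    ultimately show False using neg by (simp add: dist_real_def)
  qed
  have W_nonneg: "0 \<le> W ls x" if "norm x \<le> 1" for x using ls_nonneg that by (simp add: W_def)
  have L_le: "- ((p * V x + ls) * W ls x) \<le> \<bar>ls\<bar> * W ls x" if x: "norm x < 1" for x
  proof -
    have "0 \<le> p * V x" using V(1)[OF x] const by simp
    then have "- (p * V x + ls) \<le> \<bar>ls\<bar>" by linarith
    then have "- (p * V x + ls) * W ls x \<le> \<bar>ls\<bar> * W ls x" using W_nonneg[of x] x by (intro mult_right_mono) auto
    then show ?thesis by (simp only: mult_minus_left)
  qed
  obtain c0 where c0: "c0 > 0" "\<And>x. norm x \<le> 1 \<Longrightarrow> c0 * (1 - (norm x)\<^sup>2) \<le> W ls x"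
  proof -
    have "isCont (\<Phi> ls) 0" using c1 continuous_on_eq_continuous_at[OF open_UNIV] by blast
    then obtain d where d: "d > 0" "\<And>r. dist r 0 < d \<Longrightarrow> dist (\<Phi> ls r) (\<Phi> ls 0) < 1 / 2"
      unfolding continuous_at_eps_delta by (metis half_gt_zero_iff zero_less_one)
    define r where "r = min d 1 / 2"
    have r: "0 < r" "r < d" "r < 1" using d(1) by (auto simp: r_def min_def)
    have half: "1 / 2 \<le> W ls x" if "x \<in> cball 0 r" for x
    proof -
      have "dist (\<Phi> ls (norm x)) 1 < 1 / 2" using d(2)[of "norm x"] that r by (simp add: \<Phi>0)
      then show ?thesis by (simp add: W_def dist_real_def abs_if split: if_splits)
    qed
    let ?N = "real DIM('a)"
    \<comment> \<open>Any k >= 1 of this form satisfies k(k - N) = 4 |ls| k >= 4 |ls|, as the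
      barrier requires. Near the centre the solution is at least 1/2 by continuity.\<close>
    define k where "k = ?N + 4 * \<bar>ls\<bar>"
    have N: "1 \<le> ?N" using DIM_positive[where 'a='a] by linarith
    have "1 \<le> k" unfolding k_def using N by linarith
    then have "1 * (4 * \<bar>ls\<bar>) \<le> k * (4 * \<bar>ls\<bar>)" by (intro mult_right_mono) auto
    then have k: "4 * \<bar>ls\<bar> \<le> k * (k - ?N)" by (simp add: k_def)
    have "1 / 2 * (r / 2) powr k * (1 - (norm z)\<^sup>2) \<le> W ls z" if "norm z \<le> 1" for z
      by (rule hopf_lower_bound[OF hW[OF ls] cW W_nonneg L_le abs_ge_zero _ k r(1) _ _ half that, where ?x0.0=0])
        (use r in \<open>auto simp: k_def\<close>)
    then show ?thesis using that[of "1 / 2 * (r / 2) powr k"] r by simp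
  qed
  define t where "t = c0 / (s * K)"
  have t: "t > 0" using c0(1) const by (simp add: t_def)
  have tW: "t * u x \<le> W ls x" if x: "norm x < 1" for x
  proof -
    have "t * u x \<le> t * (s * K * (1 - (norm x)\<^sup>2))" using t u_upper[OF x] by (intro mult_left_mono) auto
    also have "\<dots> = c0 * (1 - (norm x)\<^sup>2)" using const by (simp add: t_def)
    finally show ?thesis using c0(2)[of x] x by simp
  qed
  have W_pos: "0 < W ls x" if "norm x < 1" for x using tW[OF that] t u_pos[OF that] by (meson less_le_trans mult_pos_pos)
  \<comment> \<open>For ls = 0 let m be the infimum of W/u. Then -\<Delta>(W - p m u) = p V (W - m
    u) >= 0, so W >= p m u and p m <= m, impossible for m > 0 and p > 1.\<close>
  have "ls \<noteq> 0"
  proof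
    assume ls0: "ls = 0"
    have tWb: "t * u x \<le> W ls x" if "x \<in> ball 0 1" for x using tW that by simp
    obtain m where m: "t \<le> m" "\<And>x. x \<in> ball 0 1 \<Longrightarrow> m * u x \<le> W ls x"
      "\<And>m'. (\<And>x. x \<in> ball 0 1 \<Longrightarrow> m' * u x \<le> W ls x) \<Longrightarrow> m' \<le> m"
      by (rule optimal_lower[of "ball 0 1" u t "W ls", OF _ _ tWb]) (use u_pos in auto)
    have "p * m \<le> m"
    proof (rule m(3))
      fix z :: 'a assume "z \<in> ball 0 1"
      then have z: "norm z \<le> 1" by simp
      have "0 \<le> W ls z - p * m * u z"
      proof (rule weak_maximum_principle_ball[OF _ _ _ _ z])
        show "haslap (ball 0 1) (\<lambda>x. W ls x - p * m * u x) (\<lambda>x. - (ravg n (g ls) (norm x) *\<^sub>R x) - (p * m) *\<^sub>R Gu x)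
            (\<lambda>x. - ((p * V x + ls) * W ls x) - p * m * - (V x * u x))"
          by (intro haslap_diff haslap_cmult hW[OF ls] u)
        show "continuous_on (cball 0 1) (\<lambda>x. W ls x - p * m * u x)" by (intro continuous_intros cW u)
        show "0 \<le> W ls x - p * m * u x" if "norm x = 1" for x using W_nonneg[of x] u0[OF that] that by simp
        fix x :: 'a assume x: "norm x < 1"
        have "- ((p * V x + ls) * W ls x) - p * m * - (V x * u x) = - (p * V x * (W ls x - m * u x))"
          unfolding ls0 by (simp add: algebra_simps)
        moreover have "0 \<le> p * V x * (W ls x - m * u x)"
          using const V(1)[OF x] m(2)[of x] x by (intro mult_nonneg_nonneg) auto
        ultimately show "- ((p * V x + ls) * W ls x) - p * m * - (V x * u x) \<le> 0" by linarith
      qed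
      then show "p * m * u z \<le> W ls z" by simp
    qed
    then show False using const m(1) t by (simp add: mult_le_cancel_right1)
  qed
  then have ls_neg: "ls < 0" using ls by simp
  \<comment> \<open>Otherwise the solution has a positive minimum on [0, 1], and uniform continuity
    in the parameter keeps it positive for some \<open>l\<close> strictly between \<open>ls\<close>
    and 0, or equal to 0.\<close>
  have bd: "\<Phi> ls 1 = 0"
  proof (rule ccontr)
    assume "\<Phi> ls 1 \<noteq> 0"
    then have one: "0 < \<Phi> ls 1" using ls_nonneg[of 1] by simp
    obtain e0 :: 'a where e0: "norm e0 = 1" using vector_choose_size[of 1] by auto
    have pos: "0 < \<Phi> ls r" if "r \<in> {0..1}" for r
      using W_pos[of "r *\<^sub>R e0"] one that e0 by (cases "r = 1") (auto simp: W_def)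
    obtain r1 where r1: "r1 \<in> {0..1}" "\<And>r. r \<in> {0..1} \<Longrightarrow> \<Phi> ls r1 \<le> \<Phi> ls r"
      using continuous_attains_inf[of "{0..1}" "\<Phi> ls"] continuous_on_subset[OF c1] by (metis atLeastAtMost_iff compact_Icc empty_iff order_refl subset_UNIV zero_le_one)
    define \<epsilon> where "\<epsilon> = \<Phi> ls r1"
    have \<epsilon>: "\<epsilon> > 0" using pos r1(1) by (simp add: \<epsilon>_def)
    have "uniformly_continuous_on ({- \<Lambda>..0} \<times> {0..1}) (\<lambda>p. \<Phi> (fst p) (snd p))"
      by (intro compact_uniformly_continuous continuous_on_subset[OF c\<Phi>] compact_Times) auto
    then obtain d where d: "d > 0" "\<And>z z'. z \<in> {- \<Lambda>..0} \<times> {0..1} \<Longrightarrow> z' \<in> {- \<Lambda>..0} \<times> {0..1} \<Longrightarrow>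
        dist z' z < d \<Longrightarrow> dist (\<Phi> (fst z') (snd z')) (\<Phi> (fst z) (snd z)) < \<epsilon>"
      using \<epsilon> unfolding uniformly_continuous_on_def by metis
    define l where "l = ls + min (d / 2) (- ls)"
    have l: "ls < l" "l \<in> {- \<Lambda>..0}" "\<bar>l - ls\<bar> < d" using d(1) ls ls_neg by (auto simp: l_def min_def)
    have "0 < \<Phi> l r" if r: "r \<in> {0..1}" for r
    proof -
      have "dist (\<Phi> l r) (\<Phi> ls r) < \<epsilon>"
        using d(2)[of "(ls, r)" "(l, r)"] l ls r by (simp add: dist_Pair_Pair dist_real_def)
      moreover have "\<epsilon> \<le> \<Phi> ls r" using r1(2)[OF r] by (simp add: \<epsilon>_def)
      ultimately show ?thesis by (simp add: dist_real_def abs_if split: if_splits)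
    qed
    then have "l \<in> P" using l by (simp add: P_def)
    then show False using cSup_upper[OF _ bdd, of l] l(1) by (simp add: ls_def)
  qed
  define w where "w x = (if norm x < 1 then W ls x else 0)" for x
  have w_eq: "w = (\<lambda>x. if norm x < 1 then 1 - rpot n (g ls) (norm x) else 0)"
    by (rule ext) (simp add: w_def W_def fun_cong[OF \<Phi>_eq[OF ls]])
  have bd': "1 - rpot n (g ls) 1 = 0" using bd \<Phi>_eq[OF ls] by simp
  have w: "w \<in> dirichlet_class" "\<And>x. norm x < 1 \<Longrightarrow> laplacian w x = - g ls (norm x)"
    using radial_dirichlet_class[OF cg[of ls], where a=1 and 'a='a] bd' unfolding w_eq n_def by blast+
  have "eigenfunction ls w"
    unfolding eigenfunction_def
  proof (intro conjI exI)
    show "continuous_on (cball 0 1) w" using w(1) by (simp add: dirichlet_class_def)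
    show "\<forall>x. norm x = 1 \<longrightarrow> w x = 0" by (simp add: w_def)
    show "haslap (ball 0 1) w (\<lambda>x. \<Sum>b\<in>Basis. partial b w x *\<^sub>R b) (\<lambda>x. - ((p * V x + ls) * w x))"
      by (rule haslap_cong_lap[OF dirichlet_class_haslap[OF w(1)]]) (simp add: w(2) g_def q(3) w_def W_def)
  qed
  moreover have "t * u x \<le> w x" if "norm x < 1" for x using tW[OF that] that by (simp add: w_def)
  ultimately show ?thesis using ls_neg w(1) t by blast
qed

section \<open>Uniqueness and the Morse index\<close>

text \<open>Dividing by the maximum s gives a profile with \<mu> = s^(p-1), to which the a priori
  bound applies; undoing the normalisation leaves s as an unbounded scale. The upper bound is the
  Poisson bound, since the right-hand side of the normalised equation is at most \<mu>.\<close>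

lemma henon_solution_bounds:
  fixes \<alpha> :: real
  assumes \<alpha>: "\<alpha> > 0"
  obtains K c where "K \<ge> 1" "c > 0"
    "\<And>p (u::'a::euclidean_space \<Rightarrow> real). 1 < p \<Longrightarrow> p \<le> 1 + 1 / (2 * real DIM('a)) \<Longrightarrow> henon_solution \<alpha> p u \<Longrightarrow>
      \<exists>s>0. s powr (p - 1) \<le> K \<and> (\<forall>x. norm x < 1 \<longrightarrow>
        s * c * (1 - (norm x)\<^sup>2) \<le> u x \<and> u x \<le> s * K * (1 - (norm x)\<^sup>2) \<and> u x \<le> s)"
proof -
  obtain K c where K: "K \<ge> 1" and c: "c > 0" and ap:
    "\<And>(w::'a \<Rightarrow> real) G L \<mu> p x0. haslap (ball 0 1) w G L \<Longrightarrow> continuous_on (cball 0 1) w \<Longrightarrow>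
       (\<And>x. norm x \<le> 1 \<Longrightarrow> 0 \<le> w x) \<Longrightarrow> (\<And>x. norm x < 1 \<Longrightarrow> w x \<le> 1) \<Longrightarrow>
       (\<And>x. norm x < 1 \<Longrightarrow> L x = - (\<mu> * norm x powr \<alpha> * w x powr p)) \<Longrightarrow>
       1 < p \<Longrightarrow> p \<le> 1 + 1 / (2 * real DIM('a)) \<Longrightarrow> 1 \<le> \<mu> \<Longrightarrow> 1 / \<mu> \<le> 1 - norm x0 \<Longrightarrow> w x0 = 1 \<Longrightarrow>
       \<mu> \<le> K \<and> (\<forall>z. norm z \<le> 1 \<longrightarrow> c * (1 - (norm z)\<^sup>2) \<le> w z)"
  proof (rule apriori_bound[OF \<alpha>, where 'a='a], goal_cases)
    case (1 K c) show ?case by (rule 1(1)[OF 1(2,3)]) (fact 1(4))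
  qed
  have N: "real DIM('a) \<ge> 1" using DIM_positive[where 'a='a] by linarith
  show ?thesis
  proof (rule that[OF K c])
    fix p :: real and u :: "'a \<Rightarrow> real"
    assume p: "1 < p" "p \<le> 1 + 1 / (2 * real DIM('a))" and "henon_solution \<alpha> p u"
    then have u: "u \<in> dirichlet_class" "\<And>x. norm x < 1 \<Longrightarrow> 0 < u x"
      "\<And>x. norm x < 1 \<Longrightarrow> laplacian u x = - (norm x powr \<alpha> * u x powr p)"
      unfolding henon_solution_def by (auto simp: eq_neg_iff_add_eq_0 add.commute dest: bspec)
    have cu: "continuous_on (cball 0 1) u" and u0: "\<And>x. \<not> norm x < 1 \<Longrightarrow> u x = 0"
      using u(1) by (auto simp: dirichlet_class_def)
    obtain x0 where x0: "x0 \<in> cball 0 1" "\<And>x. x \<in> cball 0 1 \<Longrightarrow> u x \<le> u x0"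
      using continuous_attains_sup[OF compact_cball _ cu] by auto
    define s where "s = u x0"
    have s: "s > 0" using u(2)[of 0] x0(2)[of 0] by (simp add: s_def)
    have x0B: "norm x0 < 1" using u0[of x0] s by (auto simp: s_def)
    have us: "u x \<le> s" if "norm x < 1" for x using x0(2)[of x] that by (simp add: s_def)
    define \<mu> where "\<mu> = s powr (p - 1)"
    define w where "w x = (1 / s) * u x" for x
    let ?L = "\<lambda>x. - (\<mu> * norm x powr \<alpha> * w x powr p)"
    have hw: "haslap (ball 0 1) w (\<lambda>x. (1 / s) *\<^sub>R (\<Sum>b\<in>Basis. partial b u x *\<^sub>R b)) ?L"
    proof (rule haslap_cong_lap)
      show "haslap (ball 0 1) w (\<lambda>x. (1 / s) *\<^sub>R (\<Sum>b\<in>Basis. partial b u x *\<^sub>R b)) (\<lambda>x. (1 / s) * laplacian u x)"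
        unfolding w_def by (rule haslap_cmult[OF dirichlet_class_haslap[OF u(1)]])
      fix x :: 'a assume "x \<in> ball 0 1"
      then have x: "norm x < 1" by simp
      have "\<mu> * w x powr p = s powr (p - 1) * (u x powr p / s powr p)"
        using s u(2)[OF x] by (simp add: \<mu>_def w_def powr_divide)
      also have "\<dots> = (1 / s) * u x powr p" using s by (simp add: powr_diff)
      finally have e: "\<mu> * w x powr p = (1 / s) * u x powr p" .
      have "?L x = - (norm x powr \<alpha> * (\<mu> * w x powr p))" by (simp only: mult_ac)
      then show "?L x = (1 / s) * laplacian u x" unfolding u(3)[OF x] e by (simp only: mult_ac mult_minus_right)
    qed
    have cw: "continuous_on (cball 0 1) w" unfolding w_def by (intro continuous_intros cu)
    have w0: "0 \<le> w x" for x using u(2)[of x] u0[of x] s by (cases "norm x < 1") (auto simp: w_def)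
    have w1: "w x \<le> 1" if "norm x < 1" for x using us[OF that] s by (simp add: w_def)
    have mu0: "\<mu> > 0" using s by (simp add: \<mu>_def)
    have wup: "w x \<le> \<mu> / (2 * DIM('a)) * (1 - (norm x)\<^sup>2)" if "norm x \<le> 1" for x
    proof (rule poisson_upper_bound[OF hw cw _ _ that])
      show "w y \<le> 0" if "norm y = 1" for y using u0[of y] that by (simp add: w_def)
      show "- \<mu> \<le> ?L y" if y: "norm y < 1" for y
      proof -
        have "norm y powr \<alpha> * w y powr p \<le> 1 * 1"
          using y w0[of y] w1[OF y] p \<alpha> by (intro mult_mono powr_le1) auto
        then have "\<mu> * (norm y powr \<alpha> * w y powr p) \<le> \<mu> * 1" using mu0 by (intro mult_left_mono) auto
        then show ?thesis by (simp add: mult.assoc)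
      qed
    qed
    have wx0: "w x0 = 1" using s by (simp add: w_def s_def)
    \<comment> \<open>Evaluating the Poisson bound at the maximum point shows that this point is at
      distance at least 1/\<mu> from the sphere, which the a priori bound requires; it also gives
      \<mu> >= 1.\<close>
    have "1 \<le> \<mu> / (2 * DIM('a)) * (1 - (norm x0)\<^sup>2)" using wup[of x0] x0B wx0 by simp
    also have "\<dots> \<le> \<mu> / (2 * 1) * (1 - (norm x0)\<^sup>2)"
      using N mu0 one_minus_sq_pos[OF x0B] by (intro mult_right_mono divide_left_mono mult_left_mono) auto
    also have "\<dots> \<le> \<mu> * (1 - norm x0)"
    proof -
      have "1 - (norm x0)\<^sup>2 = (1 - norm x0) * (1 + norm x0)" by (simp add: power2_eq_square algebra_simps)
      also have "\<dots> \<le> (1 - norm x0) * 2" using x0B by (intro mult_left_mono) auto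
      finally have "\<mu> * (1 - (norm x0)\<^sup>2) \<le> \<mu> * ((1 - norm x0) * 2)" using mu0 by (intro mult_left_mono) auto
      then show ?thesis by (simp add: algebra_simps)
    qed
    finally have m1: "1 \<le> \<mu> * (1 - norm x0)" .
    then have m2: "1 / \<mu> \<le> 1 - norm x0" using mu0 by (simp add: field_simps)
    have "\<mu> * (1 - norm x0) \<le> \<mu> * 1" using mu0 by (intro mult_left_mono) auto
    then have m3: "1 \<le> \<mu>" using m1 by simp
    have res: "\<mu> \<le> K \<and> (\<forall>z. norm z \<le> 1 \<longrightarrow> c * (1 - (norm z)\<^sup>2) \<le> w z)"
      by (rule ap[OF hw cw w0 w1 refl p m3 m2 wx0])
    show "\<exists>s>0. s powr (p - 1) \<le> K \<and> (\<forall>x. norm x < 1 \<longrightarrow>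
        s * c * (1 - (norm x)\<^sup>2) \<le> u x \<and> u x \<le> s * K * (1 - (norm x)\<^sup>2) \<and> u x \<le> s)"
    proof (intro exI[of _ s] conjI allI impI)
      show "0 < s" by fact
      show "s powr (p - 1) \<le> K" using res by (simp add: \<mu>_def)
      fix x :: 'a assume x: "norm x < 1"
      have uw: "u x = s * w x" using s by (simp add: w_def)
      show "u x \<le> s" by (rule us[OF x])
      have "s * (c * (1 - (norm x)\<^sup>2)) \<le> s * w x" using res x s by (intro mult_left_mono) auto
      then show "s * c * (1 - (norm x)\<^sup>2) \<le> u x" by (simp add: uw mult.assoc)
      have "1 \<le> real (2 * DIM('a))" using N unfolding of_nat_mult by linarith
      then have "\<mu> / (2 * DIM('a)) \<le> K / 1" using res K by (intro frac_le) auto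
      then have "\<mu> / (2 * DIM('a)) * (1 - (norm x)\<^sup>2) \<le> K * (1 - (norm x)\<^sup>2)"
        using one_minus_sq_pos[OF x] by (intro mult_right_mono) auto
      then have "w x \<le> K * (1 - (norm x)\<^sup>2)" using wup[of x] x by simp
      then have "s * w x \<le> s * (K * (1 - (norm x)\<^sup>2))" using s by (intro mult_left_mono) auto
      then show "u x \<le> s * K * (1 - (norm x)\<^sup>2)" by (simp add: uw mult.assoc)
    qed
  qed
qed

text \<open>With \<open>m\<close> and \<open>M\<close> the extrema of \<open>u / v\<close>, the maximum principle gives \<open>m \<le> 1 \<le> M\<close>, and the
  oscillation estimate bounds \<open>M - m\<close> by a multiple of \<open>(m - m\<^sup>p) + (M\<^sup>p - M) = O((p - 1)(M - m))\<close>.\<close>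

lemma henon_unique:
  fixes u v :: "'a::euclidean_space \<Rightarrow> real" and p \<alpha> K c su sv :: real
  assumes p: "1 < p" "p \<le> 2" and \<alpha>: "\<alpha> > 0" and K: "K \<ge> 1" and c: "c > 0"
    and u: "haslap (ball 0 1) u Gu (\<lambda>x. - (norm x powr \<alpha> * u x powr p))" "continuous_on (cball 0 1) u"
      "\<And>x. norm x = 1 \<Longrightarrow> u x = 0"
    and v: "haslap (ball 0 1) v Gv (\<lambda>x. - (norm x powr \<alpha> * v x powr p))" "continuous_on (cball 0 1) v"
      "\<And>x. norm x = 1 \<Longrightarrow> v x = 0"
    and su: "su > 0" "\<And>x. norm x < 1 \<Longrightarrow> su * c * (1 - (norm x)\<^sup>2) \<le> u x" "\<And>x. norm x < 1 \<Longrightarrow> u x \<le> su * K * (1 - (norm x)\<^sup>2)"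
    and sv: "sv > 0" "sv powr (p - 1) \<le> K" "\<And>x. norm x < 1 \<Longrightarrow> sv * c * (1 - (norm x)\<^sup>2) \<le> v x"
      "\<And>x. norm x < 1 \<Longrightarrow> v x \<le> sv * K * (1 - (norm x)\<^sup>2)" "\<And>x. norm x < 1 \<Longrightarrow> v x \<le> sv"
    and small: "(p - 1) * ((1 + (K\<^sup>2 / c\<^sup>2)\<^sup>2) * K) < hopf_const TYPE('a) * (c * bavg 0 (1 / 5) (\<lambda>x::'a. 1 - (norm x)\<^sup>2))"
    and x: "norm x < 1"
  shows "u x = v x"
proof -
  have cK: "c > 0" "K > 0" using c K by auto
  have d: "0 < 1 - (norm x)\<^sup>2" if "norm x < 1" for x :: 'a by (rule one_minus_sq_pos[OF that])
  have upos: "0 < u x" if "norm x < 1" for x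
    using su(1) su(2)[OF that] d[OF that] c by (meson less_le_trans mult_pos_pos)
  have vpos: "0 < v x" if "norm x < 1" for x
    using sv(1) sv(3)[OF that] d[OF that] c by (meson less_le_trans mult_pos_pos)
  \<comment> \<open>The two profile bounds, by the same function 1 - |x|^2, confine u/v between
    \<open>a\<close> and \<open>b\<close>, so its extrema exist and are positive.\<close>
  define a where "a = su * c / (sv * K)"
  define b where "b = su * K / (sv * c)"
  have a: "a > 0" using su(1) sv(1) cK by (simp add: a_def)
  have low: "a * v x \<le> u x" if "x \<in> ball 0 1" for x
  proof -
    have x: "norm x < 1" using that by simp
    have "a * v x \<le> a * (sv * K * (1 - (norm x)\<^sup>2))" using a sv(4)[OF x] by (intro mult_left_mono) auto
    also have "\<dots> = su * c * (1 - (norm x)\<^sup>2)" using sv(1) cK by (simp add: a_def)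
    finally show ?thesis using su(2)[OF x] by simp
  qed
  have upp: "u x \<le> b * v x" if "x \<in> ball 0 1" for x
  proof -
    have x: "norm x < 1" using that by simp
    have "su * K * (1 - (norm x)\<^sup>2) = b * (sv * c * (1 - (norm x)\<^sup>2))" using sv(1) cK by (simp add: b_def)
    also have "\<dots> \<le> b * v x" using su(1) sv cK sv(3)[OF x] by (intro mult_left_mono) (auto simp: b_def)
    finally show ?thesis using su(3)[OF x] by simp
  qed
  obtain m where m: "a \<le> m" "\<And>x. x \<in> ball 0 1 \<Longrightarrow> m * v x \<le> u x"
    "\<And>m'. (\<And>x. x \<in> ball 0 1 \<Longrightarrow> m' * v x \<le> u x) \<Longrightarrow> m' \<le> m"
    by (rule optimal_lower[of "ball 0 1" v a u, OF _ _ low]) (use vpos in auto)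
  obtain M where M: "M \<le> b" "\<And>x. x \<in> ball 0 1 \<Longrightarrow> u x \<le> M * v x"
    "\<And>M'. (\<And>x. x \<in> ball 0 1 \<Longrightarrow> u x \<le> M' * v x) \<Longrightarrow> M \<le> M'"
    by (rule optimal_upper[of "ball 0 1" v u b, OF _ _ upp]) (use vpos in auto)
  have mpos: "m > 0" using a m(1) by simp
  have mM: "m \<le> M"
  proof -
    have "m * v 0 \<le> M * v 0" using m(2)[of 0] M(2)[of 0] by simp
    then show ?thesis using vpos[of 0] by simp
  qed
  have Mpos: "M > 0" using mpos mM by simp
  have pw: "(r * v x) powr p = r powr p * v x powr p" if "0 < r" "norm x < 1" for r x
    using that vpos[of x] by (simp add: powr_mult)
  have up: "m powr p * v x powr p \<le> u x powr p" "u x powr p \<le> M powr p * v x powr p" if x: "norm x < 1" for x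
    using powr_mono2[of p "m * v x" "u x"] powr_mono2[of p "u x" "M * v x"]
      m(2)[of x] M(2)[of x] x mpos Mpos vpos[OF x] upos[OF x] p pw[OF mpos x] pw[OF Mpos x] by auto
  \<comment> \<open>From u >= m v follows u^p >= m^p v^p, and the maximum principle turns this into
    u >= m^p v. Optimality of m yields the claim, and p > 1 forces m <= 1; the argument for M is
    symmetric.\<close>
  have "m powr p \<le> m"
  proof (rule m(3))
    fix z :: 'a assume "z \<in> ball 0 1"
    then have z: "norm z \<le> 1" by simp
    have "0 \<le> u z - m powr p * v z"
    proof (rule weak_maximum_principle_ball[OF _ _ _ _ z])
      show "haslap (ball 0 1) (\<lambda>x. u x - m powr p * v x) (\<lambda>x. Gu x - m powr p *\<^sub>R Gv x)
          (\<lambda>x. - (norm x powr \<alpha> * u x powr p) - m powr p * - (norm x powr \<alpha> * v x powr p))"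
        by (intro haslap_diff haslap_cmult u v)
      show "continuous_on (cball 0 1) (\<lambda>x. u x - m powr p * v x)" by (intro continuous_intros u v)
      fix x :: 'a assume x: "norm x < 1"
      have "norm x powr \<alpha> * (m powr p * v x powr p) \<le> norm x powr \<alpha> * u x powr p"
        using up[OF x] by (intro mult_left_mono) auto
      then show "- (norm x powr \<alpha> * u x powr p) - m powr p * - (norm x powr \<alpha> * v x powr p) \<le> 0"
        by (simp add: mult_ac)
    qed (simp add: u(3) v(3))
    then show "m powr p * v z \<le> u z" by simp
  qed
  then have m1: "m \<le> 1"
  proof (rule contrapos_pp)
    assume "\<not> m \<le> 1"
    then have "m powr 1 < m powr p" using p by (intro powr_less_mono) auto
    then show "\<not> m powr p \<le> m" using mpos by simp
  qed
  have "M \<le> M powr p"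
  proof (rule M(3))
    fix z :: 'a assume "z \<in> ball 0 1"
    then have z: "norm z \<le> 1" by simp
    have "0 \<le> M powr p * v z - u z"
    proof (rule weak_maximum_principle_ball[OF _ _ _ _ z])
      show "haslap (ball 0 1) (\<lambda>x. M powr p * v x - u x) (\<lambda>x. M powr p *\<^sub>R Gv x - Gu x)
          (\<lambda>x. M powr p * - (norm x powr \<alpha> * v x powr p) - - (norm x powr \<alpha> * u x powr p))"
        by (intro haslap_diff haslap_cmult u v)
      show "continuous_on (cball 0 1) (\<lambda>x. M powr p * v x - u x)" by (intro continuous_intros u v)
      fix x :: 'a assume x: "norm x < 1"
      have "norm x powr \<alpha> * u x powr p \<le> norm x powr \<alpha> * (M powr p * v x powr p)"
        using up[OF x] by (intro mult_left_mono) auto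
      then show "M powr p * - (norm x powr \<alpha> * v x powr p) - - (norm x powr \<alpha> * u x powr p) \<le> 0"
        by (simp add: mult_ac)
    qed (simp add: u(3) v(3))
    then show "u z \<le> M powr p * v z" by simp
  qed
  then have M1: "1 \<le> M"
  proof (rule contrapos_pp)
    assume "\<not> 1 \<le> M"
    then have "M powr p < M powr 1" using p Mpos by (intro powr_less_mono') auto
    then show "\<not> M \<le> M powr p" using Mpos by simp
  qed
  \<comment> \<open>From a <= m <= 1 follows su/sv <= K/c, so b <= K^2/c^2. The scales of two
    solutions are thus comparable with a constant that does not involve p.\<close>
  define Q where "Q = K\<^sup>2 / c\<^sup>2"
  have MQ: "M \<le> Q"
  proof -
    have "a \<le> 1" using m(1) m1 by simp
    then have "su * c \<le> sv * K" using sv(1) cK by (simp add: a_def)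
    then have "su / sv \<le> K / c" using sv(1) cK by (simp add: field_simps)
    then have "su / sv * (K / c) \<le> K / c * (K / c)" using cK by (intro mult_right_mono) auto
    then have "b \<le> Q" by (simp add: b_def Q_def power2_eq_square)
    then show ?thesis using M(1) by simp
  qed
  have D1: "m - m powr p \<le> (p - 1) * (1 - m)"
    using powr_bernoulli[of m p] mpos p by (simp add: algebra_simps)
  have D2: "M powr p - M \<le> (p - 1) * (Q\<^sup>2 * (M - 1))"
  proof -
    have "ln M \<le> M - 1" using ln_le_minus_one[of M] Mpos by simp
    have "M powr p - M = M powr p * (1 - M powr (1 - p))"
      using Mpos by (simp add: right_diff_distrib flip: powr_add)
    also have "\<dots> \<le> M powr p * ((p - 1) * (M - 1))"
    proof (rule mult_left_mono)
      have "1 - M powr (1 - p) \<le> (p - 1) * ln M"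
        using exp_ge_add_one_self[of "(1 - p) * ln M"] Mpos by (simp add: powr_def algebra_simps)
      also have "\<dots> \<le> (p - 1) * (M - 1)" using \<open>ln M \<le> M - 1\<close> p by (intro mult_left_mono) auto
      finally show "1 - M powr (1 - p) \<le> (p - 1) * (M - 1)" .
    qed simp
    also have "\<dots> \<le> Q\<^sup>2 * ((p - 1) * (M - 1))"
    proof (rule mult_right_mono)
      have "M powr p \<le> M powr 2" using M1 p by (intro powr_mono) auto
      also have "\<dots> = M\<^sup>2" using Mpos by simp
      also have "\<dots> \<le> Q\<^sup>2" using MQ Mpos by (intro power_mono) auto
      finally show "M powr p \<le> Q\<^sup>2" .
    qed (use p M1 in auto)
    finally show ?thesis by (simp add: mult_ac)
  qed
  \<comment> \<open>One constant bounds both one-sided errors. The bounds 1 - m <= M - m and M - 1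
    <= M - m, valid because m <= 1 <= M, make it proportional to the oscillation.\<close>
  define D where "D = (m - m powr p) + (M powr p - M)"
  have D: "D \<le> (p - 1) * ((1 + Q\<^sup>2) * (M - m))"
  proof -
    have "(1 - m) + Q\<^sup>2 * (M - 1) \<le> (M - m) + Q\<^sup>2 * (M - m)"
      using m1 M1 by (intro add_mono mult_left_mono) auto
    then have "(p - 1) * ((1 - m) + Q\<^sup>2 * (M - 1)) \<le> (p - 1) * ((1 + Q\<^sup>2) * (M - m))"
      using p by (intro mult_left_mono) (auto simp: algebra_simps)
    then show ?thesis using D1 D2 unfolding D_def by (simp add: distrib_left)
  qed
  have d0: "0 \<le> m - m powr p" "0 \<le> M powr p - M" using \<open>m powr p \<le> m\<close> \<open>M \<le> M powr p\<close> by auto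
  let ?N = "real DIM('a)"
  let ?k = "D * sv powr p / (2 * ?N)"
  have k2: "2 * ?N * ?k = D * sv powr p" by simp
  have rhs: "norm x powr \<alpha> * v x powr p \<le> sv powr p" if x: "norm x < 1" for x
  proof -
    have "norm x powr \<alpha> * v x powr p \<le> 1 * sv powr p"
      using x \<alpha> p vpos[OF x] sv(5)[OF x] by (intro mult_mono powr_le1 powr_mono2) auto
    then show ?thesis by simp
  qed
  have "hopf_const TYPE('a) * (M - m) * bavg 0 (1 / 5) v \<le> 2 * ?k"
  proof (rule oscillation_estimate[OF u(1) v(1) u(2) v(2)])
    show "m * v x \<le> u x" "u x \<le> M * v x" if "norm x \<le> 1" for x
      using m(2)[of x] M(2)[of x] u(3)[of x] v(3)[of x] that by (cases "norm x = 1"; auto)+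
    show "0 < sv * K" using sv(1) cK by simp
    show "v x \<le> sv * K * (1 - (norm x)\<^sup>2)" if "norm x < 1" for x by (rule sv(4)[OF that])
    show "m' \<le> m" if "\<And>x. norm x < 1 \<Longrightarrow> m' * v x \<le> u x" for m' using m(3) that by simp
    show "M \<le> M'" if "\<And>x. norm x < 1 \<Longrightarrow> u x \<le> M' * v x" for M' using M(3) that by simp
    show "0 \<le> ?k" using d0 by (simp add: D_def)
    fix x :: 'a assume x: "norm x < 1"
    let ?V = "norm x powr \<alpha> * v x powr p"
    have V0: "0 \<le> ?V" by simp
    have a1: "m powr p * ?V \<le> norm x powr \<alpha> * u x powr p"
      using mult_left_mono[OF up(1)[OF x], of "norm x powr \<alpha>"] by (simp add: mult_ac)
    have a2: "norm x powr \<alpha> * u x powr p \<le> M powr p * ?V"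
      using mult_left_mono[OF up(2)[OF x], of "norm x powr \<alpha>"] by (simp add: mult_ac)
    have b1: "(m - m powr p) * ?V \<le> D * sv powr p"
      using d0 rhs[OF x] by (intro mult_mono) (auto simp: D_def)
    have b2: "(M powr p - M) * ?V \<le> D * sv powr p"
      using d0 rhs[OF x] by (intro mult_mono) (auto simp: D_def)
    show "- (norm x powr \<alpha> * u x powr p) - m * - ?V \<le> 2 * ?N * ?k"
      unfolding k2 using a1 b1 by (simp add: left_diff_distrib)
    show "M * - ?V - - (norm x powr \<alpha> * u x powr p) \<le> 2 * ?N * ?k"
      unfolding k2 using a2 b2 by (simp add: left_diff_distrib)
  qed
  also have "2 * ?k = D * sv powr p / ?N" by simp
  also have "\<dots> \<le> D * sv powr p / 1"
    using d0 DIM_positive[where 'a='a] by (intro divide_left_mono) (auto simp: D_def)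
  also have "\<dots> \<le> D * (sv * K)"
  proof -
    have "sv powr p = sv * sv powr (p - 1)" using sv(1) powr_add[of sv 1 "p - 1"] by simp
    also have "\<dots> \<le> sv * K" using sv by (intro mult_left_mono) auto
    finally show ?thesis using d0 by (simp add: D_def mult_left_mono)
  qed
  finally have 1: "hopf_const TYPE('a) * (M - m) * bavg 0 (1 / 5) v \<le> D * (sv * K)" .
  let ?B = "bavg 0 (1 / 5) (\<lambda>x::'a. 1 - (norm x)\<^sup>2)"
  have "bavg 0 (1 / 5) (\<lambda>x::'a. sv * c * (1 - (norm x)\<^sup>2)) \<le> bavg 0 (1 / 5) v"
    by (rule bavg_mono[of "ball 0 1"])
      (use haslap_continuous_on[OF v(1)] sv(3) in \<open>auto intro!: continuous_intros simp: subset_iff\<close>)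
  then have "sv * c * ?B \<le> bavg 0 (1 / 5) v" by (simp only: bavg_cmult)
  then have "hopf_const TYPE('a) * (M - m) * (sv * c * ?B) \<le> hopf_const TYPE('a) * (M - m) * bavg 0 (1 / 5) v"
    using mM hopf_const_pos[where 'a='a] by (intro mult_left_mono mult_nonneg_nonneg) auto
  also have "\<dots> \<le> D * (sv * K)" by (rule 1)
  also have "\<dots> \<le> ((p - 1) * ((1 + Q\<^sup>2) * (M - m))) * (sv * K)"
    using D sv(1) cK by (intro mult_right_mono) auto
  finally have "((M - m) * sv) * (hopf_const TYPE('a) * (c * ?B)) \<le> ((M - m) * sv) * ((p - 1) * ((1 + Q\<^sup>2) * K))"
    by (simp add: mult_ac)
  then have "(M - m) * sv \<le> 0"
    using mult_strict_left_mono[OF small[folded Q_def], of "(M - m) * sv"] by linarith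
  then have "M = m" using mM sv(1) by (simp add: mult_le_0_iff)
  then have "m = 1" "M = 1" using m1 M1 by auto
  then show ?thesis using m(2)[of x] M(2)[of x] x by simp
qed

text \<open>A nontrivial eigenfunction with lam <= 0 has a constant sign by the dichotomy, and
  comparison in both directions with the ground state gives lam = ls. Since ls < 0, this excludes
  lam = 0; since every eigenfunction for \<open>ls\<close> is a multiple of \<open>w\<close>, the
  multiplicity is 1. Nondegeneracy and the Morse index therefore come from the same
  argument.\<close>

lemma (in ground_profile) spectrum_of_linearisation:
  assumes es: "\<And>lam v. v \<in> eigenspace \<alpha> p u lam \<Longrightarrow> eigenfunction lam v"
    and es': "\<And>lam v. v \<in> dirichlet_class \<Longrightarrow> eigenfunction lam v \<Longrightarrow> v \<in> eigenspace \<alpha> p u lam"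
    and q: "continuous_on UNIV q" "\<And>t. \<bar>q t\<bar> \<le> K" "\<And>x. norm x < 1 \<Longrightarrow> V x = q (norm x)"
  shows "v \<in> eigenspace \<alpha> p u 0 \<Longrightarrow> v x = 0" "morse_index \<alpha> p u = 1"
proof -
  obtain ls w t where ls: "ls < 0" and w: "eigenfunction ls w" "w \<in> dirichlet_class"
    and t: "t > 0" "\<And>x. norm x < 1 \<Longrightarrow> t * u x \<le> w x"
    using ground_state_exists[OF q] by blast
  have outside: "v x = 0" if "v \<in> eigenspace \<alpha> p u lam" "\<not> norm x < 1" for v lam x
    using that by (auto simp: eigenspace_def dirichlet_class_def)
  have w0: "w 0 > 0" using t u_pos[of 0] mult_pos_pos[of t "u 0"] by (metis less_le_trans norm_zero zero_less_one)
  have lam_ge: "- ((p - 1) * K) \<le> lam" if "v \<in> eigenspace \<alpha> p u lam" "v x \<noteq> 0" for lam v x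
    using no_very_negative_eigenvalue[OF es[OF that(1)], of x] outside[OF that(1), of x] that(2) by fastforce
  have nontrivial: "lam = ls" if v: "v \<in> eigenspace \<alpha> p u lam" "v x \<noteq> 0" and lam: "lam \<le> 0" for lam v x
  proof (rule eigenfunction_dichotomy[OF es[OF v(1)] lam_ge[OF v] lam])
    assume "\<And>x. norm x < 1 \<Longrightarrow> v x = 0"
    then show ?thesis using v outside by blast
  next
    fix r assume r: "0 < r" "\<And>x. norm x < 1 \<Longrightarrow> r * u x \<le> v x"
    show ?thesis
      using positive_eigenfunction_comparison[OF es[OF v(1)] r w(1) t]
        positive_eigenfunction_comparison[OF w(1) t es[OF v(1)] r] by simp
  next
    fix r assume r: "0 < r" "\<And>x. norm x < 1 \<Longrightarrow> r * u x \<le> - v x"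
    note v' = eigenfunction_uminus[OF es[OF v(1)]]
    show ?thesis
      using positive_eigenfunction_comparison[OF v' r w(1) t]
        positive_eigenfunction_comparison[OF w(1) t v' r] by simp
  qed
  show "v x = 0" if "v \<in> eigenspace \<alpha> p u 0" using nontrivial[OF that, of x] ls by auto
  have wE: "w \<in> eigenspace \<alpha> p u ls" by (rule es'[OF w(2,1)])
  have neg: "negative_eigenvalues \<alpha> p u = {ls}"
  proof (intro equalityI subsetI)
    fix lam assume "lam \<in> negative_eigenvalues \<alpha> p u"
    then obtain v x where "lam < 0" "v \<in> eigenspace \<alpha> p u lam" "v x \<noteq> 0"
      by (auto simp: negative_eigenvalues_def)
    then show "lam \<in> {ls}" using nontrivial[of v lam x] by simp
  next
    fix lam assume "lam \<in> {ls}"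
    moreover have "\<exists>x. w x \<noteq> 0" using w0 by (intro exI[of _ 0]) simp
    ultimately show "lam \<in> negative_eigenvalues \<alpha> p u"
      using ls wE by (auto simp: negative_eigenvalues_def)
  qed
  have span: "eigenspace \<alpha> p u ls \<subseteq> fun_space.span {w}"
  proof
    fix v assume v: "v \<in> eigenspace \<alpha> p u ls"
    have lge: "- ((p - 1) * K) \<le> ls" by (rule lam_ge[OF wE, of 0]) (use w0 in simp)
    obtain r where r: "\<And>x. norm x < 1 \<Longrightarrow> v x = r * w x"
      by (rule eigenfunction_multiple[OF es[OF v] w(1) t lge]) (use ls in auto)
    have "v = (\<lambda>x. r * w x)" using r outside[OF v] outside[OF wE] by (metis mult_zero_right)
    then show "v \<in> fun_space.span {w}" using fun_space.span_scale[OF fun_space.span_base[of w "{w}"]] by simp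
  qed
  have "fun_space.independent {w}"
    using w0 by (intro fun_space.independent_insertI) (auto simp: fun_eq_iff fun_space.independent_empty intro!: exI[of _ 0])
  then have "fun_space.dim (eigenspace \<alpha> p u ls) = 1"
    using wE span by (intro fun_space.dim_unique[of "{w}"]) auto
  then show "morse_index \<alpha> p u = 1"
    unfolding morse_index_def neg using span by (auto simp: one_enat_def intro!: exI[of _ "{w}"])
qed

theorem theorem3p1:
  fixes \<alpha> :: real
  assumes "CARD('n::finite) \<ge> 3" and "\<alpha> > 0"
  shows "\<exists>\<delta>>0. \<forall>p. 1 < p \<and> p < 1 + \<delta> \<longrightarrow>
           (\<exists>!u::real^'n \<Rightarrow> real. henon_solution \<alpha> p u) \<and>
           (\<forall>u::real^'n \<Rightarrow> real. henon_solution \<alpha> p u \<longrightarrow>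
              radial u \<and> nondegenerate \<alpha> p u \<and> morse_index \<alpha> p u = 1)"
proof -
  let ?E = "TYPE(real^'n)"
  let ?N = "real DIM(real^'n)"
  have N: "?N \<ge> 1" using DIM_positive[where 'a="real^'n"] by linarith
  obtain K c where K: "K \<ge> 1" and c: "c > 0" and bounds:
    "\<And>p (u::real^'n \<Rightarrow> real). 1 < p \<Longrightarrow> p \<le> 1 + 1 / (2 * ?N) \<Longrightarrow> henon_solution \<alpha> p u \<Longrightarrow>
      \<exists>s>0. s powr (p - 1) \<le> K \<and> (\<forall>x. norm x < 1 \<longrightarrow>
        s * c * (1 - (norm x)\<^sup>2) \<le> u x \<and> u x \<le> s * K * (1 - (norm x)\<^sup>2) \<and> u x \<le> s)"
  proof (rule henon_solution_bounds[OF assms(2), where 'a="real^'n"], goal_cases)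
    case (1 K c) show ?case by (rule 1(1)[OF 1(2,3)]) (use 1(4) in simp)
  qed
  define A where "A = hopf_const ?E * (c * bavg 0 (1 / 5) (\<lambda>x::real^'n. 1 - (norm x)\<^sup>2))"
  have A: "A > 0"
    unfolding A_def by (intro mult_pos_pos hopf_const_pos c bavg_one_minus_sq_pos)
  \<comment> \<open>This is the constant of the uniqueness argument. It is at least K, so the same
    smallness condition serves the linearised problem.\<close>
  define B where "B = (1 + (K\<^sup>2 / c\<^sup>2)\<^sup>2) * K"
  have B: "B > 0" "K \<le> B" using K unfolding B_def by (auto intro!: mult_pos_pos add_pos_nonneg simp: distrib_right)
  \<comment> \<open>The first entry is the range of the a priori bounds; the second makes the
    oscillation of quotients contract strictly.\<close>
  define \<delta> where "\<delta> = min (1 / (2 * ?N)) (A / B)"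
  have \<delta>: "\<delta> > 0" using N A B by (simp add: \<delta>_def)
  have main: "(\<exists>!u::real^'n \<Rightarrow> real. henon_solution \<alpha> p u) \<and>
           (\<forall>u::real^'n \<Rightarrow> real. henon_solution \<alpha> p u \<longrightarrow>
              radial u \<and> nondegenerate \<alpha> p u \<and> morse_index \<alpha> p u = 1)"
    if p: "1 < p" "p < 1 + \<delta>" for p
  proof -
    have pN: "p \<le> 1 + 1 / (2 * ?N)" using p by (simp add: \<delta>_def)
    have "1 / (2 * ?N) \<le> 1" by (rule divide_le_eq_1_pos[THEN iffD2]) (use N in linarith)+
    then have p2: "p \<le> 2" using pN by linarith
    have "p - 1 < A / B" using p by (simp add: \<delta>_def)
    then have small: "(p - 1) * B < A" using B by (simp add: pos_less_divide_eq)
    have small': "(p - 1) * K < A" using mult_left_mono[OF B(2), of "p - 1"] p small by linarith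
    have sol: "u \<in> dirichlet_class" "continuous_on (cball 0 1) u" "\<And>x. norm x = 1 \<Longrightarrow> u x = 0"
        "\<And>x. \<not> norm x < 1 \<Longrightarrow> u x = 0" "\<And>x. norm x < 1 \<Longrightarrow> 0 < u x"
        "haslap (ball 0 1) u (\<lambda>x. \<Sum>b\<in>Basis. partial b u x *\<^sub>R b) (\<lambda>x. - (norm x powr \<alpha> * u x powr p))"
      if "henon_solution \<alpha> p u" for u :: "real^'n \<Rightarrow> real"
    proof -
      have u: "u \<in> dirichlet_class" "\<And>x. x \<in> ball 0 1 \<Longrightarrow> - laplacian u x = norm x powr \<alpha> * u x powr p"
        "\<And>x. x \<in> ball 0 1 \<Longrightarrow> 0 < u x"
        using that unfolding henon_solution_def by blast+
      show "u \<in> dirichlet_class" by fact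
      show "continuous_on (cball 0 1) u" "\<And>x. norm x = 1 \<Longrightarrow> u x = 0" "\<And>x. \<not> norm x < 1 \<Longrightarrow> u x = 0"
        using u(1) by (auto simp: dirichlet_class_def)
      show "0 < u x" if "norm x < 1" for x using u(3)[of x] that by simp
      show "haslap (ball 0 1) u (\<lambda>x. \<Sum>b\<in>Basis. partial b u x *\<^sub>R b) (\<lambda>x. - (norm x powr \<alpha> * u x powr p))"
      proof (rule haslap_cong_lap[OF dirichlet_class_haslap[OF u(1)]])
        fix x :: "real^'n" assume "x \<in> ball 0 1"
        from u(2)[OF this] show "- (norm x powr \<alpha> * u x powr p) = laplacian u x" by simp
      qed
    qed
    have unique: "u = v" if uv: "henon_solution \<alpha> p u" "henon_solution \<alpha> p v" for u v :: "real^'n \<Rightarrow> real"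
    proof
      fix x :: "real^'n"
      obtain su where su: "su > 0" "\<And>x. norm x < 1 \<Longrightarrow> su * c * (1 - (norm x)\<^sup>2) \<le> u x"
          "\<And>x. norm x < 1 \<Longrightarrow> u x \<le> su * K * (1 - (norm x)\<^sup>2)"
        using bounds[OF p(1) pN uv(1)] by blast
      obtain sv where sv: "sv > 0" "sv powr (p - 1) \<le> K" "\<And>x. norm x < 1 \<Longrightarrow> sv * c * (1 - (norm x)\<^sup>2) \<le> v x"
          "\<And>x. norm x < 1 \<Longrightarrow> v x \<le> sv * K * (1 - (norm x)\<^sup>2)" "\<And>x. norm x < 1 \<Longrightarrow> v x \<le> sv"
        using bounds[OF p(1) pN uv(2)] by blast
      show "u x = v x"
      proof (cases "norm x < 1")
        case True
        show ?thesis
          by (rule henon_unique[OF p(1) p2 assms(2) K c sol(6,2,3)[OF uv(1)] sol(6,2,3)[OF uv(2)] su sv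
                small[unfolded A_def B_def] True])
      next
        case False
        then show ?thesis using sol(4)[OF uv(1)] sol(4)[OF uv(2)] by simp
      qed
    qed
    obtain u0 :: "real^'n \<Rightarrow> real" where u0: "henon_solution \<alpha> p u0" "radial u0"
      using henon_radial_solution_exists[OF assms(2) p(1) pN] by blast
    have "radial u \<and> nondegenerate \<alpha> p u \<and> morse_index \<alpha> p u = 1" if u: "henon_solution \<alpha> p u"
      for u :: "real^'n \<Rightarrow> real"
    proof -
      have rad: "radial u" using unique[OF u u0(1)] u0(2) by simp
      note su = sol[OF u]
      obtain s where s: "s > 0" "s powr (p - 1) \<le> K" "\<And>x. norm x < 1 \<Longrightarrow> s * c * (1 - (norm x)\<^sup>2) \<le> u x"
          "\<And>x. norm x < 1 \<Longrightarrow> u x \<le> s * K * (1 - (norm x)\<^sup>2)" "\<And>x. norm x < 1 \<Longrightarrow> u x \<le> s"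
        using bounds[OF p(1) pN u] by blast
      define V where "V x = norm x powr \<alpha> * u x powr (p - 1)" for x :: "real^'n"
      have V_le: "V x \<le> K" if x: "norm x < 1" for x
      proof -
        have "V x \<le> 1 * s powr (p - 1)"
          unfolding V_def using x s(5)[OF x] su(5)[OF x] p assms(2) by (intro mult_mono powr_le1 powr_mono2) auto
        then show ?thesis using s(2) by simp
      qed
      interpret G: ground_profile u V "\<lambda>x. \<Sum>b\<in>Basis. partial b u x *\<^sub>R b" p K c s
      proof
        show "haslap (ball 0 1) u (\<lambda>x. \<Sum>b\<in>Basis. partial b u x *\<^sub>R b) (\<lambda>x. - (V x * u x))"
        proof (rule haslap_cong_lap[OF su(6)])
          fix x :: "real^'n" assume "x \<in> ball 0 1"
          then have "u x powr p = u x powr (p - 1) * u x" using su(5)[of x] by (simp add: powr_diff)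
          then show "- (V x * u x) = - (norm x powr \<alpha> * u x powr p)" by (simp add: V_def)
        qed
        show "0 \<le> V x" for x by (simp add: V_def)
        show "(p - 1) * K < hopf_const TYPE(real^'n) * (c * bavg 0 (1 / 5) (\<lambda>x::real^'n. 1 - (norm x)\<^sup>2))"
          using small' by (simp add: A_def)
      qed (use su s p K c V_le in auto)
      obtain e :: "real^'n" where e: "norm e = 1" using vector_choose_size[of 1] by auto
      \<comment> \<open>Radiality allows the potential to be read along one ray. Clamping |t| to 1
        extends it to a bounded continuous function on the whole line, as the initial value problem
        requires.\<close>
      define q where "q t = min \<bar>t\<bar> 1 powr \<alpha> * u (min \<bar>t\<bar> 1 *\<^sub>R e) powr (p - 1)" for t
      have unonneg: "0 \<le> u x" for x using su(4)[of x] su(5)[of x] by (cases "norm x < 1") auto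
      have q: "continuous_on UNIV q"
        unfolding q_def
      proof (intro continuous_on_mult continuous_on_powr_nonneg)
        show "continuous_on UNIV (\<lambda>t. u (min \<bar>t\<bar> 1 *\<^sub>R e))"
          by (rule continuous_on_compose2[OF su(2)]) (auto intro!: continuous_intros simp: e)
      qed (use assms(2) p unonneg in \<open>auto intro!: continuous_intros\<close>)
      have q_le: "\<bar>q t\<bar> \<le> K" for t
      proof (cases "\<bar>t\<bar> < 1")
        case True
        then have "q t = V (\<bar>t\<bar> *\<^sub>R e)" by (simp add: q_def V_def e)
        then show ?thesis using G.V[of "\<bar>t\<bar> *\<^sub>R e"] True e by simp
      next
        case False
        then show ?thesis using su(3)[OF e] K by (simp add: q_def)
      qed
      have q_V: "V x = q (norm x)" if x: "norm x < 1" for x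
      proof -
        obtain \<phi> where "\<forall>x\<in>ball 0 1. u x = \<phi> (norm x)" using rad unfolding radial_def by blast
        then have "u x = u (norm x *\<^sub>R e)" using x e by simp
        then show ?thesis using x by (simp add: q_def V_def)
      qed
      have es: "G.eigenfunction lam v" if v: "v \<in> eigenspace \<alpha> p u lam" for lam v
      proof -
        have vD: "v \<in> dirichlet_class" and veq: "\<And>x. x \<in> ball 0 1 \<Longrightarrow>
            - laplacian v x - p * norm x powr \<alpha> * u x powr (p - 1) * v x = lam * v x"
          using v by (auto simp: eigenspace_def)
        have "haslap (ball 0 1) v (\<lambda>x. \<Sum>b\<in>Basis. partial b v x *\<^sub>R b) (\<lambda>x. - ((p * V x + lam) * v x))"
        proof (rule haslap_cong_lap[OF dirichlet_class_haslap[OF vD]])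
          fix x :: "real^'n" assume "x \<in> ball 0 1"
          from veq[OF this] show "- ((p * V x + lam) * v x) = laplacian v x"
            by (simp add: V_def algebra_simps)
        qed
        then show ?thesis using vD by (auto simp: G.eigenfunction_def dirichlet_class_def)
      qed
      have es': "v \<in> eigenspace \<alpha> p u lam" if vD: "v \<in> dirichlet_class" and v: "G.eigenfunction lam v" for lam v
      proof -
        obtain Gv where h: "haslap (ball 0 1) v Gv (\<lambda>x. - ((p * V x + lam) * v x))"
          using v by (auto simp: G.eigenfunction_def)
        show ?thesis
          unfolding eigenspace_def
        proof (intro CollectI conjI vD ballI)
          fix x :: "real^'n" assume "x \<in> ball 0 1"
          from haslap_laplacian[OF h this]
          show "- laplacian v x - p * norm x powr \<alpha> * u x powr (p - 1) * v x = lam * v x"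
            by (simp add: V_def algebra_simps)
        qed
      qed
      have zero: "v x = 0" if "v \<in> eigenspace \<alpha> p u 0" for v x
        by (rule G.spectrum_of_linearisation(1)[OF _ _ q q_le _ that]) (fact es es' q_V)+
      have morse: "morse_index \<alpha> p u = 1"
        by (rule G.spectrum_of_linearisation(2)[OF _ _ q q_le]) (fact es es' q_V)+
      have "nondegenerate \<alpha> p u"
        unfolding nondegenerate_def
      proof (intro ballI impI allI)
        fix v :: "real^'n \<Rightarrow> real" and x
        assume "v \<in> dirichlet_class" "\<forall>x\<in>ball 0 1. - laplacian v x = p * norm x powr \<alpha> * u x powr (p - 1) * v x"
        then have "v \<in> eigenspace \<alpha> p u 0" by (simp add: eigenspace_def)
        then show "v x = 0" by (rule zero)
      qed
      then show ?thesis using rad morse by blast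
    qed
    then show ?thesis using u0(1) unique by blast
  qed
  show ?thesis using \<delta> main by blast
qed

end
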